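(* Let $a_{12},a_{21}\in\mathbb{C}_\infty$ with $a_{21}\neq 0$, let $A=\begin{pmatrix}0 & a_{12} \\ a_{21} & 0\end{pmatrix}$, and put $$v:=\operatorname{ord} a_{21},\qquad t:=\operatorname{ord}\left(\frac{\theta^q}{a_{21}}+\frac{\theta^{q^2}}{a_{21}^{q^2}}-a_{12}^q\right).$$ If ($t\ge -v$ and $v\le -\frac{q^2}{q-1}$) or ($t\ge -q^2v$ and $v\ge\frac1{q-1}$), then $h^1(M(A))=0$. For all other values of $(v,t)$, $h^1(M(A))=4$.
   Context: Let $q$ be a power of a prime and $\theta$ a variable. $\mathbb{C}_\infty$ is the completion of an algebraic closure of the completion of $\mathbb{F}_q(\theta)$ at the valuation at infinity $\operatorname{ord}$, normalized by $\operatorname{ord}\theta=-1$ (and $\operatorname{ord}0=+\infty$). $\mathbb{C}_\infty[T,\tau]$ is the ring of non-commutative polynomials with relations $Ta=aT$, $T\tau=\tau T$, $\tau a=a^q\tau$ for $a\in\mathbb{C}_\infty$; $\mathbb{C}_\infty\{\tau\}$ is the subring generated over $\mathbb{C}_\infty$ by $\tau$. For a $2\times2$ matrix $A$ over $\mathbb{C}_\infty$, $M(A)$ is the left $\mathbb{C}_\infty[T,\tau]$-module (Anderson t-motive of dimension 2 and rank 4) which is free over $\mathbb{C}_\infty\{\tau\}$ with basis $e_1,e_2$, where multiplication by $T$ is given, for the column $e_*=(e_1,e_2)^t$, by $Te_*=\theta e_*+A\tau e_*+\tau^2e_*$. It is free of rank 4 over $\mathbb{C}_\infty[T]$. $\mathbb{C}_\infty\{T\}$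 is the ring of power series $\sum_{i\ge0}a_iT^i$ with $a_i\in\mathbb{C}_\infty$, $a_i\to0$, on which $\tau$ acts by $\tau(\sum a_iT^i)=\sum a_i^qT^i$. On $M\otimes_{\mathbb{C}_\infty[T]}\mathbb{C}_\infty\{T\}$, $\tau$ acts by $\tau(m\otimes f)=\tau(m)\otimes\tau(f)$. $H^1(M)$ is the $\mathbb{F}_q[T]$-module of $\tau$-invariant elements of $M\otimes_{\mathbb{C}_\infty[T]}\mathbb{C}_\infty\{T\}$; it is free, and $h^1(M)$ is its rank over $\mathbb{F}_q[T]$. *)

theory Defs
  imports
    "HOL-Algebra.Free_Abelian_Groups"
    "HOL-Algebra.Module"
    "HOL-Computational_Algebra.Computational_Algebra"
    "HOL-Analysis.Analysis"
begin

no_notation fps_nth (infixl \<open>$\<close> 75)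

section \<open>The field of characteristic $p$ complex numbers\<close>

text \<open>
  Valuations are written additively, with values in the reals and \<open>ord 0 = \<infinity>\<close>.
  \<open>Fq q\<close> is the copy of the field with \<open>q\<close> elements in a field of characteristic \<open>p\<close>,
  where \<open>q\<close> is a power of \<open>p\<close>.
\<close>

definition Fq :: "nat \<Rightarrow> 'c::field set" where
  "Fq q = {x. x ^ q = x}"

definition polys_over :: "'c::zero set \<Rightarrow> 'c poly set" where
  "polys_over S = {f. \<forall>i. coeff f i \<in> S}"

definition rational_functions :: "nat \<Rightarrow> 'c::field \<Rightarrow> 'c set" where
  "rational_functions q \<theta> =
     {poly f \<theta> / poly g \<theta> | f g. f \<in> polys_over (Fq q) \<and> g \<in> polys_over (Fq q) \<and> g \<noteq> 0}"

definition ord_closure :: "('c::field \<Rightarrow> ereal) \<Rightarrow> 'c set \<Rightarrow> 'c set" where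
  "ord_closure ord S = {x. \<forall>r::real. \<exists>y\<in>S. ord (x - y) > ereal r}"

definition ord_Cauchy :: "('c::field \<Rightarrow> ereal) \<Rightarrow> (nat \<Rightarrow> 'c) \<Rightarrow> bool" where
  "ord_Cauchy ord X \<longleftrightarrow> (\<forall>r::real. \<exists>N. \<forall>m\<ge>N. \<forall>n\<ge>N. ord (X m - X n) > ereal r)"

definition algebraic_elements :: "'c::field set \<Rightarrow> 'c set" where
  "algebraic_elements S = {x. \<exists>f\<in>polys_over S. f \<noteq> 0 \<and> poly f x = 0}"

text \<open>
  The type \<open>'c\<close>, with \<open>\<theta>\<close> and \<open>ord\<close>, is the completion of an algebraic closure of the
  completion of $\mathbb{F}_q(\theta)$ at infinity. As \<open>'c\<close> is complete, the completion of
  $\mathbb{F}_q(\theta)$ is realised as its closure in \<open>'c\<close>. The algebraic closure is realised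
  as the set of elements of \<open>'c\<close> that are algebraic over that closure; that
  it is algebraically closed and dense in \<open>'c\<close> is assumed. These data are determined by \<open>q\<close>
  up to isomorphism.
\<close>

locale C_infinity =
  fixes q :: nat and \<theta> :: "'c::field" and ord :: "'c \<Rightarrow> ereal"
  assumes q_prime_power: "\<exists>p n. prime p \<and> n > 0 \<and> q = p ^ n \<and> CHAR('c) = p"
    and ord_not_MInf: "ord x \<noteq> -\<infinity>"
    and ord_eq_PInf_iff: "ord x = \<infinity> \<longleftrightarrow> x = 0"
    and ord_mult: "ord (x * y) = ord x + ord y"
    and ord_add: "ord (x + y) \<ge> min (ord x) (ord y)"
    and ord_poly_theta:
      "f \<in> polys_over (Fq q) \<Longrightarrow> f \<noteq> 0 \<Longrightarrow> ord (poly f \<theta>) = - ereal (real (degree f))"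
    and complete: "ord_Cauchy ord X \<Longrightarrow> \<exists>x. (\<lambda>n. ord (X n - x)) \<longlonglongrightarrow> \<infinity>"
    and algebraically_closed:
      "f \<in> polys_over (algebraic_elements (ord_closure ord (rational_functions q \<theta>))) \<Longrightarrow>
         degree f > 0 \<Longrightarrow>
         \<exists>x\<in>algebraic_elements (ord_closure ord (rational_functions q \<theta>)). poly f x = 0"
    and dense:
      "ord_closure ord (algebraic_elements (ord_closure ord (rational_functions q \<theta>))) = UNIV"

section \<open>Tensor products and ranks of modules\<close>

text \<open>
  The tensor product is the free abelian group on pairs modulo the usual relations. The library
  writes its group operation multiplicatively.
\<close>

definition tensor_relations ::
  "('r, 'x) ring_scheme \<Rightarrow> ('r, 'm, 'y) module_scheme \<Rightarrow> ('r, 'n, 'z) module_scheme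
     \<Rightarrow> ('m \<times> 'n \<Rightarrow>\<^sub>0 int) set" where
  "tensor_relations R M N =
     {frag_of (x \<oplus>\<^bsub>M\<^esub> x', y) - frag_of (x, y) - frag_of (x', y) | x x' y.
        x \<in> carrier M \<and> x' \<in> carrier M \<and> y \<in> carrier N} \<union>
     {frag_of (x, y \<oplus>\<^bsub>N\<^esub> y') - frag_of (x, y) - frag_of (x, y') | x y y'.
        x \<in> carrier M \<and> y \<in> carrier N \<and> y' \<in> carrier N} \<union>
     {frag_of (r \<odot>\<^bsub>M\<^esub> x, y) - frag_of (x, r \<odot>\<^bsub>N\<^esub> y) | r x y.
        r \<in> carrier R \<and> x \<in> carrier M \<and> y \<in> carrier N}"

definition tensor_null ::
  "('r, 'x) ring_scheme \<Rightarrow> ('r, 'm, 'y) module_scheme \<Rightarrow> ('r, 'n, 'z) module_scheme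
     \<Rightarrow> ('m \<times> 'n \<Rightarrow>\<^sub>0 int) set" where
  "tensor_null R M N =
     generate (free_Abelian_group (carrier M \<times> carrier N)) (tensor_relations R M N)"

definition tensor_product ::
  "('r, 'x) ring_scheme \<Rightarrow> ('r, 'm, 'y) module_scheme \<Rightarrow> ('r, 'n, 'z) module_scheme
     \<Rightarrow> ('m \<times> 'n \<Rightarrow>\<^sub>0 int) set monoid" where
  "tensor_product R M N =
     free_Abelian_group (carrier M \<times> carrier N) Mod tensor_null R M N"

text \<open>
  The endomorphism of the tensor product that sends $x \otimes y$ to
  $\varphi(x) \otimes \psi(y)$. A coset is sent to the union of the cosets of the images of its
  elements, which is a single coset as soon as this prescription is well defined.
\<close>

definition tensor_map ::
  "('r, 'x) ring_scheme \<Rightarrow> ('r, 'm, 'y) module_scheme \<Rightarrow> ('r, 'n, 'z) module_scheme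
     \<Rightarrow> ('m \<Rightarrow> 'm) \<Rightarrow> ('n \<Rightarrow> 'n)
     \<Rightarrow> ('m \<times> 'n \<Rightarrow>\<^sub>0 int) set \<Rightarrow> ('m \<times> 'n \<Rightarrow>\<^sub>0 int) set" where
  "tensor_map R M N \<phi> \<psi> \<xi> =
     (\<Union>c\<in>\<xi>. tensor_null R M N #>\<^bsub>free_Abelian_group (carrier M \<times> carrier N)\<^esub>
        frag_extend (\<lambda>(x, y). frag_of (\<phi> x, \<psi> y)) c)"

definition finite_basis ::
  "('r, 'x) ring_scheme \<Rightarrow> ('r, 'm, 'y) module_scheme \<Rightarrow> 'm set \<Rightarrow> bool" where
  "finite_basis R M B \<longleftrightarrow>
     finite B \<and> B \<subseteq> carrier M \<and>
     (\<forall>x\<in>carrier M. \<exists>!c. c \<in> B \<rightarrow>\<^sub>E carrier R \<and> x = (\<Oplus>\<^bsub>M\<^esub>b\<in>B. c b \<odot>\<^bsub>M\<^esub> b))"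

text \<open>Meaningful only for a module that has a finite basis, over a nonzero commutative ring.\<close>

definition free_rank ::
  "('r, 'x) ring_scheme \<Rightarrow> ('r, 'm, 'y) module_scheme \<Rightarrow> nat" where
  "free_rank R M = (THE n. \<exists>B. finite_basis R M B \<and> card B = n)"

section \<open>The t-motive of a matrix\<close>

text \<open>
  A polynomial with coefficients $a_i$ is read as the element $\sum_i a_i \tau^i$ of
  $\mathbb{C}_\infty\{\tau\}$. Then \<open>skew_tau\<close> is left multiplication by $\tau$,
  following $\tau a = a^q \tau$.
\<close>

definition skew_tau :: "nat \<Rightarrow> 'c::field poly \<Rightarrow> 'c poly" where
  "skew_tau q P = pCons 0 (map_poly (\<lambda>a. a ^ q) P)"

definition skew_mult :: "nat \<Rightarrow> 'c::field poly \<Rightarrow> 'c poly \<Rightarrow> 'c poly" where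
  "skew_mult q P Q = (\<Sum>i\<le>degree P. Polynomial.smult (coeff P i) ((skew_tau q ^^ i) Q))"

text \<open>
  An element $\sum_j P_j e_j$ of $M(A)$ is the vector of its coordinates
  $P_j \in \mathbb{C}_\infty\{\tau\}$, so $e_j$ is \<open>axis j 1\<close>, and $\tau$, $T$ and the scalars act from the left.
  As $T$ commutes with $\mathbb{C}_\infty\{\tau\}$, it acts through
  $T \sum_j P_j e_j = \sum_j P_j (T e_j)$, where
  $T e_j = \theta e_j + \sum_k A_{jk} \tau e_k + \tau^2 e_j$.
\<close>

definition motive_tau :: "nat \<Rightarrow> 'c::field poly ^ 'n \<Rightarrow> 'c poly ^ 'n" where
  "motive_tau q m = (\<chi> k. skew_tau q (m $ k))"

definition motive_scale :: "'c::field \<Rightarrow> 'c poly ^ 'n \<Rightarrow> 'c poly ^ 'n" where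
  "motive_scale c m = (\<chi> k. Polynomial.smult c (m $ k))"

definition motive_T_basis :: "nat \<Rightarrow> 'c::field \<Rightarrow> 'c ^ 'n ^ 'n \<Rightarrow> 'n \<Rightarrow> 'c poly ^ 'n" where
  "motive_T_basis q \<theta> A j =
     motive_scale \<theta> (axis j 1) +
     (\<Sum>k\<in>UNIV. motive_scale (A $ j $ k) (motive_tau q (axis k 1))) +
     motive_tau q (motive_tau q (axis j 1))"

definition motive_T ::
  "nat \<Rightarrow> 'c::field \<Rightarrow> 'c ^ 'n ^ 'n \<Rightarrow> 'c poly ^ 'n \<Rightarrow> 'c poly ^ 'n" where
  "motive_T q \<theta> A m =
     (\<chi> k. \<Sum>j\<in>UNIV. skew_mult q (m $ j) (motive_T_basis q \<theta> A j $ k))"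

definition motive_poly_scale ::
  "nat \<Rightarrow> 'c::field \<Rightarrow> 'c ^ 'n ^ 'n \<Rightarrow> 'c poly \<Rightarrow> 'c poly ^ 'n \<Rightarrow> 'c poly ^ 'n" where
  "motive_poly_scale q \<theta> A f m =
     (\<Sum>i\<le>degree f. motive_scale (coeff f i) ((motive_T q \<theta> A ^^ i) m))"

section \<open>The module of invariants\<close>

definition poly_ring :: "'c::field set \<Rightarrow> 'c poly ring" where
  "poly_ring S = \<lparr>carrier = polys_over S, monoid.mult = (*), one = 1, zero = 0, add = (+)\<rparr>"

text \<open>
  \<open>M(A)\<close> as a module over $\mathbb{C}_\infty[T]$. Module records extend ring records, and their
  multiplicative part plays no role.
\<close>

definition motive ::
  "nat \<Rightarrow> 'c::field \<Rightarrow> 'c ^ 'n ^ 'n \<Rightarrow> ('c poly, 'c poly ^ 'n) module" where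
  "motive q \<theta> A =
     \<lparr>carrier = UNIV, monoid.mult = undefined, one = undefined, zero = 0, add = (+),
      module.smult = motive_poly_scale q \<theta> A\<rparr>"

definition Tate_algebra :: "('c::field \<Rightarrow> ereal) \<Rightarrow> ('c poly, 'c fps) module" where
  "Tate_algebra ord =
     \<lparr>carrier = {f. (\<lambda>i. ord (fps_nth f i)) \<longlonglongrightarrow> \<infinity>},
      monoid.mult = (*), one = 1, zero = 0, add = (+),
      module.smult = (\<lambda>p f. fps_of_poly p * f)\<rparr>"

definition Tate_tau :: "nat \<Rightarrow> 'c::field fps \<Rightarrow> 'c fps" where
  "Tate_tau q f = Abs_fps (\<lambda>i. fps_nth f i ^ q)"

text \<open>
  $H^1(M(A))$ as a module over $\mathbb{F}_q[T]$, which acts on the tensor product through the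
  second factor.
\<close>

definition H1 ::
  "nat \<Rightarrow> 'c::field \<Rightarrow> ('c \<Rightarrow> ereal) \<Rightarrow> 'c ^ 'n ^ 'n
     \<Rightarrow> ('c poly, (('c poly ^ 'n) \<times> 'c fps \<Rightarrow>\<^sub>0 int) set) module" where
  "H1 q \<theta> ord A =
     (let R = poly_ring UNIV; M = motive q \<theta> A; N = Tate_algebra ord;
          V = tensor_product R M N
      in \<lparr>carrier = {\<xi> \<in> carrier V. tensor_map R M N (motive_tau q) (Tate_tau q) \<xi> = \<xi>},
          monoid.mult = undefined, one = undefined,
          zero = \<one>\<^bsub>V\<^esub>, add = (\<lambda>\<xi> \<eta>. \<xi> \<otimes>\<^bsub>V\<^esub> \<eta>),
          module.smult = (\<lambda>p. tensor_map R M N id (\<lambda>f. fps_of_poly p * f))\<rparr>)"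

definition h1 :: "nat \<Rightarrow> 'c::field \<Rightarrow> ('c \<Rightarrow> ereal) \<Rightarrow> 'c ^ 'n ^ 'n \<Rightarrow> nat" where
  "h1 q \<theta> ord A = free_rank (poly_ring (Fq q)) (H1 q \<theta> ord A)"

end

theory Submission
  imports Defs "HOL-Algebra.Algebraic_Closure_Type"
begin

hide_const (open) Polynomials.degree Polynomials.lead_coeff Divisibility.prime
  UnivPoly.up_ring.coeff UnivPoly.up_ring.monom Polynomial_Divisibility.poly_ring

no_notation fps_nth (infixl \<open>$\<close> 75)

text \<open>
  In the basis $e_1, e_2, \tau e_1, \tau e_2$ a $\tau$-invariant element is determined by one power
  series $\sum_i c_i T^i$, its coordinate at $\tau e_1$. Eliminating the other coordinates, invariance
  becomes a recurrence
  $P(c_i) = \kappa c_{i-1}^{q^2} + \eta c_{i-1}^{q^4} - \varepsilon c_{i-2}^{q^4}$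
  with $P(X) = X + \sigma X^{q^2} + u X^{q^4}$ and $\operatorname{ord} \sigma = v + t$.

  If one of the two conditions holds, then (in the second case after replacing $c$ by $a_{21} c$)
  all coefficients are integral and $\kappa$ is a unit. Let $n$ be the last index where
  $\operatorname{ord} c_i$ is minimal; comparing the terms of minimal valuation of the recurrence for
  $c_n$ and $c_{n+1}$ gives a contradiction.

  Otherwise the Newton polygon of $P$ shows that the recurrence can be solved with
  $\operatorname{ord} c_i \ge \min (\operatorname{ord} c_{i-1}, \operatorname{ord} c_{i-2}) + \delta$ for
  a fixed $\delta > 0$. Hence each of the $q^4$ roots of $P$ is the constant term of an invariant
  element, and four of these elements, with orthogonal constant terms, form a basis.
\<close>

section \<open>Valuation and Frobenius\<close>

text \<open>Only the algebraic elements are assumed algebraically closed, whereas the recurrence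
  needs roots of \<open>P\<close> in all of C_infinity; so the completion must first be shown
  algebraically closed. \<open>H1\<close> consists of cosets of formal sums, hence the tensor
  product is identified with pairs of vectors of Tate series before \<tau> can be computed. The
  elimination rests on \<tau> being bijective on the Tate algebra: the coordinate at \<tau> e_2 is
  recovered by q-th roots. It produces \<epsilon> = a21^(1 - q^2), of valuation E = -(q^2 - 1) v,
  and u = \<theta>^(q^2 + q^3) \<epsilon>, \<kappa> = 1 + \<epsilon>, \<eta> = (\<theta>^(q^2) +
  \<theta>^(q^3)) \<epsilon>. The bounds on v express integrality of u: ord u = E - q^2 - q^3 is
  nonnegative iff v \<le> -q^2 / (q - 1), and after rescaling, which adds (q^4 - 1) v, iff v \<ge> 1
  / (q - 1). The bounds on t express integrality of \<sigma> in the same two normalizations. Ranks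
  are read off from constant terms: a solution with constant term 0 is T times a solution, so there
  are q^rank constant terms.\<close>

context C_infinity
begin

lemma ord_zero [simp]: "ord 0 = \<infinity>"
  by (simp add: ord_eq_PInf_iff)

lemma ord_finite: "x \<noteq> 0 \<Longrightarrow> ord x = ereal (real_of_ereal (ord x))"
  using ord_not_MInf[of x] ord_eq_PInf_iff[of x] by (cases "ord x") auto

lemma ord_one [simp]: "ord 1 = 0"
  using ord_mult[of 1 1] ord_finite[of 1] by (cases "ord 1") auto

lemma ord_power: "ord (x ^ n) = ereal (real n) * ord x"
proof (cases "x = 0")
  case True
  then show ?thesis by (cases "n = 0") (auto simp: zero_ereal_def[symmetric] power_0_left)
next
  case False
  then obtain r where r: "ord x = ereal r" using ord_finite by blast
  show ?thesis unfolding r by (induction n) (auto simp: ord_mult r algebra_simps zero_ereal_def)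
qed

lemma ord_minus_one [simp]: "ord (- 1) = 0"
proof -
  have "ord ((-1) * (-1)) = 0" by simp
  then have "ord (-1) + ord (-1) = 0" by (simp only: ord_mult)
  then show ?thesis using ord_finite[of "-1"] by (cases "ord (-1)") auto
qed

lemma ord_minus [simp]: "ord (- x) = ord x"
  using ord_mult[of "-1" x] by simp

lemma ord_diff: "ord (x - y) \<ge> min (ord x) (ord y)"
  using ord_add[of x "- y"] by simp

lemma ord_add_ge: "ord x \<ge> r \<Longrightarrow> ord y \<ge> r \<Longrightarrow> ord (x + y) \<ge> r"
  using ord_add[of x y] by (meson order.trans min.boundedI)

lemma ord_diff_ge: "ord x \<ge> r \<Longrightarrow> ord y \<ge> r \<Longrightarrow> ord (x - y) \<ge> r"
  using ord_add_ge[of r x "- y"] by simp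

lemma ord_add_gt: "ord x > r \<Longrightarrow> ord y > r \<Longrightarrow> ord (x + y) > r"
  using ord_add[of x y] by (meson min_less_iff_conj less_le_trans)

lemma ord_diff_gt: "ord x > r \<Longrightarrow> ord y > r \<Longrightarrow> ord (x - y) > r"
  using ord_add_gt[of r x "- y"] by simp

lemma ord_sum_ge: "(\<And>i. i \<in> I \<Longrightarrow> ord (f i) \<ge> r) \<Longrightarrow> ord (sum f I) \<ge> r"
  by (induction I rule: infinite_finite_induct) (auto intro: ord_add_ge)

lemma ord_sum_gt: "(\<And>i. i \<in> I \<Longrightarrow> ord (f i) > ereal r) \<Longrightarrow> ord (sum f I) > ereal r"
  by (induction I rule: infinite_finite_induct) (auto intro: ord_add_gt)

text \<open>If the sum had larger valuation than \<open>x\<close>, then so would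
  \<open>x = (x + y) - y\<close>.\<close>

lemma ord_add_eq: assumes "ord x < ord y" shows "ord (x + y) = ord x"
proof -
  have "ord (x + y) \<ge> ord x" using assms by (intro ord_add_ge) auto
  moreover have "ord x \<ge> min (ord (x + y)) (ord y)" using ord_diff[of "x + y" y] by simp
  ultimately show ?thesis using assms by (auto simp: min_def split: if_splits)
qed

lemma ord_inverse: "x \<noteq> 0 \<Longrightarrow> ord (inverse x) = - ord x"
  using ord_mult[of x "inverse x"] ord_finite[of x] ord_finite[of "inverse x"]
  by (cases "ord x"; cases "ord (inverse x)") (auto simp: zero_ereal_def)

lemma ord_divide: "y \<noteq> 0 \<Longrightarrow> ord (x / y) = ord x - ord y"
  using ord_mult[of x "inverse y"] ord_inverse[of y]
  by (simp add: divide_inverse minus_ereal_def)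

section \<open>Powers of the Frobenius and the field F_q\<close>

lemma prime_CHAR: "prime CHAR('c)"
  using q_prime_power by auto

lemma q_gt_1: "q > 1"
  using q_prime_power prime_gt_1_nat one_less_power by blast


lemma frob_add: "(x + y) ^ (q ^ k) = x ^ (q ^ k) + (y :: 'c) ^ (q ^ k)"
proof -
  obtain n where "q = CHAR('c) ^ n" using q_prime_power by auto
  then show ?thesis using freshmans_dream'[OF prime_CHAR, of "q ^ k" "n * k" x y]
    by (simp add: power_mult)
qed

lemma frob_sum: "(sum f A) ^ (q ^ k) = (\<Sum>i\<in>A. (f i :: 'c) ^ (q ^ k))"
  by (induction A rule: infinite_finite_induct) (use q_gt_1 in \<open>auto simp: frob_add power_0_left\<close>)

lemma frob_minus: "(- x) ^ (q ^ k) = - ((x :: 'c) ^ (q ^ k))"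
  using frob_add[of x "- x" k] q_gt_1 by (simp add: power_0_left eq_neg_iff_add_eq_0 add.commute)

lemma frob_diff: "(x - y) ^ (q ^ k) = x ^ (q ^ k) - (y :: 'c) ^ (q ^ k)"
  using frob_add[of x "- y" k] by (simp add: frob_minus)

lemma frob_inj: "(x :: 'c) ^ (q ^ k) = y ^ (q ^ k) \<longleftrightarrow> x = y"
  using frob_diff[of x y k] by auto

lemma Fq_0 [simp]: "(0 :: 'c) \<in> Fq q" and Fq_1 [simp]: "(1 :: 'c) \<in> Fq q"
  using q_gt_1 by (auto simp: Fq_def)

lemma Fq_add: "(x :: 'c) \<in> Fq q \<Longrightarrow> y \<in> Fq q \<Longrightarrow> x + y \<in> Fq q"
  using frob_add[of x y 1] by (auto simp: Fq_def)

lemma Fq_mult: "(x :: 'c) \<in> Fq q \<Longrightarrow> y \<in> Fq q \<Longrightarrow> x * y \<in> Fq q"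
  by (auto simp: Fq_def power_mult_distrib)

lemma Fq_minus: "(x :: 'c) \<in> Fq q \<Longrightarrow> - x \<in> Fq q"
  using frob_minus[of x 1] by (auto simp: Fq_def)

lemma Fq_diff: "(x :: 'c) \<in> Fq q \<Longrightarrow> y \<in> Fq q \<Longrightarrow> x - y \<in> Fq q"
  using Fq_add[of x "- y"] Fq_minus[of y] by simp

lemma Fq_sum: "(\<And>i. i \<in> I \<Longrightarrow> (f i :: 'c) \<in> Fq q) \<Longrightarrow> sum f I \<in> Fq q"
  by (induction I rule: infinite_finite_induct) (auto intro: Fq_add)

lemma Fq_divide: "(x :: 'c) \<in> Fq q \<Longrightarrow> y \<in> Fq q \<Longrightarrow> x / y \<in> Fq q"
  by (auto simp: Fq_def power_divide)

lemma polys_Fq_add: "(f :: 'c poly) \<in> polys_over (Fq q) \<Longrightarrow> g \<in> polys_over (Fq q) \<Longrightarrow> f + g \<in> polys_over (Fq q)"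
  by (auto simp: polys_over_def intro: Fq_add)

lemma polys_Fq_minus: "(f :: 'c poly) \<in> polys_over (Fq q) \<Longrightarrow> - f \<in> polys_over (Fq q)"
  by (auto simp: polys_over_def intro: Fq_minus)

lemma polys_Fq_mult: "(f :: 'c poly) \<in> polys_over (Fq q) \<Longrightarrow> g \<in> polys_over (Fq q) \<Longrightarrow> f * g \<in> polys_over (Fq q)"
  by (auto simp: polys_over_def coeff_mult intro!: Fq_sum Fq_mult)

lemma polys_Fq_const: "(x :: 'c) \<in> Fq q \<Longrightarrow> [:x:] \<in> polys_over (Fq q)"
  by (auto simp: polys_over_def coeff_pCons split: nat.splits)

lemma polys_Fq_pCons: "(x :: 'c) \<in> Fq q \<Longrightarrow> f \<in> polys_over (Fq q) \<Longrightarrow> pCons x f \<in> polys_over (Fq q)"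
  by (auto simp: polys_over_def coeff_pCons split: nat.splits)

lemma ord_theta: "ord \<theta> = - 1"
  using ord_poly_theta[of "[:0, 1:]"] by (simp add: polys_Fq_pCons polys_Fq_const one_ereal_def)

lemma poly_theta_nonzero: "f \<in> polys_over (Fq q) \<Longrightarrow> f \<noteq> 0 \<Longrightarrow> poly f \<theta> \<noteq> 0"
  using ord_poly_theta[of f] by auto

lemma ord_Fq: "x \<in> Fq q \<Longrightarrow> x \<noteq> 0 \<Longrightarrow> ord x = 0"
  using ord_poly_theta[of "[:x:]"] by (simp add: polys_Fq_const zero_ereal_def)

end

section \<open>The field is algebraically closed\<close>

text \<open>HOL-Algebra represents polynomials by coefficient lists with the leading coefficient
  first, hence the \<open>rev\<close>.\<close>

lemma field_eval_eq_poly: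
  "ring.eval (ring_of_type_algebra :: 'c::field ring) p x = poly (Poly (rev p)) x"
proof -
  interpret R: field "ring_of_type_algebra :: 'c ring" by (rule field_from_type_algebra)
  have pow: "x [^]\<^bsub>ring_of_type_algebra\<^esub> (n::nat) = x ^ n" for n
    by (induction n) (auto simp: ring_of_type_algebra_def mult.commute)
  show ?thesis
    by (induction p) (simp_all add: pow Poly_snoc poly_monom, simp_all add: ring_of_type_algebra_def)
qed

text \<open>Translating between the two representations of polynomials makes the HOL-Algebra theory
  of algebraic elements applicable to \<open>algebraic_elements\<close>.\<close>

lemma algebraic_iff_algebraic_elements:
  fixes F :: "'c::field set"
  assumes F: "subfield F ring_of_type_algebra"
  shows "ring.algebraic ring_of_type_algebra F x \<longleftrightarrow> x \<in> algebraic_elements F"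
proof -
  interpret R: field "ring_of_type_algebra :: 'c ring" by (rule field_from_type_algebra)
  have sub: "subring F ring_of_type_algebra" using F by (rule subfieldE)
  have 0: "0 \<in> F" using subringE(2)[OF sub] by (simp add: ring_of_type_algebra_def)
  have carr: "x \<in> carrier ring_of_type_algebra" by (simp add: ring_of_type_algebra_def)
  show ?thesis
  proof
    assume "R.algebraic F x"
    then have "(R.algebraic over F) x" by (simp add: over_def)
    then obtain p where p: "p \<in> carrier (F[X]\<^bsub>ring_of_type_algebra\<^esub>)" "p \<noteq> []" "R.eval p x = \<zero>\<^bsub>ring_of_type_algebra\<^esub>"
      using R.algebraicE[OF sub carr] by blast
    then have p': "set p \<subseteq> F" "hd p \<noteq> 0"
      by (auto simp: univ_poly_def polynomial_def ring_of_type_algebra_def)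
    have "Poly (rev p) \<in> polys_over F"
      using p'(1) 0 by (auto simp: polys_over_def nth_default_def coeff_Poly_eq subset_iff) (metis length_rev nth_mem set_rev)
    moreover have "Poly (rev p) \<noteq> 0"
    proof -
      have "coeff (Poly (rev p)) (length p - 1) = hd p"
        using p(2) by (simp add: coeff_Poly_eq nth_default_def rev_nth hd_conv_nth)
      then show ?thesis using p'(2) by (metis coeff_0)
    qed
    moreover have "poly (Poly (rev p)) x = 0"
      using p(3) unfolding field_eval_eq_poly by (simp add: ring_of_type_algebra_def)
    ultimately show "x \<in> algebraic_elements F" by (auto simp: algebraic_elements_def)
  next
    assume "x \<in> algebraic_elements F"
    then obtain f where f: "f \<in> polys_over F" "f \<noteq> 0" "poly f x = 0"
      by (auto simp: algebraic_elements_def)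
    have "(R.algebraic over F) x"
    proof (rule R.algebraicI)
      show "rev (coeffs f) \<in> carrier (F[X]\<^bsub>ring_of_type_algebra\<^esub>)"
        using f by (auto simp: univ_poly_def polynomial_def ring_of_type_algebra_def polys_over_def
            hd_rev last_coeffs_eq_coeff_degree coeffs_def)
      show "rev (coeffs f) \<noteq> []" using f by simp
      show "R.eval (rev (coeffs f)) x = \<zero>\<^bsub>ring_of_type_algebra\<^esub>"
        using f unfolding field_eval_eq_poly by (simp add: ring_of_type_algebra_def)
    qed
    then show "R.algebraic F x" by (simp add: over_def)
  qed
qed

lemma subring_algebraic_elements:
  fixes F :: "'c::field set"
  assumes F: "subfield F ring_of_type_algebra"
  shows "subring (algebraic_elements F) ring_of_type_algebra"
proof -
  interpret R: field "ring_of_type_algebra :: 'c ring" by (rule field_from_type_algebra)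
  have "{x \<in> carrier ring_of_type_algebra. (R.algebraic over F) x} = algebraic_elements F"
    using algebraic_iff_algebraic_elements[OF F] by (auto simp: over_def) (simp add: ring_of_type_algebra_def)
  then show ?thesis using subfieldE(1)[OF R.subfield_of_algebraics[OF F]] by simp
qed

context C_infinity
begin

text \<open>A real bound covers \<open>ord 0 = \<infinity>\<close> without a case distinction; the
  cap \<open>b\<close> allows several bounds to be merged into one.\<close>

lemma ord_lower_bound: "\<exists>B::real. B \<le> b \<and> ereal B \<le> ord x"
proof (cases "x = 0")
  case False
  then show ?thesis using ord_finite[OF False]
    by (intro exI[of _ "min b (real_of_ereal (ord x))"]) (metis ereal_less_eq(3) min.cobounded1 min.cobounded2)
qed (auto intro: exI[of _ b])

section \<open>The closure of F_q(\<theta>) is a field\<close>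

lemma rational_functionsE:
  assumes "x \<in> rational_functions q \<theta>"
  obtains f g where "f \<in> polys_over (Fq q)" "g \<in> polys_over (Fq q)" "g \<noteq> 0"
    "poly g \<theta> \<noteq> 0" "x = poly f \<theta> / poly g \<theta>"
  using assms poly_theta_nonzero unfolding rational_functions_def by blast

lemma rational_functionsI:
  "f \<in> polys_over (Fq q) \<Longrightarrow> g \<in> polys_over (Fq q) \<Longrightarrow> g \<noteq> 0 \<Longrightarrow> x = poly f \<theta> / poly g \<theta>
   \<Longrightarrow> x \<in> rational_functions q \<theta>"
  unfolding rational_functions_def by blast

lemma rational_functions_1: "1 \<in> rational_functions q \<theta>" "- 1 \<in> rational_functions q \<theta>"
proof -
  have 1: "(1 :: 'c poly) \<in> polys_over (Fq q)" by (simp add: polys_Fq_const one_pCons del: pCons_one)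
  show "1 \<in> rational_functions q \<theta>" by (rule rational_functionsI[OF 1 1]) auto
  show "- 1 \<in> rational_functions q \<theta>" by (rule rational_functionsI[OF polys_Fq_minus[OF 1] 1]) auto
qed

lemma rational_functions_add:
  assumes "x \<in> rational_functions q \<theta>" "y \<in> rational_functions q \<theta>"
  shows "x + y \<in> rational_functions q \<theta>"
proof -
  from assms(1) obtain f g where fg: "f \<in> polys_over (Fq q)" "g \<in> polys_over (Fq q)" "g \<noteq> 0"
    "poly g \<theta> \<noteq> 0" "x = poly f \<theta> / poly g \<theta>" by (rule rational_functionsE)
  from assms(2) obtain h k where hk: "h \<in> polys_over (Fq q)" "k \<in> polys_over (Fq q)" "k \<noteq> 0"
    "poly k \<theta> \<noteq> 0" "y = poly h \<theta> / poly k \<theta>" by (rule rational_functionsE)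
  show ?thesis
    by (rule rational_functionsI[of "f * k + h * g" "g * k"])
      (use fg hk in \<open>auto simp: add_frac_eq intro: polys_Fq_add polys_Fq_mult\<close>)
qed

lemma rational_functions_mult:
  assumes "x \<in> rational_functions q \<theta>" "y \<in> rational_functions q \<theta>"
  shows "x * y \<in> rational_functions q \<theta>"
proof -
  from assms(1) obtain f g where fg: "f \<in> polys_over (Fq q)" "g \<in> polys_over (Fq q)" "g \<noteq> 0"
    "poly g \<theta> \<noteq> 0" "x = poly f \<theta> / poly g \<theta>" by (rule rational_functionsE)
  from assms(2) obtain h k where hk: "h \<in> polys_over (Fq q)" "k \<in> polys_over (Fq q)" "k \<noteq> 0"
    "poly k \<theta> \<noteq> 0" "y = poly h \<theta> / poly k \<theta>" by (rule rational_functionsE)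
  show ?thesis
    by (rule rational_functionsI[of "f * h" "g * k"])
      (use fg hk in \<open>auto intro: polys_Fq_mult\<close>)
qed

lemma rational_functions_inverse:
  assumes "x \<in> rational_functions q \<theta>" "x \<noteq> 0"
  shows "inverse x \<in> rational_functions q \<theta>"
proof -
  from assms(1) obtain f g where fg: "f \<in> polys_over (Fq q)" "g \<in> polys_over (Fq q)" "g \<noteq> 0"
    "poly g \<theta> \<noteq> 0" "x = poly f \<theta> / poly g \<theta>" by (rule rational_functionsE)
  show ?thesis
    by (rule rational_functionsI[of "g" "f"])
      (use fg assms(2) in \<open>auto\<close>)
qed

lemma ord_closureE:
  assumes "x \<in> ord_closure ord S" obtains y where "y \<in> S" "ord (x - y) > ereal r"
  using assms unfolding ord_closure_def by blast

text \<open>This closure is the field F_q((1/\<theta>)). It must be known to be a field before sums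
  and products of elements algebraic over it can be handled. Each operation is approximated by the
  same operation on nearby rational functions.\<close>

lemma subfield_ord_closure_rational_functions:
  "subfield (ord_closure ord (rational_functions q \<theta>)) ring_of_type_algebra"
proof -
  let ?R = "ring_of_type_algebra :: 'c ring"
  let ?S = "rational_functions q \<theta>" and ?F = "ord_closure ord (rational_functions q \<theta>)"
  interpret R: field ?R by (rule field_from_type_algebra)
  have incl: "x \<in> ?F" if "x \<in> ?S" for x
    unfolding ord_closure_def using that by (auto intro!: bexI[of _ x])
  have add: "x + y \<in> ?F" if "x \<in> ?F" "y \<in> ?F" for x y
    unfolding ord_closure_def
  proof (clarify)
    fix r :: real
    obtain x' where x': "x' \<in> ?S" "ord (x - x') > ereal r" using \<open>x \<in> ?F\<close> by (rule ord_closureE)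
    obtain y' where y': "y' \<in> ?S" "ord (y - y') > ereal r" using \<open>y \<in> ?F\<close> by (rule ord_closureE)
    have "x + y - (x' + y') = (x - x') + (y - y')" by simp
    then have "ord (x + y - (x' + y')) > ereal r" using ord_add_gt[OF x'(2) y'(2)] by (simp only:)
    then show "\<exists>z\<in>?S. ereal r < ord (x + y - z)"
      using rational_functions_add[OF x'(1) y'(1)] by blast
  qed
  have mult: "x * y \<in> ?F" if "x \<in> ?F" "y \<in> ?F" for x y
    unfolding ord_closure_def
  proof (clarify)
    fix r :: real
    obtain B where B: "ereal B \<le> ord x" using ord_lower_bound by blast
    obtain C where C: "ereal C \<le> ord y" using ord_lower_bound by blast
    \<comment> \<open>The precision at which each of the three error terms x (y - y'), y (x - x')
      and (x - x') (y - y') has valuation above \<open>r\<close>.\<close>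
    define s where "s = max (r - B) (max (r - C) (max r 0))"
    have s: "s \<ge> r" "s \<ge> 0" by (auto simp: s_def)
    obtain x' where x': "x' \<in> ?S" "ord (x - x') > ereal s" using \<open>x \<in> ?F\<close> by (rule ord_closureE)
    obtain y' where y': "y' \<in> ?S" "ord (y - y') > ereal s" using \<open>y \<in> ?F\<close> by (rule ord_closureE)
    have gt: "ord (u * w) > ereal r" if "ereal b \<le> ord u" "ord w > ereal s" "b + s \<ge> r" for u w b
      unfolding ord_mult using that ord_not_MInf[of u] ord_not_MInf[of w]
      by (cases "ord u"; cases "ord w") auto
    have 1: "ord (x * (y - y')) > ereal r" by (rule gt[OF B y'(2)]) (simp add: s_def)
    have 2: "ord (y * (x - x')) > ereal r" by (rule gt[OF C x'(2)]) (simp add: s_def)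
    have 3: "ord ((x - x') * (y - y')) > ereal r"
      by (rule gt[OF order.strict_implies_order[OF x'(2)] y'(2)]) (use s in linarith)
    have "x * y - x' * y' = x * (y - y') + y * (x - x') - (x - x') * (y - y')"
      by (simp add: algebra_simps)
    then have "ord (x * y - (x' * y')) > ereal r" using ord_diff_gt[OF ord_add_gt[OF 1 2] 3] by (simp only:)
    then show "\<exists>z\<in>?S. ereal r < ord (x * y - z)"
      using rational_functions_mult[OF x'(1) y'(1)] by blast
  qed
  have minus: "- x \<in> ?F" if "x \<in> ?F" for x
    using mult[OF incl[OF rational_functions_1(2)] that] by simp
  have inverse: "inverse x \<in> ?F" if "x \<in> ?F" "x \<noteq> 0" for x
    unfolding ord_closure_def
  proof (clarify)
    fix r :: real
    obtain B where B: "ord x = ereal B" using ord_finite \<open>x \<noteq> 0\<close> by blast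
    \<comment> \<open>Precision \<open>B\<close> forces \<open>ord y = ord x\<close>; the other
      bound pays for the denominator in 1/x - 1/y = -(x - y) / (x y), which costs
      \<open>2 * B\<close>.\<close>
    obtain y where y: "y \<in> ?S" "ord (x - y) > ereal (max B (r + 2 * B))" using \<open>x \<in> ?F\<close> by (rule ord_closureE)
    have "ord x < ord (y - x)"
      using y(2) ord_minus[of "x - y"] B by simp
    then have oy: "ord y = ereal B" using ord_add_eq[of x "y - x"] B by simp
    then have "y \<noteq> 0" by auto
    then have "inverse x - inverse y = - (x - y) / (x * y)" using \<open>x \<noteq> 0\<close> by (simp add: field_simps)
    then have "ord (inverse x - inverse y) = ord (x - y) - (ord x + ord y)"
      using \<open>x \<noteq> 0\<close> \<open>y \<noteq> 0\<close> by (simp only: ord_divide ord_minus ord_mult mult_eq_0_iff simp_thms not_False_eq_True)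
    also have "\<dots> > ereal r" using y(2) unfolding B oy by (cases "ord (x - y)") auto
    finally show "\<exists>z\<in>?S. ereal r < ord (inverse x - z)"
      using rational_functions_inverse[OF y(1) \<open>y \<noteq> 0\<close>] by blast
  qed
  have minv: "\<ominus>\<^bsub>?R\<^esub> x = - x" for x :: 'c
    by (rule R.minus_equality) (auto simp: ring_of_type_algebra_def)
  have inv: "inv\<^bsub>?R\<^esub> x = inverse x" if "x \<noteq> 0" for x :: 'c
    by (rule R.comm_inv_char) (use that in \<open>auto simp: ring_of_type_algebra_def\<close>)
  show ?thesis
  proof (rule R.subfieldI'[OF R.subringI])
    show "?F \<subseteq> carrier ?R" by (simp add: ring_of_type_algebra_def)
    show "\<one>\<^bsub>?R\<^esub> \<in> ?F" using incl[OF rational_functions_1(1)] by (simp add: ring_of_type_algebra_def)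
    fix x y assume xy: "x \<in> ?F" "y \<in> ?F"
    show "\<ominus>\<^bsub>?R\<^esub> x \<in> ?F" using minus[OF xy(1)] by (simp add: minv)
    show "x \<otimes>\<^bsub>?R\<^esub> y \<in> ?F" "x \<oplus>\<^bsub>?R\<^esub> y \<in> ?F"
      using add[OF xy] mult[OF xy] by (simp_all add: ring_of_type_algebra_def)
  next
    fix x assume "x \<in> ?F - {\<zero>\<^bsub>?R\<^esub>}"
    then have "x \<in> ?F" "x \<noteq> 0" by (auto simp: ring_of_type_algebra_def)
    then show "inv\<^bsub>?R\<^esub> x \<in> ?F" using inverse inv by simp
  qed
qed


abbreviation alg_field :: "'c set" where
  "alg_field \<equiv> algebraic_elements (ord_closure ord (rational_functions q \<theta>))"

lemma alg_field_closed:
  "1 \<in> alg_field" "0 \<in> alg_field"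
  "x \<in> alg_field \<Longrightarrow> y \<in> alg_field \<Longrightarrow> x + y \<in> alg_field"
  "x \<in> alg_field \<Longrightarrow> y \<in> alg_field \<Longrightarrow> x * y \<in> alg_field"
proof -
  note sub = subringE[OF subring_algebraic_elements[OF subfield_ord_closure_rational_functions]]
  show "1 \<in> alg_field" "0 \<in> alg_field"
    using sub(2,3) by (simp_all add: ring_of_type_algebra_def)
  show "x \<in> alg_field \<Longrightarrow> y \<in> alg_field \<Longrightarrow> x + y \<in> alg_field"
    "x \<in> alg_field \<Longrightarrow> y \<in> alg_field \<Longrightarrow> x * y \<in> alg_field"
    using sub(6)[of x y] sub(7)[of x y] by (simp_all add: ring_of_type_algebra_def)
qed

text \<open>Horner's scheme builds the value and the quotient from \<open>a\<close> and the
  coefficients by ring operations alone.\<close>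

lemma synthetic_div_alg_field:
  assumes "f \<in> polys_over alg_field" "a \<in> alg_field"
  shows "poly f a \<in> alg_field \<and> synthetic_div f a \<in> polys_over alg_field"
  using assms(1)
proof (induction f)
  case (pCons c f)
  have *: "c \<in> alg_field" "f \<in> polys_over alg_field"
    using pCons.prems by (auto simp: polys_over_def coeff_pCons split: nat.splits)
  then show ?case using pCons.IH[OF *(2)] assms(2)
    by (auto intro!: alg_field_closed simp: polys_over_def coeff_pCons split: nat.splits)
qed (auto simp: polys_over_def alg_field_closed)

lemma alg_field_splits:
  assumes "f \<in> polys_over alg_field" "degree f = n" "lead_coeff f = 1"
  shows "\<exists>xs. set xs \<subseteq> alg_field \<and> length xs = n \<and> f = (\<Prod>x\<leftarrow>xs. [:- x, 1:])"
  using assms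
proof (induction n arbitrary: f)
  case 0
  then have "f = 1" by (metis degree_0_id one_pCons)
  then show ?case by (intro exI[of _ "[]"]) auto
next
  case (Suc n)
  obtain a where a: "a \<in> alg_field" "poly f a = 0"
    using algebraically_closed[of f] Suc.prems by auto
  define g where "g = synthetic_div f a"
  have f: "f = [:- a, 1:] * g" using synthetic_div_correct'[of a f] a by (simp add: g_def)
  have "g \<noteq> 0" using f Suc.prems by auto
  then have "degree g = n" using Suc.prems(2) unfolding f by (subst (asm) degree_mult_eq) auto
  moreover have "lead_coeff g = 1" using Suc.prems(3) unfolding f lead_coeff_mult by simp
  moreover have "g \<in> polys_over alg_field" using synthetic_div_alg_field[OF Suc.prems(1) a(1)] by (simp add: g_def)
  ultimately obtain xs where "set xs \<subseteq> alg_field" "length xs = n" "g = (\<Prod>x\<leftarrow>xs. [:- x, 1:])"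
    using Suc.IH[of g] by blast
  then show ?case using a f by (intro exI[of _ "a # xs"]) auto
qed

section \<open>Roots over the completion by approximation\<close>

lemma close_root:
  assumes "xs \<noteq> []" "ord (poly (\<Prod>x\<leftarrow>xs. [:- x, 1:]) y) \<ge> ereal (real (length xs) * M)"
  shows "\<exists>x\<in>set xs. ord (y - x) \<ge> ereal M"
proof (rule ccontr)
  assume "\<not> ?thesis"
  then have lt: "\<forall>x\<in>set xs. ord (y - x) < ereal M" by (auto simp: not_le)
  have "ord (poly (\<Prod>x\<leftarrow>xs. [:- x, 1:]) y) < ereal (real (length xs) * M)"
    using assms(1) lt
  proof (induction xs rule: list_nonempty_induct)
    case (single x) then show ?case by simp
  next
    case (cons x xs)
    then have "ord (y - x) < ereal M"
      "ord (poly (\<Prod>x\<leftarrow>xs. [:- x, 1:]) y) < ereal (real (length xs) * M)" by auto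
    then have "ord (y - x) + ord (poly (\<Prod>x\<leftarrow>xs. [:- x, 1:]) y) < ereal M + ereal (real (length xs) * M)"
      using ord_not_MInf[of "y - x"]
      by (cases "ord (y - x)"; cases "ord (poly (\<Prod>x\<leftarrow>xs. [:- x, 1:]) y)") auto
    then show ?case by (simp add: ord_mult[symmetric] algebra_simps)
  qed
  then show False using assms(2) by simp
qed

text \<open>For a root with smaller valuation the leading term alone would have the least valuation,
  and the terms could not cancel. \<open>B \<le> 0\<close> makes higher powers of such an element
  strictly dominant.\<close>

lemma ord_root_bound:
  assumes "degree f > 0" "lead_coeff f = 1" "\<And>i. ord (coeff f i) \<ge> ereal B" "B \<le> 0" "poly f x = 0"
  shows "ord x \<ge> ereal B"
proof (rule ccontr)
  assume "\<not> ?thesis"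
  then have lt: "ord x < ereal B" by simp
  then have "x \<noteq> 0" by auto
  then obtain s where "ord x = ereal s" using ord_finite by blast
  with lt have s: "ord x = ereal s" "s < B" by auto
  define n where "n = degree f"
  have "(\<Sum>i\<le>n. coeff f i * x ^ i) = 0" using assms(5) by (simp add: poly_altdef n_def)
  moreover have "{..n} = insert n {..<n}" by auto
  ultimately have "x ^ n + (\<Sum>i<n. coeff f i * x ^ i) = 0" using assms(2) by (simp add: n_def)
  then have "x ^ n = - (\<Sum>i<n. coeff f i * x ^ i)" by (simp add: eq_neg_iff_add_eq_0)
  then have "ord (x ^ n) = ord (\<Sum>i<n. coeff f i * x ^ i)" by simp
  also have "\<dots> > ereal (real n * s)"
  proof (rule ord_sum_gt)
    fix i assume "i \<in> {..<n}"
    then have "real n \<ge> real i + 1" by auto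
    then have "real n * s \<le> (real i + 1) * s" using s assms(4) by (intro mult_right_mono_neg) auto
    then have "real n * s < B + real i * s" using s by (simp add: algebra_simps)
    moreover have "ord (coeff f i * x ^ i) \<ge> ereal B + ereal (real i * s)"
      unfolding ord_mult ord_power s using assms(3)[of i] by (intro add_mono) auto
    ultimately show "ereal (real n * s) < ord (coeff f i * x ^ i)"
      by (metis ereal_less(2) less_le_trans less_ereal.simps(1) plus_ereal.simps(1))
  qed
  finally show False by (simp add: ord_power s)
qed

lemma ord_poly_ge:
  assumes "\<And>i. ord (coeff f i) \<ge> ereal C" "ord x \<ge> ereal B" "B \<le> 0" "degree f \<le> n"
  shows "ord (poly f x) \<ge> ereal (C + real n * B)"
  unfolding poly_altdef
proof (rule ord_sum_ge)
  fix i assume "i \<in> {..degree f}"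
  then have "real n * B \<le> real i * B" using assms(3,4) by (intro mult_right_mono_neg) auto
  then have "ereal (C + real n * B) \<le> ereal C + ereal (real i) * ereal B" by simp
  also have "\<dots> \<le> ord (coeff f i) + ereal (real i) * ord x"
    by (intro add_mono assms ereal_mult_left_mono) auto
  finally show "ereal (C + real n * B) \<le> ord (coeff f i * x ^ i)" by (simp add: ord_mult ord_power)
qed

lemma ord_coeff_lower_bound: "\<exists>B::real. B \<le> 0 \<and> (\<forall>i. ord (coeff f i) \<ge> ereal B)"
proof (induction f)
  case (pCons a f)
  then obtain B where B: "B \<le> 0" "\<forall>i. ord (coeff f i) \<ge> ereal B" by blast
  obtain B' where B': "B' \<le> B" "ereal B' \<le> ord a" using ord_lower_bound by blast
  have "ereal B' \<le> ord (coeff f i)" for i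
    using B(2) B'(1) by (meson ereal_less_eq(3) order.trans)
  then show ?case using B B' by (intro exI[of _ B']) (auto simp: coeff_pCons split: nat.splits)
qed auto

text \<open>Density is applied to the coefficients below the top one; the leading coefficient stays
  exactly 1, so the degree does not change.\<close>

lemma approx_monic:
  fixes g :: "'c poly"
  assumes "degree g = n" "lead_coeff g = 1"
  shows "\<exists>h\<in>polys_over alg_field. degree h = n \<and> lead_coeff h = 1 \<and> (\<forall>i. ord (coeff (g - h) i) \<ge> ereal k)"
proof -
  have "\<exists>y\<in>alg_field. ord (coeff g i - y) > ereal k" for i
    using dense unfolding ord_closure_def by blast
  then obtain a where a: "\<And>i. a i \<in> alg_field" "\<And>i. ord (coeff g i - a i) > ereal k" by metis
  define h where "h = (\<Sum>i<n. monom (a i) i) + monom 1 n"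
  have ch: "coeff h i = (if i < n then a i else if i = n then 1 else 0)" for i
    by (auto simp: h_def coeff_sum)
  then have dh: "degree h = n" by (intro antisym degree_le le_degree) auto
  have "coeff (g - h) i = (if i < n then coeff g i - a i else 0)" for i
    using assms by (auto simp: ch coeff_eq_0)
  then have "\<forall>i. ord (coeff (g - h) i) \<ge> ereal k" using a(2) by (auto intro: less_imp_le)
  moreover have "h \<in> polys_over alg_field" using a(1) by (auto simp: polys_over_def ch alg_field_closed)
  ultimately show ?thesis using ch dh by (intro bexI[of _ h]) auto
qed

lemma ord_Cauchy_linear:
  assumes step: "\<And>k. ord (Y (Suc k) - Y k) \<ge> ereal (a * real k + b)" and a: "a > 0"
  shows "ord_Cauchy ord Y"
  unfolding ord_Cauchy_def
proof
  fix r :: real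
  obtain N :: nat where N: "real N > (r - b) / a" using reals_Archimedean2 by blast
  have gt: "a * real k + b > r" if "k \<ge> N" for k
  proof -
    have "(r - b) / a < real k" using N that by linarith
    then show ?thesis using a by (simp add: field_simps)
  qed
  have *: "ord (Y m - Y N) > ereal r" if "m \<ge> N" for m
    using that
  proof (induction m rule: dec_induct)
    case (step m)
    have "ord (Y (Suc m) - Y m) > ereal r"
      using assms(1)[of m] gt[of m] step.hyps by (metis less_ereal.simps(1) less_le_trans)
    from ord_add_gt[OF this step.IH] show ?case by simp
  qed simp
  show "\<exists>N. \<forall>m\<ge>N. \<forall>n\<ge>N. ereal r < ord (Y m - Y n)"
  proof (intro exI allI impI)
    fix m n assume "m \<ge> N" "n \<ge> N"
    from ord_diff_gt[OF *[OF this(1)] *[OF this(2)]] show "ereal r < ord (Y m - Y n)" by simp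
  qed
qed

text \<open>Approximate \<open>g\<close> by monic \<open>h k\<close> with algebraic coefficients and
  follow the roots. A root x of \<open>h k\<close> makes \<open>h (Suc k)\<close> small at x,
  because the two polynomials are close; since \<open>h (Suc k)\<close> splits, the valuation of
  this value is a sum of n valuations, and one of its roots lies near x. The roots obtained form a
  Cauchy sequence whose limit is a root of \<open>g\<close>.\<close>

lemma monic_poly_root:
  fixes g :: "'c poly"
  assumes g: "degree g > 0" "lead_coeff g = 1"
  shows "\<exists>x. poly g x = 0"
proof -
  define n where "n = degree g"
  have n: "real n > 0" "n > 0" using g by (auto simp: n_def)
  obtain B where B: "B \<le> 0" "\<And>i. ord (coeff g i) \<ge> ereal B" using ord_coeff_lower_bound[of g] by blast
  have "\<forall>k. \<exists>h\<in>polys_over alg_field. degree h = n \<and> lead_coeff h = 1 \<and> (\<forall>i. ord (coeff (g - h) i) \<ge> ereal (real k))"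
    using approx_monic[OF n_def[symmetric] g(2)] by blast
  then obtain h where h: "\<And>k. h k \<in> polys_over alg_field" "\<And>k. degree (h k) = n" "\<And>k. lead_coeff (h k) = 1"
    "\<And>k i. ord (coeff (g - h k) i) \<ge> ereal (real k)" by metis
  have hB: "ord (coeff (h k) i) \<ge> ereal B" for k i
  proof -
    have "coeff (h k) i = coeff g i - coeff (g - h k) i" by simp
    moreover have "ord (coeff (g - h k) i) \<ge> ereal B"
      using h(4)[of k i] B(1) by (meson ereal_less_eq(3) of_nat_0_le_iff order.trans)
    ultimately show ?thesis using ord_diff_ge[OF B(2)[of i]] by metis
  qed
  \<comment> \<open>The largest of the n factors has at least the average valuation, hence the
    division by \<open>n\<close>; the bound still grows linearly in \<open>k\<close>.\<close>
  have "\<exists>y. poly (h (Suc k)) y = 0 \<and> ord (y - x) \<ge> ereal ((real k + real n * B) / real n)"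
    if "poly (h k) x = 0" for k x
  proof -
    have ox: "ord x \<ge> ereal B" using ord_root_bound[OF _ h(3) hB B(1) that] h(2) n by simp
    have c: "ord (coeff (h (Suc k) - h k) i) \<ge> ereal (real k)" for i
    proof -
      have "coeff (h (Suc k) - h k) i = coeff (g - h k) i - coeff (g - h (Suc k)) i" by simp
      moreover have "ord (coeff (g - h (Suc k)) i) \<ge> ereal (real k)"
        using h(4)[of "Suc k" i] by (rule order.trans[rotated]) simp
      ultimately show ?thesis using ord_diff_ge[OF h(4)[of k i]] by metis
    qed
    have "ord (poly (h (Suc k) - h k) x) \<ge> ereal (real k + real n * B)"
      by (rule ord_poly_ge[OF c ox B(1)]) (use h(2) in \<open>auto intro: degree_diff_le\<close>)
    then have val: "ord (poly (h (Suc k)) x) \<ge> ereal (real k + real n * B)" using that by simp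
    obtain xs where xs: "length xs = n" "h (Suc k) = (\<Prod>x\<leftarrow>xs. [:- x, 1:])"
      using alg_field_splits[OF h(1,2,3)] by blast
    obtain y where y: "y \<in> set xs" "ord (x - y) \<ge> ereal ((real k + real n * B) / real n)"
    proof -
      have *: "real (length xs) * ((real k + real n * B) / real n) = real k + real n * B"
        unfolding xs(1) using n(1) by (metis less_irrefl nonzero_mult_div_cancel_left times_divide_eq_right)
      have ne: "xs \<noteq> []" using n xs(1) by auto
      have "ereal (real (length xs) * ((real k + real n * B) / real n)) \<le> ord (poly (\<Prod>x\<leftarrow>xs. [:- x, 1:]) x)"
        unfolding * using val unfolding xs(2) .
      from close_root[OF ne this] show ?thesis using that by blast
    qed
    have "poly (h (Suc k)) y = 0"
      unfolding xs(2) using y(1) by (induction xs) (simp, fastforce)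
    then show ?thesis using y(2) ord_minus[of "x - y"] by auto
  qed
  moreover have "\<exists>x. poly (h 0) x = 0"
    using algebraically_closed[OF h(1)[of 0]] h(2) n by auto
  ultimately have "\<exists>Y. \<forall>k. poly (h k) (Y k) = 0 \<and> ord (Y (Suc k) - Y k) \<ge> ereal ((real k + real n * B) / real n)"
    by (intro dependent_nat_choice)
  then obtain Y where Y: "\<And>k. poly (h k) (Y k) = 0"
    "\<And>k. ord (Y (Suc k) - Y k) \<ge> ereal ((real k + real n * B) / real n)" by blast
  have "ord_Cauchy ord Y"
  proof (rule ord_Cauchy_linear)
    show "ereal (1 / real n * real k + B) \<le> ord (Y (Suc k) - Y k)" for k
      using Y(2)[of k] n(1) by (simp add: add_divide_distrib)
    show "0 < 1 / real n" using n(1) by simp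
  qed
  then obtain x where x: "(\<lambda>k. ord (Y k - x)) \<longlonglongrightarrow> \<infinity>" using complete by blast
  \<comment> \<open>Moving the limit to 0 turns the claim into the vanishing of the constant
    coefficient \<open>c\<close>, which is compared with the small values
    \<open>poly g (Y k)\<close>.\<close>
  define p where "p = pcompose g [:x, 1:]"
  obtain c p' where p: "p = pCons c p'" by (cases p)
  obtain C where C: "C \<le> 0" "\<And>i. ord (coeff p' i) \<ge> ereal C" using ord_coeff_lower_bound[of p'] by blast
  have "ord c > ereal r" for r
  proof -
    have "eventually (\<lambda>k. ord (Y k - x) > ereal (max 0 (r - C))) sequentially"
      using x unfolding tendsto_PInfty by blast
    moreover have "eventually (\<lambda>k. real k > r - real n * B) sequentially"
      by (rule eventually_compose_filterlim[OF eventually_gt_at_top filterlim_real_sequentially])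
    ultimately have "eventually (\<lambda>k. ord (Y k - x) > ereal (max 0 (r - C)) \<and> real k > r - real n * B) sequentially"
      by eventually_elim auto
    then obtain k where k: "ord (Y k - x) > ereal (max 0 (r - C))" "real k > r - real n * B"
      using eventually_happens'[OF sequentially_bot] by blast
    have oX: "ord (Y k) \<ge> ereal B" using ord_root_bound[OF _ h(3) hB B(1) Y(1)] h(2) n by simp
    have "ord (poly (g - h k) (Y k)) \<ge> ereal (real k + real n * B)"
      by (rule ord_poly_ge[OF h(4) oX B(1)]) (use h(2) in \<open>auto intro: degree_diff_le simp: n_def\<close>)
    moreover have "poly (g - h k) (Y k) = poly g (Y k)" using Y(1)[of k] by simp
    moreover have "ereal r < ereal (real k + real n * B)" using k(2) by simp
    ultimately have 1: "ord (poly g (Y k)) > ereal r" by (metis less_le_trans)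
    have "ereal 0 \<le> ereal (max 0 (r - C))" by simp
    then have "ord (Y k - x) \<ge> ereal 0" using k(1) by (meson le_less_trans less_imp_le)
    from ord_poly_ge[OF C(2) this, of "degree p'"] have p'C: "ord (poly p' (Y k - x)) \<ge> ereal C" by simp
    have "ord ((Y k - x) * poly p' (Y k - x)) > ereal r"
      unfolding ord_mult using k(1) p'C by (cases "ord (Y k - x)"; cases "ord (poly p' (Y k - x))") auto
    moreover have "poly g (Y k) = c + (Y k - x) * poly p' (Y k - x)"
    proof -
      have "poly g (Y k) = poly p (Y k - x)" by (simp add: p_def poly_pcompose)
      then show ?thesis by (simp add: p)
    qed
    ultimately show ?thesis using ord_diff_gt[OF 1] by (metis add_diff_cancel_right')
  qed
  then have "c = 0" using ord_finite[of c] by (metis less_irrefl)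
  moreover have "poly g x = poly p 0" by (simp add: p_def poly_pcompose)
  ultimately show ?thesis by (auto simp: p)
qed

lemma poly_root: 
  assumes "degree (f :: 'c poly) > 0"
  shows "\<exists>x. poly f x = 0"
proof -
  define g where "g = Polynomial.smult (inverse (lead_coeff f)) f"
  have "lead_coeff f \<noteq> 0" using assms by auto
  then have "degree g > 0" "lead_coeff g = 1" using assms by (auto simp: g_def)
  then show ?thesis using monic_poly_root[of g] \<open>lead_coeff f \<noteq> 0\<close> by (auto simp: g_def)
qed

text \<open>Split off one root at a time; simplicity says precisely that the root removed is not a
  root of the cofactor.\<close>

lemma card_roots_simple:
  assumes "f \<noteq> 0" "\<And>x. poly (f :: 'c poly) x = 0 \<Longrightarrow> poly (pderiv f) x \<noteq> 0"
  shows "card {x. poly f x = 0} = degree f"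
  using assms
proof (induction "degree f" arbitrary: f)
  case 0
  then obtain c where "f = [:c:]" using degree_eq_zeroE by metis
  then show ?case using 0 by simp
next
  case (Suc n)
  obtain a where a: "poly f a = 0" using poly_root[of f] Suc.hyps by auto
  then obtain g where f: "f = [:- a, 1:] * g" by (auto simp: poly_eq_0_iff_dvd elim: dvdE)
  have g: "g \<noteq> 0" using f Suc.prems(1) by auto
  then have dg: "degree g = n" using Suc.hyps(2) unfolding f by (subst (asm) degree_mult_eq) auto
  have pd: "poly (pderiv f) x = poly g x + (x - a) * poly (pderiv g) x" for x
    unfolding f pderiv_mult by (simp add: pderiv_pCons algebra_simps)
  have ga: "poly g a \<noteq> 0" using Suc.prems(2)[OF a] pd[of a] by simp
  have "poly (pderiv g) x \<noteq> 0" if "poly g x = 0" for x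
    using Suc.prems(2)[of x] pd[of x] that by (auto simp: f)
  then have "card {x. poly g x = 0} = n" using Suc.hyps(1)[of g] dg g by simp
  moreover have "poly f x = (x - a) * poly g x" for x unfolding f by (simp add: algebra_simps)
  then have "{x. poly f x = 0} = insert a {x. poly g x = 0}" by auto
  moreover have "card (insert a {x. poly g x = 0}) = Suc (card {x. poly g x = 0})"
    by (rule card_insert_disjoint) (use ga poly_roots_finite[OF g] in auto)
  ultimately show ?case using Suc.hyps(2) by simp
qed

end

section \<open>Coordinates of the t-motive\<close>

text \<open>The degree of \<open>pCons a f\<close> is irregular at \<open>f = 0\<close>; the
  hypothesis that zero coefficients contribute nothing hides this and allows induction along
  \<open>pCons\<close> for the sums over \<open>{..degree f}\<close> below.\<close>

lemma sum_coeff_pCons: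
  assumes "\<And>i. g i 0 = 0"
  shows "(\<Sum>i\<le>degree (pCons a f). g i (coeff (pCons a f) i)) = g 0 a + (\<Sum>i\<le>degree f. g (Suc i) (coeff f i))"
proof (cases "f = 0")
  case False
  then show ?thesis by (simp add: sum.atMost_Suc_shift del: sum.atMost_Suc)
qed (use assms in auto)

lemma smult_sum_right: "Polynomial.smult c (sum f I) = (\<Sum>i\<in>I. Polynomial.smult c (f i))"
  by (induction I rule: infinite_finite_induct) (auto simp: smult_add_right)

definition poly_tau :: "nat \<Rightarrow> 'c::field poly \<Rightarrow> 'c poly" where
  "poly_tau q = map_poly (\<lambda>a. a ^ q)"

context C_infinity
begin

lemma q_pos [simp]: "q > 0" "q \<noteq> 0" using q_gt_1 by auto

lemma zero_power_q [simp]: "(0 :: 'c) ^ q = 0" by (simp add: power_0_left)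

lemmas frob1_add = frob_add[of _ _ 1, simplified]
lemmas frob1_sum = frob_sum[of _ _ 1, simplified]

lemma coeff_poly_tau [simp]: "coeff (poly_tau q f) i = (coeff f i :: 'c) ^ q"
  by (simp add: poly_tau_def coeff_map_poly)

lemma poly_tau_0 [simp]: "poly_tau q (0 :: 'c poly) = 0"
  and poly_tau_add: "poly_tau q (f + g :: 'c poly) = poly_tau q f + poly_tau q g"
  and poly_tau_smult: "poly_tau q (Polynomial.smult (c :: 'c) f) = Polynomial.smult (c ^ q) (poly_tau q f)"
  and poly_tau_pCons: "poly_tau q (pCons (c :: 'c) f) = pCons (c ^ q) (poly_tau q f)"
  by (auto intro!: poly_eqI simp: frob1_add power_mult_distrib coeff_pCons split: nat.splits)

lemma poly_tau_1 [simp]: "poly_tau q (1 :: 'c poly) = 1"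
  by (simp only: one_pCons poly_tau_pCons poly_tau_0 power_one)

section \<open>Skew polynomials\<close>

lemma skew_tau_conv: "skew_tau q (f :: 'c poly) = pCons 0 (poly_tau q f)"
  by (simp add: skew_tau_def poly_tau_def)

lemma skew_tau_0 [simp]: "skew_tau q (0 :: 'c poly) = 0"
  and skew_tau_add: "skew_tau q (f + g :: 'c poly) = skew_tau q f + skew_tau q g"
  and skew_tau_smult: "skew_tau q (Polynomial.smult (c :: 'c) f) = Polynomial.smult (c ^ q) (skew_tau q f)"
  by (simp_all add: skew_tau_conv poly_tau_add poly_tau_smult)

lemma skew_tau_sum: "skew_tau q (sum h I) = (\<Sum>i\<in>I. skew_tau q (h i :: 'c poly))"
  by (induction I rule: infinite_finite_induct) (auto simp: skew_tau_add)

text \<open>\<open>pCons a f\<close> stands for a + f \<tau>, so its product with g is a g + f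
  (\<tau> g).\<close>

lemma skew_mult_pCons:
  "skew_mult q (pCons a f) (g :: 'c poly) = Polynomial.smult a g + skew_mult q f (skew_tau q g)"
  unfolding skew_mult_def
  by (subst sum_coeff_pCons) (auto simp: funpow_Suc_right simp del: funpow.simps)

lemma skew_mult_0 [simp]: "skew_mult q 0 (g :: 'c poly) = 0"
  by (simp add: skew_mult_def)

lemma skew_mult_1 [simp]: "skew_mult q 1 (g :: 'c poly) = g"
  by (simp only: one_pCons skew_mult_pCons skew_mult_0) simp

lemma skew_mult_add: "skew_mult q (f + f') (g :: 'c poly) = skew_mult q f g + skew_mult q f' g"
  by (induction f f' arbitrary: g rule: poly_induct2) (simp_all add: skew_mult_pCons smult_add_left)

lemma skew_mult_smult: "skew_mult q (Polynomial.smult c f) (g :: 'c poly) = Polynomial.smult c (skew_mult q f g)"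
  by (induction f arbitrary: g) (simp_all add: skew_mult_pCons smult_add_right)

text \<open>This is (\<tau> f) g = \<tau> (f g). Since \<tau> f equals the coefficientwise twist of
  f followed by \<tau> on the right, the induction is done for the twisted polynomial.\<close>

lemma skew_mult_skew_tau: "skew_mult q (skew_tau q f) (g :: 'c poly) = skew_tau q (skew_mult q f g)"
proof -
  have "skew_mult q (poly_tau q f) (skew_tau q g) = skew_tau q (skew_mult q f g)"
    by (induction f arbitrary: g) (simp_all add: skew_mult_pCons poly_tau_pCons skew_tau_add skew_tau_smult)
  then show ?thesis by (simp add: skew_tau_conv[of f] skew_mult_pCons)
qed

section \<open>The actions of \<tau>, of scalars and of T on the motive\<close>

lemma motive_tau_0 [simp]: "motive_tau q (0 :: 'c poly ^ 'n) = 0"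
  and motive_tau_add: "motive_tau q (m + m' :: 'c poly ^ 'n) = motive_tau q m + motive_tau q m'"
  and motive_tau_scale: "motive_tau q (motive_scale c m :: 'c poly ^ 'n) = motive_scale (c ^ q) (motive_tau q m)"
  by (simp_all add: vec_eq_iff motive_tau_def motive_scale_def skew_tau_add skew_tau_smult)

lemma motive_tau_sum: "motive_tau q (sum h I) = (\<Sum>i\<in>I. motive_tau q (h i :: 'c poly ^ 'n))"
  by (induction I rule: infinite_finite_induct) (auto simp: motive_tau_add)

lemma motive_scale_simps [simp]: "motive_scale 0 (m :: 'c poly ^ 'n) = 0" "motive_scale c (0 :: 'c poly ^ 'n) = 0"
   "motive_scale 1 (m :: 'c poly ^ 'n) = m" "motive_scale a (motive_scale b m) = motive_scale (a * b) m"
  by (simp_all add: vec_eq_iff motive_scale_def)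

lemma motive_scale_add: "motive_scale c (m + m' :: 'c poly ^ 'n) = motive_scale c m + motive_scale c m'"
  and motive_scale_add_left: "motive_scale (a + b) (m :: 'c poly ^ 'n) = motive_scale a m + motive_scale b m"
  by (simp_all add: vec_eq_iff motive_scale_def smult_add_right smult_add_left)

lemma motive_scale_sum: "motive_scale c (sum h I) = (\<Sum>i\<in>I. motive_scale c (h i :: 'c poly ^ 'n))"
  by (induction I rule: infinite_finite_induct) (auto simp: motive_scale_add)

lemma motive_T_add: "motive_T q \<theta> A (m + m' :: 'c poly ^ 'n) = motive_T q \<theta> A m + motive_T q \<theta> A m'"
  and motive_T_scale: "motive_T q \<theta> A (motive_scale c m) = motive_scale c (motive_T q \<theta> A m)"
  and motive_T_tau: "motive_T q \<theta> A (motive_tau q m) = motive_tau q (motive_T q \<theta> A m)"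
  by (simp_all add: vec_eq_iff motive_T_def motive_scale_def motive_tau_def skew_mult_add skew_mult_smult
      skew_mult_skew_tau sum.distrib smult_sum_right skew_tau_sum)

lemma motive_T_0 [simp]: "motive_T q \<theta> A (0 :: 'c poly ^ 'n) = 0"
  using motive_T_scale[of A 0 0] by simp

lemma motive_T_axis: "motive_T q \<theta> A (axis j 1 :: 'c poly ^ 'n) = motive_T_basis q \<theta> A j"
proof -
  have "skew_mult q (axis j 1 $ i) g = (if i = j then g else 0)" for i and g :: "'c poly"
    by (simp add: axis_def)
  then show ?thesis by (simp add: vec_eq_iff motive_T_def)
qed

text \<open>The e_j generate the motive under sums, scalars and \<tau>; identities between additive
  maps compatible with scalars and \<tau> thus need checking on the e_j only.\<close>

lemma motive_induct [case_names axis add scale tau]: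
  fixes m :: "'c poly ^ 'n"
  assumes axis: "\<And>j. Q (axis j 1)"
    and add: "\<And>m m'. Q m \<Longrightarrow> Q m' \<Longrightarrow> Q (m + m')"
    and scale: "\<And>c m. Q m \<Longrightarrow> Q (motive_scale c m)"
    and tau: "\<And>m. Q m \<Longrightarrow> Q (motive_tau q m)"
  shows "Q m"
proof -
  have 0: "Q 0" using scale[OF axis, of 0] by simp
  have sum: "Q (sum h I)" if "\<And>i. i \<in> I \<Longrightarrow> Q (h i)" for h :: "'i \<Rightarrow> 'c poly ^ 'n" and I
    using that by (induction I rule: infinite_finite_induct) (auto intro: 0 add)
  have single: "Q (axis j f)" for j and f :: "'c poly"
  proof -
    have "Q (axis j (monom 1 i))" for i
    proof (induction i)
      case 0 then show ?case using axis[of j] by (simp add: monom_0 one_pCons)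
    next
      case (Suc i)
      have "axis j (monom 1 (Suc i)) = motive_tau q (axis j (monom (1 :: 'c) i))"
        by (auto simp: vec_eq_iff motive_tau_def axis_def skew_tau_conv poly_tau_def map_poly_monom monom_Suc)
      then show ?case using tau[OF Suc] by simp
    qed
    then have "Q (\<Sum>i\<le>degree f. motive_scale (coeff f i) (axis j (monom 1 i)))"
      by (intro sum scale)
    moreover have "(\<Sum>i\<le>degree f. motive_scale (coeff f i) (axis j (monom 1 i))) = axis j f"
      by (auto simp: vec_eq_iff axis_def motive_scale_def smult_monom poly_as_sum_of_monoms)
    ultimately show ?thesis by simp
  qed
  have m: "m = (\<Sum>j\<in>UNIV. axis j (m $ j))"
    by (simp add: vec_eq_iff axis_def)
  show ?thesis by (subst m) (intro sum single)
qed

abbreviation "poly_scale A \<equiv> motive_poly_scale q \<theta> A"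

lemma motive_poly_scale_pCons:
  "poly_scale A (pCons a f) (m :: 'c poly ^ 'n)
   = motive_scale a m + poly_scale A f (motive_T q \<theta> A m)"
  unfolding motive_poly_scale_def
  by (subst sum_coeff_pCons) (auto simp: funpow_Suc_right simp del: funpow.simps)

lemma motive_poly_scale_0 [simp]: "poly_scale A 0 (m :: 'c poly ^ 'n) = 0"
  by (simp add: motive_poly_scale_def)

lemma motive_poly_scale_1 [simp]: "poly_scale A 1 (m :: 'c poly ^ 'n) = m"
  by (simp only: one_pCons motive_poly_scale_pCons motive_poly_scale_0) simp

lemma motive_poly_scale_add:
  "poly_scale A (f + g) (m :: 'c poly ^ 'n) = poly_scale A f m + poly_scale A g m"
  by (induction f g arbitrary: m rule: poly_induct2)
    (simp_all add: motive_poly_scale_pCons motive_scale_add_left)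

lemma motive_poly_scale_smult:
  "poly_scale A (Polynomial.smult c f) (m :: 'c poly ^ 'n) = motive_scale c (poly_scale A f m)"
  by (induction f arbitrary: m) (simp_all add: motive_poly_scale_pCons motive_scale_add)

lemma motive_poly_scale_diff:
  "poly_scale A (f - g) (m :: 'c poly ^ 'n) = poly_scale A f m - poly_scale A g m"
  using motive_poly_scale_add[of A "f - g" g m] by (simp add: algebra_simps)

lemma motive_poly_scale_sum:
  "poly_scale A (sum h I) (m :: 'c poly ^ 'n) = (\<Sum>i\<in>I. poly_scale A (h i) m)"
  by (induction I rule: infinite_finite_induct) (auto simp: motive_poly_scale_add)

lemma motive_poly_scale_add_right:
  "poly_scale A f (m + m' :: 'c poly ^ 'n) = poly_scale A f m + poly_scale A f m'"
  by (induction f arbitrary: m m') (simp_all add: motive_poly_scale_pCons motive_scale_add motive_T_add)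

lemma motive_poly_scale_scale:
  "poly_scale A f (motive_scale c m :: 'c poly ^ 'n) = motive_scale c (poly_scale A f m)"
  by (induction f arbitrary: m)
    (simp_all add: motive_poly_scale_pCons motive_scale_add motive_T_scale mult.commute)

lemma motive_poly_scale_sum_right:
  "poly_scale A f (sum h I :: 'c poly ^ 'n) = (\<Sum>i\<in>I. poly_scale A f (h i))"
proof -
  have 0: "poly_scale A f (0 :: 'c poly ^ 'n) = 0"
    using motive_poly_scale_scale[of A f 0 0] by simp
  then show ?thesis by (induction I rule: infinite_finite_induct) (auto simp: motive_poly_scale_add_right)
qed

lemma motive_tau_poly_scale:
  "motive_tau q (poly_scale A f m) = poly_scale A (poly_tau q f) (motive_tau q (m :: 'c poly ^ 'n))"
  by (induction f arbitrary: m)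
    (simp_all add: motive_poly_scale_pCons poly_tau_pCons motive_tau_add motive_tau_scale motive_T_tau)

text \<open>The pair holds the coordinates at the e_j and at the \<tau> e_j. The formula comes from
  \<tau>^2 e_j = (T - \<theta>) e_j - \<Sum>_k A_jk \<tau> e_k, which is the definition of T e_j
  solved for \<tau>^2 e_j.\<close>

definition motive_coord_tau ::
  "'c ^ 'n ^ 'n \<Rightarrow> ('c poly ^ 'n) \<times> ('c poly ^ 'n) \<Rightarrow> ('c poly ^ 'n) \<times> ('c poly ^ 'n)" where
  "motive_coord_tau A v =
     (\<chi> j. [:- \<theta>, 1:] * poly_tau q (snd v $ j),
      \<chi> k. poly_tau q (fst v $ k) - (\<Sum>j\<in>UNIV. Polynomial.smult (A $ j $ k) (poly_tau q (snd v $ j))))"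

definition motive_coord_scale ::
  "'c poly \<Rightarrow> ('c poly ^ 'n) \<times> ('c poly ^ 'n) \<Rightarrow> ('c poly ^ 'n) \<times> ('c poly ^ 'n)" where
  "motive_coord_scale f v = (\<chi> j. f * fst v $ j, \<chi> j. f * snd v $ j)"

lemma motive_coord_scale_simps:
  "motive_coord_scale 0 v = 0" "motive_coord_scale f 0 = 0" "motive_coord_scale 1 v = v"
  "motive_coord_scale (f + g) v = motive_coord_scale f v + motive_coord_scale g v"
  "motive_coord_scale f (v + w) = motive_coord_scale f v + motive_coord_scale f w"
  "motive_coord_scale (f * g) v = motive_coord_scale f (motive_coord_scale g v)"
  by (simp_all add: motive_coord_scale_def vec_eq_iff prod_eq_iff algebra_simps)

lemma motive_coord_scale_sum: "motive_coord_scale f (sum h I) = (\<Sum>i\<in>I. motive_coord_scale f (h i))"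
  by (induction I rule: infinite_finite_induct) (auto simp: motive_coord_scale_simps)

lemma motive_coord_tau_add: "motive_coord_tau A (v + w) = motive_coord_tau A v + motive_coord_tau A w"
  by (simp add: motive_coord_tau_def vec_eq_iff prod_eq_iff poly_tau_add smult_add_right sum.distrib algebra_simps)

lemma motive_coord_tau_scale:
  "motive_coord_tau A (motive_coord_scale f v) = motive_coord_scale (poly_tau q f) (motive_coord_tau A v)"
proof -
  have mult: "poly_tau q (f * g) = poly_tau q f * poly_tau q g" for g :: "'c poly"
    by (rule poly_eqI) (simp add: coeff_mult frob1_sum power_mult_distrib)
  show ?thesis
    by (simp add: motive_coord_tau_def motive_coord_scale_def mult vec_eq_iff prod_eq_iff
      sum_distrib_left right_diff_distrib mult.left_commute del: mult_pCons_left mult_pCons_right)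
qed

lemma motive_coord_tau_0 [simp]: "motive_coord_tau A 0 = 0"
  using motive_coord_tau_add[of A 0 0] by simp

text \<open>The action of \<Sum> a_i \<tau>^i on a coordinate vector.\<close>

definition coord_skew ::
  "'c ^ 'n ^ 'n \<Rightarrow> ('c poly ^ 'n) \<times> ('c poly ^ 'n) \<Rightarrow> 'c poly \<Rightarrow> ('c poly ^ 'n) \<times> ('c poly ^ 'n)" where
  "coord_skew A v f = (\<Sum>i\<le>degree f. motive_coord_scale [:coeff f i:] ((motive_coord_tau A ^^ i) v))"

lemma coord_skew_0 [simp]: "coord_skew A v 0 = 0"
  by (simp add: coord_skew_def motive_coord_scale_simps)

lemma coord_skew_pCons: "coord_skew A v (pCons a f) = motive_coord_scale [:a:] v + coord_skew A (motive_coord_tau A v) f"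
  unfolding coord_skew_def
  by (subst sum_coeff_pCons[of "\<lambda>i a. motive_coord_scale [:a:] ((motive_coord_tau A ^^ i) v)"])
    (auto simp: funpow_Suc_right motive_coord_scale_simps simp del: funpow.simps)

lemma motive_coord_scale_const_add:
  "motive_coord_scale [:a + b:] v = motive_coord_scale [:a:] v + motive_coord_scale [:b:] v"
  using motive_coord_scale_simps(4)[of "[:a:]" "[:b:]" v] by simp

lemma motive_coord_scale_const_mult:
  "motive_coord_scale [:a * b:] v = motive_coord_scale [:a:] (motive_coord_scale [:b:] v)"
  using motive_coord_scale_simps(6)[of "[:a:]" "[:b:]" v] by (simp add: mult.commute)

lemma coord_skew_add: "coord_skew A v (f + g) = coord_skew A v f + coord_skew A v g"
  by (induction f g arbitrary: v rule: poly_induct2)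
    (simp_all add: coord_skew_pCons motive_coord_scale_const_add)

lemma coord_skew_smult: "coord_skew A v (Polynomial.smult c f) = motive_coord_scale [:c:] (coord_skew A v f)"
  by (induction f arbitrary: v)
    (simp_all add: coord_skew_pCons motive_coord_scale_simps(2,5) motive_coord_scale_const_mult)

lemma coord_skew_skew_tau: "coord_skew A v (skew_tau q f) = motive_coord_tau A (coord_skew A v f)"
proof -
  have "coord_skew A (motive_coord_tau A v) (poly_tau q f) = motive_coord_tau A (coord_skew A v f)"
    by (induction f arbitrary: v)
      (simp_all add: coord_skew_pCons poly_tau_pCons motive_coord_tau_add motive_coord_tau_scale)
  then show ?thesis by (simp add: skew_tau_conv coord_skew_pCons motive_coord_scale_simps)
qed

text \<open>The coordinates in $\mathbb{C}_\infty[T]$ with respect to the basis $e_j$, $\tau e_j$.\<close>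

definition motive_coords :: "'c ^ 'n ^ 'n \<Rightarrow> 'c poly ^ 'n \<Rightarrow> ('c poly ^ 'n) \<times> ('c poly ^ 'n)" where
  "motive_coords A m = (\<Sum>j\<in>UNIV. coord_skew A (axis j 1, 0) (m $ j))"

lemma motive_coords_add: "motive_coords A (m + m') = motive_coords A m + motive_coords A m'"
  by (simp add: motive_coords_def coord_skew_add sum.distrib)

lemma motive_coords_scale: "motive_coords A (motive_scale c m) = motive_coord_scale [:c:] (motive_coords A m)"
  by (simp add: motive_coords_def coord_skew_smult motive_coord_scale_sum motive_scale_def)

lemma motive_coord_tau_sum: "motive_coord_tau A (sum h I) = (\<Sum>i\<in>I. motive_coord_tau A (h i))"
  by (induction I rule: infinite_finite_induct) (auto simp: motive_coord_tau_add)

lemma motive_coords_tau: "motive_coords A (motive_tau q m) = motive_coord_tau A (motive_coords A m)"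
  by (simp add: motive_coords_def coord_skew_skew_tau motive_coord_tau_sum motive_tau_def)

lemma motive_coords_axis: "motive_coords A (axis j 1) = (axis j 1, 0)"
proof -
  have "coord_skew A v 1 = v" for v
    by (simp only: one_pCons coord_skew_pCons coord_skew_0) (simp only: one_pCons[symmetric] motive_coord_scale_simps add_0_right)
  then have "coord_skew A (axis k 1, 0) (axis j 1 $ k) = (if k = j then (axis j 1, 0) else 0)" for k
    by (simp add: axis_def)
  then show ?thesis by (simp add: motive_coords_def)
qed

lemma motive_coords_sum: "motive_coords A (sum h I) = (\<Sum>i\<in>I. motive_coords A (h i))"
proof -
  have "motive_coords A 0 = 0" by (simp add: motive_coords_def)
  then show ?thesis by (induction I rule: infinite_finite_induct) (auto simp: motive_coords_add)
qed

text \<open>The entries of \<open>A\<close> in T e_j cancel against those hidden in the coordinates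
  of \<tau>^2 e_j, and \<theta> cancels against T - \<theta>.\<close>

lemma motive_coords_T_basis: "motive_coords A (motive_T_basis q \<theta> A j) = motive_coord_scale [:0, 1:] (axis j 1, 0)"
proof -
  have 1: "motive_coord_tau A (axis k 1, 0) = (0, axis k 1)" for k
    by (simp add: motive_coord_tau_def vec_eq_iff axis_def)
  have 2: "motive_coord_tau A (0, axis j 1) = (axis j [:- \<theta>, 1:], \<chi> k. [:- (A $ j $ k):])"
  proof -
    have "Polynomial.smult (A $ i $ k) (poly_tau q (axis j 1 $ i)) = (if i = j then [:A $ j $ k:] else 0)" for i k
      by (simp add: axis_def)
    then show ?thesis by (auto simp add: motive_coord_tau_def vec_eq_iff axis_def)
  qed
  have "(\<Sum>k\<in>UNIV. motive_coord_scale [:A $ j $ k:] (0, axis k 1)) = (0, \<chi> k. [:A $ j $ k:])"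
  proof -
    have "motive_coord_scale [:A $ j $ k:] (0, axis k 1) = (0, axis k [:A $ j $ k:])" for k
      by (auto simp: motive_coord_scale_def vec_eq_iff axis_def)
    then show ?thesis by (auto simp: prod_eq_iff vec_eq_iff fst_sum snd_sum axis_def)
  qed
  then have "motive_coords A (motive_T_basis q \<theta> A j) =
     motive_coord_scale [:\<theta>:] (axis j 1, 0) + (0, \<chi> k. [:A $ j $ k:]) + (axis j [:- \<theta>, 1:], \<chi> k. [:- (A $ j $ k):])"
    by (simp add: motive_T_basis_def motive_coords_add motive_coords_scale motive_coords_sum motive_coords_tau
        motive_coords_axis 1 2)
  then show ?thesis by (auto simp: motive_coord_scale_def vec_eq_iff axis_def)
qed

text \<open>On both sides T commutes with scalars and with \<tau> (the twist fixes the polynomial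
  T), so the case of e_j suffices.\<close>

lemma motive_coords_T: "motive_coords A (motive_T q \<theta> A m) = motive_coord_scale [:0, 1:] (motive_coords A m)"
proof (induction m rule: motive_induct)
  case (axis j)
  show ?case by (simp add: motive_T_axis motive_coords_T_basis motive_coords_axis)
next
  case (scale c m)
  then show ?case
    by (simp add: motive_T_scale motive_coords_scale motive_coord_scale_simps(6)[symmetric] mult.commute)
next
  case (tau m)
  then show ?case
    by (simp add: motive_T_tau motive_coords_tau motive_coord_tau_scale poly_tau_pCons)
qed (simp add: motive_T_add motive_coords_add motive_coord_scale_simps)

lemma motive_coords_poly_scale: "motive_coords A (poly_scale A f m) = motive_coord_scale f (motive_coords A m)"
proof (induction f arbitrary: m)
  case 0
  then show ?case by (simp add: motive_coords_def motive_coord_scale_simps)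
next
  case (pCons a f)
  have "pCons a f = [:a:] + f * [:0, 1:]" by simp
  then have "motive_coord_scale (pCons a f) (motive_coords A m) = motive_coord_scale [:a:] (motive_coords A m)
      + motive_coord_scale f (motive_coord_scale [:0, 1:] (motive_coords A m))"
    by (simp only: motive_coord_scale_simps)
  then show ?case using pCons.IH
    by (simp only: motive_poly_scale_pCons motive_coords_add motive_coords_scale motive_coords_T)
qed

definition motive_of_coords :: "'c ^ 'n ^ 'n \<Rightarrow> ('c poly ^ 'n) \<times> ('c poly ^ 'n) \<Rightarrow> 'c poly ^ 'n" where
  "motive_of_coords A v = (\<Sum>j\<in>UNIV. poly_scale A (fst v $ j) (axis j 1))
     + (\<Sum>j\<in>UNIV. poly_scale A (snd v $ j) (motive_tau q (axis j 1)))"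

text \<open>The map back to the motive respects \<tau>; this is what lets
  \<open>motive_of_coords_coords\<close> be proved by induction over the generation of the motive
  from the e_j.\<close>

lemma motive_of_coords_tau: "motive_of_coords A (motive_coord_tau A v) = motive_tau q (motive_of_coords A v)"
proof -
  let ?s = "poly_scale A" and ?e = "\<lambda>j. axis j 1 :: 'c poly ^ 'n" and ?t = "motive_tau q"
  obtain x y where v: "v = (x, y)" by (cases v)
  define y' where "y' j = poly_tau q (y $ j)" for j
  \<comment> \<open>The definition of T e_j, solved for \<tau>^2 e_j.\<close>
  have tt: "?t (?t (?e j)) = motive_T q \<theta> A (?e j) - motive_scale \<theta> (?e j)
      - (\<Sum>k\<in>UNIV. motive_scale (A $ j $ k) (?t (?e k)))" for j
    by (simp add: motive_T_axis motive_T_basis_def)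
  have X: "?s ([:- \<theta>, 1:] * f) m = ?s f (motive_T q \<theta> A m) - motive_scale \<theta> (?s f m)" for f m
  proof -
    have "[:- \<theta>, 1:] * f = pCons 0 f - Polynomial.smult \<theta> f" by simp
    then show ?thesis
      by (simp only: motive_poly_scale_diff motive_poly_scale_pCons motive_poly_scale_smult motive_scale_simps add_0_left)
  qed
  have diff: "?s f (m - m') = ?s f m - ?s f m'" for f m m'
    using motive_poly_scale_add_right[of A f "m - m'" m'] by (simp add: algebra_simps)
  have "motive_of_coords A (motive_coord_tau A v) =
     (\<Sum>j\<in>UNIV. ?s ([:- \<theta>, 1:] * y' j) (?e j))
     + ((\<Sum>k\<in>UNIV. ?s (poly_tau q (x $ k)) (?t (?e k)))
        - (\<Sum>k\<in>UNIV. \<Sum>j\<in>UNIV. motive_scale (A $ j $ k) (?s (y' j) (?t (?e k)))))"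
    by (simp add: motive_of_coords_def motive_coord_tau_def v y'_def motive_poly_scale_diff sum_subtractf
        motive_poly_scale_sum motive_poly_scale_smult del: mult_pCons_left)
  also have "(\<Sum>k\<in>UNIV. \<Sum>j\<in>UNIV. motive_scale (A $ j $ k) (?s (y' j) (?t (?e k)))) =
     (\<Sum>j\<in>UNIV. \<Sum>k\<in>UNIV. motive_scale (A $ j $ k) (?s (y' j) (?t (?e k))))"
    by (rule sum.swap)
  also have "(\<Sum>j\<in>UNIV. ?s ([:- \<theta>, 1:] * y' j) (?e j)) + ((\<Sum>k\<in>UNIV. ?s (poly_tau q (x $ k)) (?t (?e k))) - \<dots>)
     = (\<Sum>k\<in>UNIV. ?s (poly_tau q (x $ k)) (?t (?e k))) + (\<Sum>j\<in>UNIV. ?s (y' j) (?t (?t (?e j))))"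
    unfolding tt X diff by (simp add: sum_subtractf sum.distrib motive_poly_scale_sum_right motive_poly_scale_scale algebra_simps)
  also have "\<dots> = ?t (motive_of_coords A v)"
    by (simp add: motive_of_coords_def v y'_def motive_tau_add motive_tau_sum motive_tau_poly_scale)
  finally show ?thesis .
qed

text \<open>The e_j and \<tau> e_j generate the motive over C_infinity[T], with the coordinates as
  coefficients.\<close>

lemma motive_of_coords_coords: "motive_of_coords A (motive_coords A m) = m"
proof (induction m rule: motive_induct)
  case (axis j)
  have "poly_scale A (axis j 1 $ k) (axis k 1) = (if k = j then axis j 1 else 0)" for k
    by (simp add: axis_def)
  then show ?case by (simp add: motive_coords_axis motive_of_coords_def)
next
  case (add m m')
  then show ?case by (simp add: motive_coords_add motive_of_coords_def motive_poly_scale_add sum.distrib algebra_simps)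
next
  case (scale c m)
  have "motive_of_coords A (motive_coord_scale [:c:] v) = motive_scale c (motive_of_coords A v)" for v
    by (simp add: motive_coord_scale_def motive_of_coords_def motive_poly_scale_smult motive_scale_add motive_scale_sum)
  then show ?case by (simp add: motive_coords_scale scale)
next
  case (tau m)
  then show ?case by (simp add: motive_coords_tau motive_of_coords_tau)
qed

end

section \<open>The tensor product with the Tate algebra\<close>

text \<open>The additive extension of \<phi> from generators to formal sums.\<close>

definition frag_sum :: "('k \<Rightarrow> 'b::ring_1) \<Rightarrow> ('k \<Rightarrow>\<^sub>0 int) \<Rightarrow> 'b" where
  "frag_sum \<phi> c = (\<Sum>k\<in>Poly_Mapping.keys c. of_int (Poly_Mapping.lookup c k) * \<phi> k)"

lemma frag_sum_superset:
  "finite S \<Longrightarrow> Poly_Mapping.keys c \<subseteq> S \<Longrightarrow> frag_sum \<phi> c = (\<Sum>k\<in>S. of_int (Poly_Mapping.lookup c k) * \<phi> k)"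
  unfolding frag_sum_def by (rule sum.mono_neutral_left) (auto simp: in_keys_iff)

lemma frag_sum_add: "frag_sum \<phi> (a + b) = frag_sum \<phi> a + frag_sum \<phi> b"
proof -
  let ?S = "Poly_Mapping.keys a \<union> Poly_Mapping.keys b"
  have "frag_sum \<phi> c = (\<Sum>k\<in>?S. of_int (Poly_Mapping.lookup c k) * \<phi> k)" if "c \<in> {a, b, a + b}" for c
    by (rule frag_sum_superset) (use that Poly_Mapping.keys_add[of a b] in auto)
  then show ?thesis by (simp add: lookup_add sum.distrib ring_distribs)
qed

lemma frag_sum_0 [simp]: "frag_sum \<phi> 0 = 0"
  by (simp add: frag_sum_def)

lemma frag_sum_of [simp]: "frag_sum \<phi> (frag_of k) = \<phi> k"
  by (simp add: frag_sum_def)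

lemma frag_sum_diff: "frag_sum \<phi> (a - b) = frag_sum \<phi> a - frag_sum \<phi> b"
  using frag_sum_add[of \<phi> "a - b" b] by (simp add: algebra_simps)

lemma frag_sum_uminus: "frag_sum \<phi> (- a) = - frag_sum \<phi> a"
  using frag_sum_diff[of \<phi> 0 a] by simp

lemma frag_sum_sum: "frag_sum \<phi> (sum h I) = (\<Sum>i\<in>I. frag_sum \<phi> (h i))"
  by (induction I rule: infinite_finite_induct) (auto simp: frag_sum_add)

context C_infinity
begin

section \<open>The Tate algebra\<close>

abbreviation tate :: "'c fps set" where
  "tate \<equiv> carrier (Tate_algebra ord)"

lemma tate_iff: "f \<in> tate \<longleftrightarrow> (\<forall>r::real. eventually (\<lambda>i. ord (fps_nth f i) > ereal r) sequentially)"
  by (simp add: Tate_algebra_def tendsto_PInfty)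

lemma tate_0 [simp]: "0 \<in> tate"
  by (simp add: tate_iff)

lemma tate_add: assumes "f \<in> tate" "g \<in> tate" shows "f + g \<in> tate"
  unfolding tate_iff
proof
  fix r :: real
  from assms have "eventually (\<lambda>i. ord (fps_nth f i) > ereal r) sequentially"
    "eventually (\<lambda>i. ord (fps_nth g i) > ereal r) sequentially" unfolding tate_iff by blast+
  then show "eventually (\<lambda>i. ord (fps_nth (f + g) i) > ereal r) sequentially"
    by eventually_elim (simp add: ord_add_gt)
qed

lemma tate_minus: "f \<in> tate \<Longrightarrow> - f \<in> tate"
  by (simp add: tate_iff)

lemma tate_diff: "f \<in> tate \<Longrightarrow> g \<in> tate \<Longrightarrow> f - g \<in> tate"
  using tate_add[of f "- g"] tate_minus[of g] by simp

lemma tate_const_mult: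
  assumes "f \<in> tate" shows "fps_const c * f \<in> tate"
  unfolding tate_iff
proof
  fix r :: real
  obtain B where B: "ereal B \<le> ord c" using ord_lower_bound by blast
  have "eventually (\<lambda>i. ord (fps_nth f i) > ereal (r - B)) sequentially" using assms tate_iff by blast
  then show "eventually (\<lambda>i. ord (fps_nth (fps_const c * f) i) > ereal r) sequentially"
  proof eventually_elim
    case (elim i)
    then show ?case unfolding fps_mult_left_const_nth ord_mult using B
      by (cases "ord c"; cases "ord (fps_nth f i)") auto
  qed
qed

lemma tate_X_mult_iff: "fps_X * f \<in> tate \<longleftrightarrow> f \<in> tate"
proof -
  have "eventually (\<lambda>i. ord (fps_nth (fps_X * f) i) > ereal r) sequentially \<longleftrightarrow>
     eventually (\<lambda>i. ord (fps_nth f i) > ereal r) sequentially" for r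
    by (subst eventually_sequentially_Suc[symmetric]) simp
  then show ?thesis by (simp add: tate_iff)
qed

lemma tate_poly_mult: "f \<in> tate \<Longrightarrow> fps_of_poly p * f \<in> tate"
proof (induction p)
  case (pCons a p)
  then show ?case
    using tate_add[OF tate_const_mult[of f a] tate_X_mult_iff[THEN iffD2, of "fps_of_poly p * f"]]
    by (simp add: fps_of_poly_pCons algebra_simps)
qed auto

lemma fps_nth_Tate_tau [simp]: "fps_nth (Tate_tau q f) i = fps_nth f i ^ q"
  by (simp add: Tate_tau_def)

lemma tate_tau: assumes "f \<in> tate" shows "Tate_tau q f \<in> tate"
  unfolding tate_iff
proof
  fix r :: real
  \<comment> \<open>Raising to the q-th power multiplies valuations by \<open>q\<close>, which
    raises them only where they are positive; hence the \<open>max 0\<close>.\<close>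
  have "eventually (\<lambda>i. ord (fps_nth f i) > ereal (max 0 r)) sequentially" using assms tate_iff by blast
  then show "eventually (\<lambda>i. ord (fps_nth (Tate_tau q f) i) > ereal r) sequentially"
  proof eventually_elim
    case (elim i)
    show ?case
    proof (cases "ord (fps_nth f i)")
      case (real s)
      then have "s > 0" "s > r" using elim by auto
      moreover have "real q * s \<ge> 1 * s" using q_gt_1 \<open>s > 0\<close> by (intro mult_right_mono) auto
      ultimately have "r < real q * s" by linarith
      then show ?thesis by (simp add: ord_power real)
    qed (use elim in \<open>auto simp: ord_power\<close>)
  qed
qed

lemma Tate_tau_0 [simp]: "Tate_tau q (0 :: 'c fps) = 0"
  and Tate_tau_add: "Tate_tau q (f + g :: 'c fps) = Tate_tau q f + Tate_tau q g"
  by (simp_all add: fps_eq_iff frob1_add)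

lemma Tate_tau_mult: "Tate_tau q (f * g :: 'c fps) = Tate_tau q f * Tate_tau q g"
  by (simp add: fps_eq_iff fps_mult_nth frob1_sum power_mult_distrib)

lemma Tate_tau_of_poly: "Tate_tau q (fps_of_poly p :: 'c fps) = fps_of_poly (poly_tau q p)"
  by (simp add: fps_eq_iff)

section \<open>Coordinates on formal sums of tensors\<close>

abbreviation motive_frag :: "'c ^ 'n ^ 'n \<Rightarrow> (('c poly ^ 'n) \<times> 'c fps \<Rightarrow>\<^sub>0 int) monoid" where
  "motive_frag A \<equiv> free_Abelian_group (carrier (motive q \<theta> A) \<times> tate)"

abbreviation "motive_tensor A \<equiv> tensor_product (poly_ring UNIV) (motive q \<theta> A) (Tate_algebra ord)"
abbreviation "motive_tensor_map A \<equiv> tensor_map (poly_ring UNIV) (motive q \<theta> A) (Tate_algebra ord)"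
abbreviation "motive_relations A \<equiv> tensor_relations (poly_ring UNIV) (motive q \<theta> A) (Tate_algebra ord)"

abbreviation motive_null :: "'c ^ 'n ^ 'n \<Rightarrow> (('c poly ^ 'n) \<times> 'c fps \<Rightarrow>\<^sub>0 int) set" where
  "motive_null A \<equiv> tensor_null (poly_ring UNIV) (motive q \<theta> A) (Tate_algebra ord)"

definition tensor_coords :: "'c ^ 'n ^ 'n \<Rightarrow> (('c poly ^ 'n) \<times> 'c fps \<Rightarrow>\<^sub>0 int) \<Rightarrow> ('c fps ^ 'n) \<times> ('c fps ^ 'n)" where
  "tensor_coords A c =
     (\<chi> j. frag_sum (\<lambda>(m, f). fps_of_poly (fst (motive_coords A m) $ j) * f) c,
      \<chi> j. frag_sum (\<lambda>(m, f). fps_of_poly (snd (motive_coords A m) $ j) * f) c)"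

definition tate_vecs :: "(('c fps ^ 'n) \<times> ('c fps ^ 'n)) set" where
  "tate_vecs = {z. \<forall>j. fst z $ j \<in> tate \<and> snd z $ j \<in> tate}"

text \<open>The formal sum representing \<Sum>_j e_j \<otimes> x_j + \<Sum>_j \<tau> e_j \<otimes>
  y_j: a section of \<open>tensor_coords\<close>.\<close>

definition tensor_std :: "('c fps ^ 'n) \<times> ('c fps ^ 'n) \<Rightarrow> (('c poly ^ 'n) \<times> 'c fps \<Rightarrow>\<^sub>0 int)" where
  "tensor_std z = (\<Sum>j\<in>UNIV. frag_of (axis j 1, fst z $ j)) + (\<Sum>j\<in>UNIV. frag_of (motive_tau q (axis j 1), snd z $ j))"

lemma carrier_motive [simp]: "carrier (motive q \<theta> A) = UNIV"
  and add_motive [simp]: "x \<oplus>\<^bsub>motive q \<theta> A\<^esub> y = x + y"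
  and smult_motive [simp]: "p \<odot>\<^bsub>motive q \<theta> A\<^esub> x = poly_scale A p x"
  by (simp_all add: motive_def)

lemma add_Tate [simp]: "f \<oplus>\<^bsub>Tate_algebra ord\<^esub> g = f + g"
  and smult_Tate [simp]: "p \<odot>\<^bsub>Tate_algebra ord\<^esub> f = fps_of_poly p * f"
  by (simp_all add: Tate_algebra_def)

lemma carrier_poly_ring [simp]: "carrier (poly_ring UNIV) = UNIV"
  by (simp add: poly_ring_def polys_over_def)

abbreviation supported :: "(('c poly ^ 'n) \<times> 'c fps \<Rightarrow>\<^sub>0 int) \<Rightarrow> bool" where
  "supported c \<equiv> Poly_Mapping.keys c \<subseteq> UNIV \<times> tate"

lemma tensor_coords_0 [simp]: "tensor_coords A 0 = 0"
  and tensor_coords_add: "tensor_coords A (a + b) = tensor_coords A a + tensor_coords A b"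
  and tensor_coords_diff: "tensor_coords A (a - b) = tensor_coords A a - tensor_coords A b"
  and tensor_coords_uminus: "tensor_coords A (- a) = - tensor_coords A a"
  by (simp_all add: tensor_coords_def prod_eq_iff vec_eq_iff frag_sum_add frag_sum_diff frag_sum_uminus)

lemma tensor_coords_of:
  "tensor_coords A (frag_of (m, f)) = (\<chi> j. fps_of_poly (fst (motive_coords A m) $ j) * f, \<chi> j. fps_of_poly (snd (motive_coords A m) $ j) * f)"
  by (simp add: tensor_coords_def)

lemma tensor_coords_in_tate_vecs:
  assumes "supported c" shows "tensor_coords A c \<in> tate_vecs"
  using assms
proof (induction c rule: free_Abelian_group_induct[consumes 1, case_names zero diff of])
  case (of a)
  then show ?case by (cases a) (auto simp: tensor_coords_of tate_vecs_def tate_poly_mult)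
qed (auto simp: tensor_coords_diff tate_vecs_def tate_diff)

lemma motive_coords_tau_axis: "motive_coords A (motive_tau q (axis j 1)) = (0, axis j 1)"
  by (simp add: motive_coords_tau motive_coords_axis) (simp add: motive_coord_tau_def vec_eq_iff axis_def)

lemma tensor_coords_std: "tensor_coords A (tensor_std z) = z"
proof -
  have "frag_sum (\<lambda>(m, f). fps_of_poly (fst (motive_coords A m) $ i) * f) (frag_of (axis j 1, f)) = (if j = i then f else 0)"
    "frag_sum (\<lambda>(m, f). fps_of_poly (snd (motive_coords A m) $ i) * f) (frag_of (axis j 1, f)) = 0"
    "frag_sum (\<lambda>(m, f). fps_of_poly (fst (motive_coords A m) $ i) * f) (frag_of (motive_tau q (axis j 1), f)) = 0"
    "frag_sum (\<lambda>(m, f). fps_of_poly (snd (motive_coords A m) $ i) * f) (frag_of (motive_tau q (axis j 1), f)) = (if j = i then f else 0)"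
    for i j f
    by (simp_all add: motive_coords_axis motive_coords_tau_axis) (simp_all add: axis_def)
  then show ?thesis
    by (simp add: tensor_coords_def tensor_std_def frag_sum_add frag_sum_sum prod_eq_iff vec_eq_iff del: frag_sum_of)
qed

lemma tensor_std_in_carrier:
  assumes "z \<in> tate_vecs" shows "tensor_std z \<in> carrier (motive_frag A)"
proof -
  have "(\<Sum>j\<in>UNIV. frag_of (axis j 1, fst z $ j)) \<in> carrier (motive_frag A)"
    "(\<Sum>j\<in>UNIV. frag_of (motive_tau q (axis j 1), snd z $ j)) \<in> carrier (motive_frag A)"
    using assms by (intro sum_closed_free_Abelian_group; simp add: tate_vecs_def)+
  then show ?thesis
    unfolding tensor_std_def carrier_free_Abelian_group_iff by (rule subset_trans[OF keys_add Un_least])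
qed

lemma tensor_relations_subset:
  "motive_relations A \<subseteq> {c. supported c \<and> tensor_coords A c = 0}"
proof -
  have keys: "supported (a - b)"
    if "supported a" "supported b" for a b :: "('c poly ^ 'n) \<times> 'c fps \<Rightarrow>\<^sub>0 int"
    using keys_diff[of a b] that by blast
  show ?thesis
  proof
    fix c assume "c \<in> motive_relations A"
    then consider
      (left) m m' f where "f \<in> tate" "c = frag_of (m + m', f) - frag_of (m, f) - frag_of (m', f)"
    | (right) m f g where "f \<in> tate" "g \<in> tate" "c = frag_of (m, f + g) - frag_of (m, f) - frag_of (m, g)"
    | (scale) p m f where "f \<in> tate" "c = frag_of (poly_scale A p m, f) - frag_of (m, fps_of_poly p * f)"
      unfolding tensor_relations_def by auto
    then show "c \<in> {c. supported c \<and> tensor_coords A c = 0}"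
    proof cases
      case left
      have "tensor_coords A c = 0"
        unfolding left(2) by (simp add: tensor_coords_diff tensor_coords_of motive_coords_add fps_of_poly_add
            prod_eq_iff vec_eq_iff ring_distribs)
      moreover have "supported c" unfolding left(2) by (intro keys) (use left in auto)
      ultimately show ?thesis by simp
    next
      case right
      have "tensor_coords A c = 0"
        unfolding right(3) by (simp add: tensor_coords_diff tensor_coords_of prod_eq_iff vec_eq_iff ring_distribs)
      moreover have "supported c" unfolding right(3) by (intro keys) (use right tate_add in auto)
      ultimately show ?thesis by simp
    next
      case scale
      have "tensor_coords A c = 0"
        unfolding scale(2) by (simp add: tensor_coords_diff tensor_coords_of motive_coords_poly_scale
            motive_coord_scale_def prod_eq_iff vec_eq_iff fps_of_poly_mult mult_ac)
      moreover have "supported c" unfolding scale(2) by (intro keys) (use scale tate_poly_mult in auto)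
      ultimately show ?thesis by simp
    qed
  qed
qed

lemma tensor_relations_carrier:
  "motive_relations A \<subseteq> carrier (motive_frag A)"
  by (rule subset_trans[OF tensor_relations_subset], rule subsetI) simp

lemma motive_null_subgroup: "subgroup (motive_null A) (motive_frag A)"
  unfolding tensor_null_def
  by (rule group.generate_is_subgroup[OF group_free_Abelian_group tensor_relations_carrier])

lemma motive_null_closed:
  "0 \<in> motive_null A" "a \<in> motive_null A \<Longrightarrow> b \<in> motive_null A \<Longrightarrow> a + b \<in> motive_null A"
  "a \<in> motive_null A \<Longrightarrow> - a \<in> motive_null A"
  "a \<in> motive_null A \<Longrightarrow> supported a"
proof -
  note s = motive_null_subgroup[of A]
  show "0 \<in> motive_null A" using subgroup.one_closed[OF s] by simp
  show "a \<in> motive_null A \<Longrightarrow> b \<in> motive_null A \<Longrightarrow> a + b \<in> motive_null A"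
    using subgroup.m_closed[OF s] by simp
  show k: "a \<in> motive_null A \<Longrightarrow> supported a"
    using subgroup.mem_carrier[OF s] by simp
  show "a \<in> motive_null A \<Longrightarrow> - a \<in> motive_null A"
    using subgroup.m_inv_closed[OF s, of a] k by simp
qed

lemma motive_null_diff: "a \<in> motive_null A \<Longrightarrow> b \<in> motive_null A \<Longrightarrow> a - b \<in> motive_null A"
  using motive_null_closed(2)[of a A "- b"] motive_null_closed(3)[of b A] by simp

lemma motive_null_sum: "(\<And>i. i \<in> I \<Longrightarrow> h i \<in> motive_null A) \<Longrightarrow> sum h I \<in> motive_null A"
  by (induction I rule: infinite_finite_induct) (auto intro: motive_null_closed)

lemma motive_null_relations:
  shows "f \<in> tate \<Longrightarrow> frag_of (m + m', f) - frag_of (m, f) - frag_of (m', f) \<in> motive_null A"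
    and "f \<in> tate \<Longrightarrow> g \<in> tate \<Longrightarrow> frag_of (m, f + g) - frag_of (m, f) - frag_of (m, g) \<in> motive_null A"
    and "f \<in> tate \<Longrightarrow> frag_of (poly_scale A p m, f) - frag_of (m, fps_of_poly p * f) \<in> motive_null A"
  unfolding tensor_null_def by (rule generate.incl, force simp: tensor_relations_def)+

lemma frag_of_sum_null:
  assumes "finite I" "f \<in> tate"
  shows "frag_of (sum h I, f) - (\<Sum>i\<in>I. frag_of (h i, f)) \<in> motive_null A"
  using assms(1)
proof (induction I rule: finite_induct)
  case empty
  show ?case using motive_null_closed(3)[OF motive_null_relations(1)[OF assms(2), of 0 0 A]] by simp
next
  case (insert x I)
  from motive_null_closed(2)[OF motive_null_relations(1)[OF assms(2), of "h x" "sum h I" A] insert.IH]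
  show ?case using insert.hyps by (simp add: algebra_simps)
qed

lemma tensor_std_add_null:
  assumes "z \<in> tate_vecs" "w \<in> tate_vecs"
  shows "tensor_std (z + w) - tensor_std z - tensor_std w \<in> motive_null A"
proof -
  have "(\<Sum>j\<in>UNIV. frag_of (axis j 1, fst z $ j + fst w $ j) - frag_of (axis j 1, fst z $ j) - frag_of (axis j 1, fst w $ j))
     + (\<Sum>j\<in>UNIV. frag_of (motive_tau q (axis j 1), snd z $ j + snd w $ j) - frag_of (motive_tau q (axis j 1), snd z $ j)
           - frag_of (motive_tau q (axis j 1), snd w $ j)) \<in> motive_null A"
    by (intro motive_null_closed(2) motive_null_sum motive_null_relations) (use assms in \<open>auto simp: tate_vecs_def\<close>)
  then show ?thesis by (simp add: tensor_std_def sum_subtractf sum.distrib algebra_simps)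
qed

lemma tensor_std_diff_null:
  assumes "z \<in> tate_vecs" "w \<in> tate_vecs"
  shows "tensor_std z - tensor_std w - tensor_std (z - w) \<in> motive_null A"
  using tensor_std_add_null[of "z - w" w A] assms by (auto simp: tate_vecs_def tate_diff algebra_simps)

text \<open>Write m in the generators e_j and \<tau> e_j, split the first factor additively, and
  move the polynomial coefficients across the tensor sign to the Tate series.\<close>

lemma tensor_std_of_null:
  assumes "f \<in> tate"
  shows "frag_of (m, f) - tensor_std (tensor_coords A (frag_of (m, f))) \<in> motive_null A"
proof -
  define x y where "x = fst (motive_coords A m)" and "y = snd (motive_coords A m)"
  let ?e = "\<lambda>j. axis j 1 :: 'c poly ^ 'n" and ?s = "poly_scale A"
  define a where "a = (\<Sum>j\<in>UNIV. ?s (x $ j) (?e j))"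
  define b where "b = (\<Sum>j\<in>UNIV. ?s (y $ j) (motive_tau q (?e j)))"
  have m: "m = a + b" using motive_of_coords_coords[of A m] by (simp add: motive_of_coords_def x_def y_def a_def b_def)
  have 1: "frag_of (m, f) - frag_of (a, f) - frag_of (b, f) \<in> motive_null A"
    unfolding m by (rule motive_null_relations(1)[OF assms])
  have 2: "frag_of (a, f) - (\<Sum>j\<in>UNIV. frag_of (?s (x $ j) (?e j), f)) \<in> motive_null A"
    unfolding a_def by (rule frag_of_sum_null[OF _ assms]) simp
  have 3: "frag_of (b, f) - (\<Sum>j\<in>UNIV. frag_of (?s (y $ j) (motive_tau q (?e j)), f)) \<in> motive_null A"
    unfolding b_def by (rule frag_of_sum_null[OF _ assms]) simp
  have 4: "(\<Sum>j\<in>UNIV. frag_of (?s (x $ j) (?e j), f) - frag_of (?e j, fps_of_poly (x $ j) * f)) \<in> motive_null A"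
    by (intro motive_null_sum motive_null_relations(3)[OF assms])
  have 5: "(\<Sum>j\<in>UNIV. frag_of (?s (y $ j) (motive_tau q (?e j)), f) - frag_of (motive_tau q (?e j), fps_of_poly (y $ j) * f)) \<in> motive_null A"
    by (intro motive_null_sum motive_null_relations(3)[OF assms])
  \<comment> \<open>The five relations telescope to the claim.\<close>
  note sum = motive_null_closed(2)[OF motive_null_closed(2)[OF motive_null_closed(2)[OF motive_null_closed(2)[OF 1 2] 3] 4] 5]
  then show ?thesis
    by (simp add: tensor_std_def tensor_coords_of x_def y_def sum_subtractf algebra_simps)
qed

lemma tensor_std_null:
  assumes "supported c"
  shows "c - tensor_std (tensor_coords A c) \<in> motive_null A"
  using assms
proof (induction c rule: free_Abelian_group_induct[consumes 1, case_names zero diff of])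
  case zero
  have "tensor_std 0 - tensor_std 0 - tensor_std 0 \<in> motive_null A"
    using tensor_std_diff_null[of 0 0 A] by (simp add: tate_vecs_def)
  then show ?case by simp
next
  case (diff x y)
  note z = tensor_coords_in_tate_vecs[OF diff(1), of A] tensor_coords_in_tate_vecs[OF diff(2), of A]
  from motive_null_closed(2)[OF motive_null_diff[OF diff(3,4)] tensor_std_diff_null[OF z, of A]]
  show ?case by (simp add: tensor_coords_diff algebra_simps)
next
  case (of a)
  then show ?case using tensor_std_of_null by (cases a) auto
qed

text \<open>Coordinates are additive in both factors and balanced, so they kill all relations;
  conversely a formal sum agrees modulo relations with the standard sum of its coordinates, which is
  null when they vanish.\<close>

lemma motive_null_eq: "motive_null A = {c. supported c \<and> tensor_coords A c = 0}" (is "_ = ?K")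
proof
  have "subgroup ?K (motive_frag A)"
  proof (rule group.subgroupI[OF group_free_Abelian_group])
    show "?K \<subseteq> carrier (motive_frag A)" by (rule subsetI) simp
    have "0 \<in> ?K" by simp
    then show "?K \<noteq> {}" by blast
    fix a b assume a: "a \<in> ?K" and b: "b \<in> ?K"
    show "inv\<^bsub>motive_frag A\<^esub> a \<in> ?K" using a by (simp add: tensor_coords_uminus)
    have "supported (a + b)" using a b by (intro subset_trans[OF keys_add Un_least]) simp_all
    then show "a \<otimes>\<^bsub>motive_frag A\<^esub> b \<in> ?K" using a b by (simp add: tensor_coords_add)
  qed
  then show "motive_null A \<subseteq> ?K"
    unfolding tensor_null_def
    by (rule group.generate_subgroup_incl[OF group_free_Abelian_group tensor_relations_subset])
  show "?K \<subseteq> motive_null A"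
  proof
    fix c assume "c \<in> ?K"
    then have "c - tensor_std 0 \<in> motive_null A" using tensor_std_null[of c A] by simp
    moreover have "tensor_std 0 \<in> motive_null A"
      using motive_null_closed(3)[OF tensor_std_null[of 0 A]] by simp
    ultimately have "c - tensor_std 0 + tensor_std 0 \<in> motive_null A" by (rule motive_null_closed(2))
    then show "c \<in> motive_null A" by simp
  qed
qed

text \<open>For Tate vectors \<open>z\<close> these fibers are exactly the cosets that make up the
  tensor product, which is thereby parametrized by \<open>tate_vecs\<close>.\<close>

definition tensor_fiber :: "'c ^ 'n ^ 'n \<Rightarrow> ('c fps ^ 'n) \<times> ('c fps ^ 'n) \<Rightarrow> (('c poly ^ 'n) \<times> 'c fps \<Rightarrow>\<^sub>0 int) set" where
  "tensor_fiber A z = {c. supported c \<and> tensor_coords A c = z}"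

lemma tensor_std_in_fiber: "z \<in> tate_vecs \<Longrightarrow> tensor_std z \<in> tensor_fiber A z"
  using tensor_std_in_carrier[of z A] tensor_coords_std[of A z] by (simp add: tensor_fiber_def)

lemma tensor_fiber_inj: "z \<in> tate_vecs \<Longrightarrow> tensor_fiber A z = tensor_fiber A w \<Longrightarrow> z = w"
  using tensor_std_in_fiber[of z A] by (auto simp: tensor_fiber_def)

lemma motive_null_coset:
  assumes "supported c"
  shows "motive_null A #>\<^bsub>motive_frag A\<^esub> c = tensor_fiber A (tensor_coords A c)"
proof (intro Set.set_eqI iffI)
  fix d assume "d \<in> motive_null A #>\<^bsub>motive_frag A\<^esub> c"
  then obtain n where n: "n \<in> motive_null A" "d = n + c" by (auto simp: r_coset_def)
  then show "d \<in> tensor_fiber A (tensor_coords A c)"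
    using assms keys_add[of n c] by (auto simp: tensor_fiber_def motive_null_eq tensor_coords_add)
next
  fix d assume d: "d \<in> tensor_fiber A (tensor_coords A c)"
  then have "d - c \<in> motive_null A"
    using assms keys_diff[of d c] by (auto simp: tensor_fiber_def motive_null_eq tensor_coords_diff)
  then show "d \<in> motive_null A #>\<^bsub>motive_frag A\<^esub> c" by (auto simp: r_coset_def intro!: bexI[of _ "d - c"])
qed

lemma carrier_motive_tensor:
  "carrier (motive_tensor A) = tensor_fiber A ` tate_vecs"
proof -
  have "tensor_fiber A z = motive_null A #>\<^bsub>motive_frag A\<^esub> tensor_std z" if "z \<in> tate_vecs" for z
    using motive_null_coset[of "tensor_std z" A] tensor_std_in_carrier[OF that, of A] by (simp add: tensor_coords_std)
  then have 1: "tensor_fiber A z \<in> rcosets\<^bsub>motive_frag A\<^esub> motive_null A" if "z \<in> tate_vecs" for z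
    using that tensor_std_in_carrier[OF that, of A] unfolding RCOSETS_def by blast
  have 2: "C \<in> tensor_fiber A ` tate_vecs" if C: "C \<in> rcosets\<^bsub>motive_frag A\<^esub> motive_null A" for C
  proof -
    obtain c where c: "c \<in> carrier (motive_frag A)" "C = motive_null A #>\<^bsub>motive_frag A\<^esub> c"
      using C unfolding RCOSETS_def by blast
    then have "supported c" by simp
    then show ?thesis using motive_null_coset[of c A] tensor_coords_in_tate_vecs[of c A] c(2) by simp
  qed
  have "carrier (motive_tensor A) = rcosets\<^bsub>motive_frag A\<^esub> motive_null A"
    by (simp add: tensor_product_def FactGroup_def)
  also have "\<dots> = tensor_fiber A ` tate_vecs" using 1 2 by (intro equalityI subsetI) (blast, blast)
  finally show ?thesis .
qed

lemma mult_motive_tensor: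
  assumes "z \<in> tate_vecs" "w \<in> tate_vecs"
  shows "tensor_fiber A z \<otimes>\<^bsub>motive_tensor A\<^esub> tensor_fiber A w
    = tensor_fiber A (z + w)"
proof -
  have "tensor_fiber A z <#>\<^bsub>motive_frag A\<^esub> tensor_fiber A w = tensor_fiber A (z + w)"
  proof (intro Set.set_eqI iffI)
    fix d assume "d \<in> tensor_fiber A z <#>\<^bsub>motive_frag A\<^esub> tensor_fiber A w"
    then obtain a b where "a \<in> tensor_fiber A z" "b \<in> tensor_fiber A w" "d = a + b" by (auto simp: set_mult_def)
    then show "d \<in> tensor_fiber A (z + w)" using keys_add[of a b] by (auto simp: tensor_fiber_def tensor_coords_add)
  next
    fix d assume d: "d \<in> tensor_fiber A (z + w)"
    have w: "tensor_std w \<in> tensor_fiber A w" using tensor_std_in_fiber[OF assms(2)] .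
    have "d - tensor_std w \<in> tensor_fiber A z"
      using w d keys_diff[of d "tensor_std w"] by (auto simp: tensor_fiber_def tensor_coords_diff)
    then show "d \<in> tensor_fiber A z <#>\<^bsub>motive_frag A\<^esub> tensor_fiber A w"
      unfolding set_mult_def mult_free_Abelian_group UN_iff singleton_iff
      by (rule bexI[rotated]) (rule bexI[OF _ w], simp)
  qed
  then show ?thesis by (simp add: tensor_product_def FactGroup_def)
qed

lemma one_motive_tensor:
  "\<one>\<^bsub>motive_tensor A\<^esub> = tensor_fiber A 0"
  by (simp add: tensor_product_def FactGroup_def motive_null_eq tensor_fiber_def)

text \<open>\<open>\<sigma>\<close> is the additive map of coordinates that \<phi> \<otimes> \<psi>
  induces on generators. Its existence shows that all representatives of a coset have images in one
  coset, so the union in \<open>tensor_map\<close> collapses.\<close>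

lemma tensor_map_fiber:
  assumes z: "z \<in> tate_vecs"
    and add: "\<And>u v. \<sigma> (u + v) = \<sigma> u + \<sigma> v"
    and gen: "\<And>m f. f \<in> tate \<Longrightarrow> tensor_coords A (frag_of (\<phi> m, \<psi> f)) = \<sigma> (tensor_coords A (frag_of (m, f)))"
    and tate: "\<And>f. f \<in> tate \<Longrightarrow> \<psi> f \<in> tate"
  shows "motive_tensor_map A \<phi> \<psi> (tensor_fiber A z) = tensor_fiber A (\<sigma> z)"
proof -
  let ?F = "frag_extend (\<lambda>(x, y). frag_of (\<phi> x, \<psi> y))"
  have sdiff: "\<sigma> (u - v) = \<sigma> u - \<sigma> v" for u v using add[of "u - v" v] by (simp add: algebra_simps)
  have F: "supported (?F c) \<and> tensor_coords A (?F c) = \<sigma> (tensor_coords A c)"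
    if "supported c" for c
    using that
  proof (induction c rule: free_Abelian_group_induct[consumes 1, case_names zero diff of])
    case zero
    then show ?case using sdiff[of 0 0] by simp
  next
    case (diff x y)
    then show ?case using keys_diff[of "?F x" "?F y"] by (auto simp: frag_extend_diff tensor_coords_diff sdiff)
  next
    case (of a)
    then show ?case using gen tate by (cases a) auto
  qed
  have "motive_tensor_map A \<phi> \<psi> (tensor_fiber A z)
    = (\<Union>c\<in>tensor_fiber A z. tensor_fiber A (\<sigma> z))"
    unfolding tensor_map_def
  proof (rule SUP_cong[OF refl])
    fix c assume "c \<in> tensor_fiber A z"
    then have "supported c" "tensor_coords A c = z" by (auto simp: tensor_fiber_def)
    then show "motive_null A #>\<^bsub>motive_frag A\<^esub> ?F c = tensor_fiber A (\<sigma> z)" using F[of c] motive_null_coset[of "?F c" A] by simp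
  qed
  then show ?thesis using tensor_std_in_fiber[OF z, of A] by auto
qed

text \<open>The formula of \<open>motive_coord_tau\<close>, with Tate series in place of
  polynomials.\<close>

definition tensor_tau :: "'c ^ 'n ^ 'n \<Rightarrow> ('c fps ^ 'n) \<times> ('c fps ^ 'n) \<Rightarrow> ('c fps ^ 'n) \<times> ('c fps ^ 'n)" where
  "tensor_tau A z =
     (\<chi> j. fps_of_poly [:- \<theta>, 1:] * Tate_tau q (snd z $ j),
      \<chi> k. Tate_tau q (fst z $ k) - (\<Sum>j\<in>UNIV. fps_const (A $ j $ k) * Tate_tau q (snd z $ j)))"

lemma tensor_map_tau:
  assumes "z \<in> tate_vecs"
  shows "motive_tensor_map A (motive_tau q) (Tate_tau q) (tensor_fiber A z)
    = tensor_fiber A (tensor_tau A z)"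
proof (rule tensor_map_fiber[OF assms])
  show "tensor_tau A (u + v) = tensor_tau A u + tensor_tau A v" for u v
    by (simp add: tensor_tau_def prod_eq_iff vec_eq_iff Tate_tau_add sum.distrib algebra_simps)
  show "tensor_coords A (frag_of (motive_tau q m, Tate_tau q f)) = tensor_tau A (tensor_coords A (frag_of (m, f)))" for m f
    by (simp add: tensor_coords_of motive_coords_tau motive_coord_tau_def tensor_tau_def prod_eq_iff vec_eq_iff
        Tate_tau_mult Tate_tau_of_poly fps_of_poly_mult fps_of_poly_diff fps_of_poly_sum fps_of_poly_smult
        sum_distrib_right left_diff_distrib mult.assoc del: mult_pCons_left)
qed (rule tate_tau)

lemma tensor_map_poly:
  assumes "z \<in> tate_vecs"
  shows "motive_tensor_map A id (\<lambda>f. fps_of_poly p * f) (tensor_fiber A z)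
    = tensor_fiber A (\<chi> j. fps_of_poly p * fst z $ j, \<chi> j. fps_of_poly p * snd z $ j)"
  by (rule tensor_map_fiber[OF assms, of "\<lambda>z. (\<chi> j. fps_of_poly p * fst z $ j, \<chi> j. fps_of_poly p * snd z $ j)"])
    (auto simp: tensor_coords_of tate_poly_mult prod_eq_iff vec_eq_iff ring_distribs mult.left_commute)

end

section \<open>Rank over $\mathbb{F}_q[T]$\<close>

lemma bij_betw_ex1_iff:
  assumes "bij_betw f U V"
  shows "(\<exists>!x. x \<in> U \<and> Q (f x)) \<longleftrightarrow> (\<exists>!y. y \<in> V \<and> Q y)"
proof -
  from assms have inj: "\<And>x y. x \<in> U \<Longrightarrow> y \<in> U \<Longrightarrow> f x = f y \<Longrightarrow> x = y" and img: "V = f ` U"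
    by (auto simp: bij_betw_def inj_on_def)
  show ?thesis
  proof
    assume "\<exists>!x. x \<in> U \<and> Q (f x)"
    then obtain x where "x \<in> U" "Q (f x)" "\<And>x'. x' \<in> U \<Longrightarrow> Q (f x') \<Longrightarrow> x' = x" by blast
    then show "\<exists>!y. y \<in> V \<and> Q y" unfolding img by blast
  next
    assume "\<exists>!y. y \<in> V \<and> Q y"
    then show "\<exists>!x. x \<in> U \<and> Q (f x)" unfolding img using inj by blast
  qed
qed

text \<open>A basis is indexed by its own elements, so transporting it along \<open>g\<close>
  changes the domain of the extensional coefficient families; uniqueness of coefficients is carried
  over by this bijection.\<close>

lemma bij_betw_reindex_PiE:
  assumes "inj_on g B"
  shows "bij_betw (\<lambda>c. \<lambda>b\<in>B. c (g b)) (g ` B \<rightarrow>\<^sub>E R) (B \<rightarrow>\<^sub>E R)"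
proof (rule bij_betwI[where g = "\<lambda>c. \<lambda>x\<in>g ` B. c (the_inv_into B g x)"])
  show "(\<lambda>c. \<lambda>b\<in>B. c (g b)) \<in> (g ` B \<rightarrow>\<^sub>E R) \<rightarrow> (B \<rightarrow>\<^sub>E R)" by auto
  show "(\<lambda>c. \<lambda>x\<in>g ` B. c (the_inv_into B g x)) \<in> (B \<rightarrow>\<^sub>E R) \<rightarrow> (g ` B \<rightarrow>\<^sub>E R)"
    using assms by (auto simp: the_inv_into_f_f PiE_iff)
  show "(\<lambda>x\<in>g ` B. (\<lambda>b\<in>B. c (g b)) (the_inv_into B g x)) = c" if "c \<in> g ` B \<rightarrow>\<^sub>E R" for c
    by (rule PiE_ext[OF _ that]) (use that assms in \<open>auto simp: the_inv_into_f_f\<close>)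
  show "(\<lambda>b\<in>B. (\<lambda>x\<in>g ` B. c (the_inv_into B g x)) (g b)) = c" if "c \<in> B \<rightarrow>\<^sub>E R" for c
    by (rule PiE_ext[OF _ that]) (use that assms in \<open>auto simp: the_inv_into_f_f\<close>)
qed

context C_infinity
begin

lemma of_nat_q [simp]: "of_nat q = (0 :: 'c)"
proof -
  obtain n where "q = CHAR('c) ^ n" "n > 0" using q_prime_power by auto
  then show ?thesis by simp
qed

lemma card_Fq: "card (Fq q :: 'c set) = q"
proof -
  define f :: "'c poly" where "f = monom 1 q - monom 1 1"
  have deg: "degree f = q"
  proof (rule antisym)
    show "degree f \<le> q" unfolding f_def using q_gt_1 by (intro degree_le) auto
    show "q \<le> degree f" unfolding f_def using q_gt_1 by (intro le_degree) auto
  qed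
  have "pderiv f = [:- 1:]"
    by (simp add: f_def pderiv_diff pderiv_monom monom_0)
  then have "poly (pderiv f) x \<noteq> 0" for x by simp
  moreover have "f \<noteq> 0" using deg by auto
  ultimately have "card {x. poly f x = 0} = q" using card_roots_simple[of f] deg by simp
  moreover have "{x. poly f x = 0} = Fq q" by (auto simp: f_def Fq_def poly_monom)
  ultimately show ?thesis by simp
qed

lemma finite_Fq: "finite (Fq q :: 'c set)"
  using card_Fq by (intro card_ge_0_finite) simp

end

text \<open>By \<open>S_shift\<close> the solutions with constant term 0 are exactly T S, so the
  constant terms form a copy of S / T S inside C_infinity.\<close>

locale Fq_T_submodule = C_infinity q \<theta> ord for q and \<theta> :: "'c::field" and ord +
  fixes S :: "'c fps set"
  assumes S_0: "0 \<in> S"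
    and S_add: "f \<in> S \<Longrightarrow> g \<in> S \<Longrightarrow> f + g \<in> S"
    and S_mult: "p \<in> polys_over (Fq q) \<Longrightarrow> f \<in> S \<Longrightarrow> fps_of_poly p * f \<in> S"
    and S_shift: "fps_X * f \<in> S \<Longrightarrow> f \<in> S"
begin

definition fps_basis :: "'c fps set \<Rightarrow> bool" where
  "fps_basis B \<longleftrightarrow> finite B \<and> B \<subseteq> S \<and>
     (\<forall>f\<in>S. \<exists>!c. c \<in> B \<rightarrow>\<^sub>E polys_over (Fq q) \<and> f = (\<Sum>b\<in>B. fps_of_poly (c b) * b))"

lemma S_sum: "(\<And>i. i \<in> I \<Longrightarrow> h i \<in> S) \<Longrightarrow> sum h I \<in> S"
  by (induction I rule: infinite_finite_induct) (auto intro: S_0 S_add)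

lemma fps_basis_unique:
  assumes B: "fps_basis B" and c: "\<And>b. b \<in> B \<Longrightarrow> c b \<in> polys_over (Fq q)"
    and 0: "(\<Sum>b\<in>B. fps_of_poly (c b) * b) = 0" and b: "b \<in> B"
  shows "c b = 0"
proof -
  have "(0 :: 'c poly) \<in> polys_over (Fq q)" by (simp add: polys_over_def)
  then have "restrict c B \<in> B \<rightarrow>\<^sub>E polys_over (Fq q) \<and> 0 = (\<Sum>b\<in>B. fps_of_poly (restrict c B b) * b)"
    "(\<lambda>b\<in>B. 0 :: 'c poly) \<in> B \<rightarrow>\<^sub>E polys_over (Fq q) \<and> 0 = (\<Sum>b\<in>B. fps_of_poly ((\<lambda>b\<in>B. 0) b) * b)"
    using c 0 by (auto simp: PiE_iff)
  moreover have "\<exists>!c. c \<in> B \<rightarrow>\<^sub>E polys_over (Fq q) \<and> 0 = (\<Sum>b\<in>B. fps_of_poly (c b) * b)"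
    using B S_0 unfolding fps_basis_def by blast
  ultimately have "restrict c B = (\<lambda>b\<in>B. 0)" by blast
  then show ?thesis using b by (metis restrict_apply')
qed

text \<open>S / T S is an F_q-space with the classes of the basis elements as basis. The count makes
  all finite bases equally large.\<close>

lemma card_fps_basis:
  assumes B: "fps_basis B"
  shows "card ((\<lambda>f. fps_nth f 0) ` S) = q ^ card B"
proof -
  have fin: "finite B" and BS: "B \<subseteq> S" using B by (auto simp: fps_basis_def)
  let ?h = "\<lambda>l. \<Sum>b\<in>B. l b * fps_nth b 0"
  have "bij_betw ?h (B \<rightarrow>\<^sub>E Fq q) ((\<lambda>f. fps_nth f 0) ` S)"
  proof (rule bij_betw_imageI)
    show "inj_on ?h (B \<rightarrow>\<^sub>E Fq q)"
    proof (rule inj_onI)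
      fix l l' assume l: "l \<in> B \<rightarrow>\<^sub>E Fq q" "l' \<in> B \<rightarrow>\<^sub>E Fq q" and eq: "?h l = ?h l'"
      define m where "m b = l b - l' b" for b
      have m: "m b \<in> Fq q" if "b \<in> B" for b using l that by (auto simp: m_def intro: Fq_diff)
      define f where "f = (\<Sum>b\<in>B. fps_of_poly [:m b:] * b)"
      have "f \<in> S" unfolding f_def using m BS by (intro S_sum S_mult polys_Fq_const) auto
      have "fps_nth f 0 = 0"
        using eq by (simp add: f_def fps_sum_nth m_def left_diff_distrib sum_subtractf)
      then have f: "f = fps_X * fps_shift 1 f" by (intro fps_ext) simp
      then have "fps_shift 1 f \<in> S" using \<open>f \<in> S\<close> S_shift by metis
      then obtain c where c: "c \<in> B \<rightarrow>\<^sub>E polys_over (Fq q)" "fps_shift 1 f = (\<Sum>b\<in>B. fps_of_poly (c b) * b)"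
        using B unfolding fps_basis_def by blast
      \<comment> \<open>Expanding f / T in the basis gives a second expression for f, with
        coefficients divisible by T. The difference of the two is a relation whose constant
        coefficients are the \<open>m b\<close>.\<close>
      define d where "d b = [:m b:] - pCons 0 (c b)" for b
      have "(\<Sum>b\<in>B. fps_of_poly (d b) * b) = f - fps_X * fps_shift 1 f"
        unfolding c(2) by (simp add: f_def d_def fps_of_poly_diff fps_of_poly_pCons left_diff_distrib sum_subtractf
            sum_distrib_left mult.assoc mult.left_commute del: diff_pCons)
      then have "(\<Sum>b\<in>B. fps_of_poly (d b) * b) = 0" using f by simp
      moreover have "d b \<in> polys_over (Fq q)" if "b \<in> B" for b
      proof -
        have "c b \<in> polys_over (Fq q)" using c(1) that by auto
        then show ?thesis using m[OF that] unfolding d_def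
          by (auto simp: polys_over_def coeff_pCons split: nat.splits intro: Fq_minus)
      qed
      ultimately have "d b = 0" if "b \<in> B" for b using fps_basis_unique[OF B] that by blast
      then have "m b = 0" if "b \<in> B" for b using that by (auto simp: d_def)
      then show "l = l'" using l by (intro PiE_ext[OF l]) (auto simp: m_def)
    qed
    show "?h ` (B \<rightarrow>\<^sub>E Fq q) = (\<lambda>f. fps_nth f 0) ` S"
    proof (intro equalityI subsetI)
      fix w assume "w \<in> ?h ` (B \<rightarrow>\<^sub>E Fq q)"
      then obtain l where l: "l \<in> B \<rightarrow>\<^sub>E Fq q" "w = ?h l" by auto
      have "(\<Sum>b\<in>B. fps_of_poly [:l b:] * b) \<in> S"
        using l BS by (intro S_sum S_mult polys_Fq_const) auto
      moreover have "fps_nth (\<Sum>b\<in>B. fps_of_poly [:l b:] * b) 0 = w"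
        by (simp add: l fps_sum_nth)
      ultimately show "w \<in> (\<lambda>f. fps_nth f 0) ` S" by force
    next
      fix w assume "w \<in> (\<lambda>f. fps_nth f 0) ` S"
      then obtain f where f: "f \<in> S" "w = fps_nth f 0" by auto
      then obtain c where c: "c \<in> B \<rightarrow>\<^sub>E polys_over (Fq q)" "f = (\<Sum>b\<in>B. fps_of_poly (c b) * b)"
        using B unfolding fps_basis_def by blast
      have "w = ?h (\<lambda>b\<in>B. coeff (c b) 0)" by (simp add: f c(2) fps_sum_nth)
      moreover have "(\<lambda>b\<in>B. coeff (c b) 0) \<in> B \<rightarrow>\<^sub>E Fq q" using c(1) by (auto simp: polys_over_def)
      ultimately show "w \<in> ?h ` (B \<rightarrow>\<^sub>E Fq q)" by blast
    qed
  qed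
  then have "card ((\<lambda>f. fps_nth f 0) ` S) = card (B \<rightarrow>\<^sub>E (Fq q :: 'c set))"
    by (rule bij_betw_same_card[symmetric])
  then show ?thesis using fin by (simp add: card_PiE card_Fq)
qed

text \<open>\<open>g\<close> is an isomorphism of S onto H. The \<open>THE\<close> in
  \<open>free_rank\<close> is resolved by \<open>card_fps_basis\<close>: every basis of H comes from
  one of S, and its size n satisfies q^n = |S / T S|.\<close>

lemma free_rank_eq:
  fixes H :: "('c poly, 'm) module"
  assumes g: "inj_on g S" "carrier H = g ` S"
    and g_add: "\<And>f h. f \<in> S \<Longrightarrow> h \<in> S \<Longrightarrow> g f \<oplus>\<^bsub>H\<^esub> g h = g (f + h)"
    and g_0: "\<zero>\<^bsub>H\<^esub> = g 0"
    and g_mult: "\<And>p f. p \<in> polys_over (Fq q) \<Longrightarrow> f \<in> S \<Longrightarrow> p \<odot>\<^bsub>H\<^esub> g f = g (fps_of_poly p * f)"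
    and B: "fps_basis B"
  shows "free_rank (poly_ring (Fq q)) H = card B"
proof -
  interpret H: abelian_monoid H
    by (rule abelian_monoidI) (auto simp: g g_add g_0 S_add S_0 algebra_simps)
  have finsum: "(\<Oplus>\<^bsub>H\<^esub>b\<in>g ` D. c b \<odot>\<^bsub>H\<^esub> b) = g (\<Sum>b\<in>D. fps_of_poly (c (g b)) * b)"
    if D: "finite D" "D \<subseteq> S" and c: "c \<in> g ` D \<rightarrow> polys_over (Fq q)" for D c
    using D c
  proof (induction D rule: finite_induct)
    case (insert x D)
    have x: "g x \<notin> g ` D" using insert.hyps insert.prems g(1) by (auto simp: inj_on_def)
    have cS: "fps_of_poly (c (g b)) * b \<in> S" if "b \<in> insert x D" for b
      using insert.prems that by (intro S_mult) auto
    have cc: "c b \<odot>\<^bsub>H\<^esub> b \<in> carrier H" if "b \<in> g ` insert x D" for b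
      using that insert.prems cS g by (auto simp: g_mult Pi_iff subset_iff)
    have "(\<Oplus>\<^bsub>H\<^esub>b\<in>g ` insert x D. c b \<odot>\<^bsub>H\<^esub> b) = (c (g x) \<odot>\<^bsub>H\<^esub> g x) \<oplus>\<^bsub>H\<^esub> (\<Oplus>\<^bsub>H\<^esub>b\<in>g ` D. c b \<odot>\<^bsub>H\<^esub> b)"
      unfolding image_insert by (rule H.finsum_insert) (use insert.hyps x cc in auto)
    also have "\<dots> = g (fps_of_poly (c (g x)) * x) \<oplus>\<^bsub>H\<^esub> g (\<Sum>b\<in>D. fps_of_poly (c (g b)) * b)"
      using insert.IH insert.prems by (simp add: g_mult Pi_iff)
    also have "\<dots> = g (fps_of_poly (c (g x)) * x + (\<Sum>b\<in>D. fps_of_poly (c (g b)) * b))"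
      using cS by (intro g_add S_sum) auto
    finally show ?case using insert.hyps by simp
  qed (simp add: g_0)
  have carr: "carrier (poly_ring (Fq q)) = (polys_over (Fq q) :: 'c poly set)" by (simp add: poly_ring_def)
  have basis_iff: "finite_basis (poly_ring (Fq q)) H (g ` D) \<longleftrightarrow> fps_basis D" if D: "D \<subseteq> S" for D
  proof -
    have injD: "inj_on g D" using g(1) D by (rule inj_on_subset)
    have eq: "(\<exists>!c. c \<in> g ` D \<rightarrow>\<^sub>E polys_over (Fq q) \<and> g f = (\<Oplus>\<^bsub>H\<^esub>b\<in>g ` D. c b \<odot>\<^bsub>H\<^esub> b)) \<longleftrightarrow>
        (\<exists>!c. c \<in> D \<rightarrow>\<^sub>E polys_over (Fq q) \<and> f = (\<Sum>b\<in>D. fps_of_poly (c b) * b))" if f: "f \<in> S" "finite D" for f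
    proof -
      have "c \<in> g ` D \<rightarrow>\<^sub>E polys_over (Fq q) \<and> g f = (\<Oplus>\<^bsub>H\<^esub>b\<in>g ` D. c b \<odot>\<^bsub>H\<^esub> b) \<longleftrightarrow>
          c \<in> g ` D \<rightarrow>\<^sub>E polys_over (Fq q) \<and> f = (\<Sum>b\<in>D. fps_of_poly ((\<lambda>b\<in>D. c (g b)) b) * b)" for c
      proof (cases "c \<in> g ` D \<rightarrow>\<^sub>E polys_over (Fq q)")
        case True
        then have c: "c \<in> g ` D \<rightarrow> polys_over (Fq q)" by auto
        have "(\<Sum>b\<in>D. fps_of_poly (c (g b)) * b) \<in> S" using c D by (intro S_sum S_mult) auto
        then show ?thesis using finsum[OF f(2) D c] f(1) g(1) by (auto simp: inj_on_def)
      qed simp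
      then show ?thesis using bij_betw_ex1_iff[OF bij_betw_reindex_PiE[OF injD, of "polys_over (Fq q)"],
            of "\<lambda>c. f = (\<Sum>b\<in>D. fps_of_poly (c b) * b)"] by simp
    qed
    have ball: "(\<forall>x\<in>g ` S. \<exists>!c. c \<in> g ` D \<rightarrow>\<^sub>E polys_over (Fq q) \<and> x = (\<Oplus>\<^bsub>H\<^esub>b\<in>g ` D. c b \<odot>\<^bsub>H\<^esub> b)) \<longleftrightarrow>
        (\<forall>f\<in>S. \<exists>!c. c \<in> D \<rightarrow>\<^sub>E polys_over (Fq q) \<and> f = (\<Sum>b\<in>D. fps_of_poly (c b) * b))" if "finite D"
      unfolding ball_simps(9) by (rule ball_cong[OF refl eq[OF _ that]])
    have sub: "g ` D \<subseteq> g ` S" using D by blast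
    show ?thesis
    proof (cases "finite D")
      case True
      show ?thesis
        unfolding finite_basis_def fps_basis_def carr g(2) finite_image_iff[OF injD]
        by (simp only: True D sub ball[OF True] simp_thms)
    next
      case False
      then show ?thesis unfolding finite_basis_def fps_basis_def finite_image_iff[OF injD] by (simp only: simp_thms)
    qed
  qed
  have BS: "B \<subseteq> S" using B by (simp add: fps_basis_def)
  have card_g: "card (g ` D) = card D" if "D \<subseteq> S" for D using that g(1) by (meson card_image inj_on_subset)
  show ?thesis
    unfolding free_rank_def
  proof (rule the_equality)
    show "\<exists>D. finite_basis (poly_ring (Fq q)) H D \<and> card D = card B"
      using basis_iff[OF BS] card_g[OF BS] B by blast
    fix n assume "\<exists>D. finite_basis (poly_ring (Fq q)) H D \<and> card D = n"
    then obtain D where D: "finite_basis (poly_ring (Fq q)) H D" "card D = n" by blast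
    then have "D \<subseteq> g ` S" using g(2) by (auto simp: finite_basis_def)
    then obtain D' where D': "D' \<subseteq> S" "D = g ` D'" by (auto simp: subset_image_iff)
    then have "fps_basis D'" "card D' = n" using D basis_iff[OF D'(1)] card_g[OF D'(1)] by auto
    then have "q ^ n = q ^ card B" using card_fps_basis[OF B] card_fps_basis[of D'] by simp
    then show "n = card B" using q_gt_1 by simp
  qed
qed

end

section \<open>The recurrence for invariant elements\<close>

context C_infinity
begin

section \<open>Frobenius twists of power series\<close>

definition fps_frob :: "nat \<Rightarrow> 'c fps \<Rightarrow> 'c fps" where
  "fps_frob k f = Abs_fps (\<lambda>i. fps_nth f i ^ (q ^ k))"

lemma fps_nth_frob [simp]: "fps_nth (fps_frob k f) i = fps_nth f i ^ (q ^ k)"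
  by (simp add: fps_frob_def)

lemma Tate_tau_eq_frob: "Tate_tau q f = fps_frob 1 f"
  by (simp add: fps_eq_iff)

lemma fps_frob_add: "fps_frob k (f + g) = fps_frob k f + fps_frob k g"
  and fps_frob_diff: "fps_frob k (f - g) = fps_frob k f - fps_frob k g"
  and fps_frob_frob: "fps_frob j (fps_frob k f) = fps_frob (j + k) f"
  and fps_frob_const: "fps_frob k (fps_const c) = fps_const (c ^ (q ^ k))"
  by (simp_all add: fps_eq_iff frob_add frob_diff power_add power_mult[symmetric] mult.commute power_0_left)

lemma fps_frob_mult: "fps_frob k (f * g) = fps_frob k f * fps_frob k g"
  by (simp add: fps_eq_iff fps_mult_nth frob_sum power_mult_distrib)

lemma fps_frob_X: "fps_frob k fps_X = fps_X"
  by (simp add: fps_eq_iff power_0_left)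

lemma fps_frob_0: "fps_frob k 0 = 0"
  by (simp add: fps_eq_iff power_0_left)

lemma fps_frob_inj: "fps_frob k f = fps_frob k g \<longleftrightarrow> f = g"
  by (simp add: fps_eq_iff frob_inj)

lemma Fq_power: "x \<in> Fq q \<Longrightarrow> (x :: 'c) ^ (q ^ k) = x"
  by (induction k) (auto simp: Fq_def power_mult)

lemma fps_frob_poly: "p \<in> polys_over (Fq q) \<Longrightarrow> fps_frob k (fps_of_poly p) = fps_of_poly p"
  by (simp add: fps_eq_iff polys_over_def Fq_power)

lemma frob_surj: "\<exists>y. (y :: 'c) ^ q = x"
proof -
  have "degree (monom 1 q - [:x:]) = q"
  proof (rule antisym)
    show "degree (monom 1 q - [:x:]) \<le> q"
      using q_gt_1 by (intro degree_le) (auto simp: coeff_pCons split: nat.splits)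
    show "q \<le> degree (monom 1 q - [:x:])"
      using q_gt_1 by (intro le_degree) (auto simp: coeff_pCons split: nat.splits)
  qed
  then obtain y where "poly (monom 1 q - [:x:]) y = 0" using poly_root[of "monom 1 q - [:x:]"] by auto
  then show ?thesis by (auto simp: poly_monom)
qed

text \<open>Taking q-th roots of the coefficients divides valuations by \<open>q\<close>, which
  keeps them tending to infinity.\<close>

lemma Tate_tau_surj:
  assumes "f \<in> tate"
  shows "\<exists>g\<in>tate. Tate_tau q g = f"
proof -
  obtain r where r: "\<And>x. (r x :: 'c) ^ q = x" using frob_surj by metis
  define g where "g = Abs_fps (\<lambda>i. r (fps_nth f i))"
  have g: "Tate_tau q g = f" by (simp add: fps_eq_iff g_def r)
  have "g \<in> tate"
    unfolding tate_iff
  proof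
    fix b :: real
    have "eventually (\<lambda>i. ord (fps_nth f i) > ereal (real q * b)) sequentially" using assms tate_iff by blast
    then show "eventually (\<lambda>i. ord (fps_nth g i) > ereal b) sequentially"
    proof eventually_elim
      case (elim i)
      have "fps_nth f i = fps_nth g i ^ q" by (simp add: g_def r)
      then have "ord (fps_nth f i) = ereal (real q) * ord (fps_nth g i)" by (simp add: ord_power)
      then show ?case using elim by (cases "ord (fps_nth g i)") (auto simp: ord_not_MInf)
    qed
  qed
  then show ?thesis using g by blast
qed

text \<open>Coefficientwise, $c_i + \sigma c_i^{q^2} + u c_i^{q^4}
  = \kappa c_{i-1}^{q^2} + \eta c_{i-1}^{q^4} - \varepsilon c_{i-2}^{q^4}$.\<close>

definition rec_module :: "'c \<Rightarrow> 'c \<Rightarrow> 'c \<Rightarrow> 'c \<Rightarrow> 'c \<Rightarrow> 'c fps set" where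
  "rec_module \<sigma> u \<kappa> \<eta> \<epsilon> = {f \<in> tate.
     f + fps_const \<sigma> * fps_frob 2 f + fps_const u * fps_frob 4 f =
     fps_X * (fps_const \<kappa> * fps_frob 2 f + fps_const \<eta> * fps_frob 4 f - fps_X * (fps_const \<epsilon> * fps_frob 4 f))}"

text \<open>The defect \<open>d\<close> of the equation is linear over F_q[T], because the twists
  fix polynomials over F_q; closure under division by T follows by cancelling \<open>fps_X\<close>
  in \<open>d (fps_X * f) = fps_X * d f\<close>.\<close>

lemma Fq_T_submodule_rec_module: "Fq_T_submodule q \<theta> ord (rec_module \<sigma> u \<kappa> \<eta> \<epsilon>)"
proof -
  define d where "d f = f + fps_const \<sigma> * fps_frob 2 f + fps_const u * fps_frob 4 f -
     fps_X * (fps_const \<kappa> * fps_frob 2 f + fps_const \<eta> * fps_frob 4 f - fps_X * (fps_const \<epsilon> * fps_frob 4 f))" for f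
  have mem: "f \<in> rec_module \<sigma> u \<kappa> \<eta> \<epsilon> \<longleftrightarrow> f \<in> tate \<and> d f = 0" for f
    by (simp add: rec_module_def d_def)
  have "d (f + g) = d f + d g" for f g
    by (simp add: d_def fps_frob_add algebra_simps)
  moreover have "d (fps_of_poly p * f) = fps_of_poly p * d f" if "p \<in> polys_over (Fq q)" for p f
    using that by (simp add: d_def fps_frob_mult fps_frob_poly algebra_simps)
  moreover have "d (fps_X * f) = fps_X * d f" for f
    by (simp add: d_def fps_frob_mult fps_frob_X algebra_simps)
  moreover have "d 0 = 0" by (simp add: d_def fps_frob_0)
  ultimately show ?thesis
    by unfold_locales (simp_all add: mem tate_add tate_poly_mult tate_X_mult_iff)
qed

lemma rec_module_nth:
  assumes "f \<in> rec_module \<sigma> u \<kappa> \<eta> \<epsilon>"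
  shows "fps_nth f i + \<sigma> * fps_nth f i ^ q\<^sup>2 + u * fps_nth f i ^ q ^ 4 =
    (if i = 0 then 0 else \<kappa> * fps_nth f (i - 1) ^ q\<^sup>2 + \<eta> * fps_nth f (i - 1) ^ q ^ 4
      - (if i = 1 then 0 else \<epsilon> * fps_nth f (i - 2) ^ q ^ 4))"
proof -
  have "fps_nth (f + fps_const \<sigma> * fps_frob 2 f + fps_const u * fps_frob 4 f) i =
     fps_nth (fps_X * (fps_const \<kappa> * fps_frob 2 f + fps_const \<eta> * fps_frob 4 f - fps_X * (fps_const \<epsilon> * fps_frob 4 f))) i"
    using assms by (simp add: rec_module_def)
  then show ?thesis by (simp add: numeral_2_eq_2)
qed

lemma rec_moduleI:
  assumes "f \<in> tate"
    and "\<And>i. fps_nth f i + \<sigma> * fps_nth f i ^ q\<^sup>2 + u * fps_nth f i ^ q ^ 4 =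
    (if i = 0 then 0 else \<kappa> * fps_nth f (i - 1) ^ q\<^sup>2 + \<eta> * fps_nth f (i - 1) ^ q ^ 4
      - (if i = 1 then 0 else \<epsilon> * fps_nth f (i - 2) ^ q ^ 4))"
  shows "f \<in> rec_module \<sigma> u \<kappa> \<eta> \<epsilon>"
  unfolding rec_module_def using assms by (auto simp: fps_eq_iff numeral_2_eq_2)

section \<open>From invariant elements to the recurrence\<close>

definition tau_fixed :: "'c ^ 'n ^ 'n \<Rightarrow> (('c fps ^ 'n) \<times> ('c fps ^ 'n)) set" where
  "tau_fixed A = {z \<in> tate_vecs. tensor_tau A z = z}"

lemma carrier_H1: "carrier (H1 q \<theta> ord A) = tensor_fiber A ` tau_fixed A"
proof -
  have "motive_tensor_map A (motive_tau q) (Tate_tau q) (tensor_fiber A z)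
      = tensor_fiber A z \<longleftrightarrow> tensor_tau A z = z" if "z \<in> tate_vecs" for z
    unfolding tensor_map_tau[OF that]
  proof
    assume "tensor_fiber A (tensor_tau A z) = tensor_fiber A z"
    from tensor_fiber_inj[OF that this[symmetric]] show "tensor_tau A z = z" ..
  qed simp
  note * = this
  have "carrier (H1 q \<theta> ord A) = {\<xi> \<in> tensor_fiber A ` tate_vecs.
      motive_tensor_map A (motive_tau q) (Tate_tau q) \<xi> = \<xi>}"
    by (simp add: H1_def Let_def carrier_motive_tensor)
  also have "\<dots> = tensor_fiber A ` tau_fixed A"
    unfolding tau_fixed_def using * by blast
  finally show ?thesis .
qed

lemma add_H1:
  "z \<in> tau_fixed A \<Longrightarrow> w \<in> tau_fixed A \<Longrightarrow>
    tensor_fiber A z \<oplus>\<^bsub>H1 q \<theta> ord A\<^esub> tensor_fiber A w = tensor_fiber A (z + w)"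
  by (simp add: H1_def Let_def mult_motive_tensor tau_fixed_def)

lemma zero_H1: "\<zero>\<^bsub>H1 q \<theta> ord A\<^esub> = tensor_fiber A 0"
  by (simp add: H1_def Let_def one_motive_tensor)

lemma smult_H1:
  "z \<in> tau_fixed A \<Longrightarrow>
    p \<odot>\<^bsub>H1 q \<theta> ord A\<^esub> tensor_fiber A z = tensor_fiber A (\<chi> j. fps_of_poly p * fst z $ j, \<chi> j. fps_of_poly p * snd z $ j)"
  by (simp add: H1_def Let_def tensor_map_poly tau_fixed_def)

text \<open>\<open>y1\<close> and \<open>y2\<close> are the coordinates at \<tau> e_1 and \<tau>
  e_2. The hypothesis determines \<tau> y2 but not y2 directly; applying the injective \<tau> to the
  other equation leaves only \<tau> y2 and \<tau>^3 y2, both known from the hypothesis and its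
  \<tau>^2-twist.\<close>

lemma eliminate_second_coordinate:
  fixes a12 a21 :: 'c
  defines "\<epsilon> \<equiv> a21 / a21 ^ q\<^sup>2"
  assumes a21: "a21 \<noteq> 0"
    and y2: "fps_const a21 * fps_frob 1 y2 = (fps_X - fps_const (\<theta> ^ q)) * fps_frob 2 y1 - y1"
  shows "y2 = (fps_X - fps_const (\<theta> ^ q)) * fps_frob 2 y2 - fps_const a12 * fps_frob 1 y1 \<longleftrightarrow>
    y1 + fps_const (a21 * (\<theta> ^ q / a21 + \<theta> ^ (q\<^sup>2) / a21 ^ (q\<^sup>2) - a12 ^ q)) * fps_frob 2 y1
       + fps_const (\<theta> ^ (q ^ 2) * \<theta> ^ (q ^ 3) * \<epsilon>) * fps_frob 4 y1 =
     fps_X * (fps_const (1 + \<epsilon>) * fps_frob 2 y1 + fps_const ((\<theta> ^ (q ^ 2) + \<theta> ^ (q ^ 3)) * \<epsilon>) * fps_frob 4 y1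
        - fps_X * (fps_const \<epsilon> * fps_frob 4 y1))"
    (is "?L \<longleftrightarrow> ?R")
proof -
  let ?C = "fps_const :: 'c \<Rightarrow> 'c fps"
  define F2 F4 G3 t1 t2 t3 where "F2 = fps_frob 2 y1" and "F4 = fps_frob 4 y1" and "G3 = fps_frob 3 y2"
    and "t1 = ?C (\<theta> ^ q)" and "t2 = ?C (\<theta> ^ q ^ 2)" and "t3 = ?C (\<theta> ^ q ^ 3)"
  have nz: "?C a21 \<noteq> 0" "a21 ^ q ^ 2 \<noteq> 0" using a21 by simp_all
  \<comment> \<open>The \<tau>^2-twist of the hypothesis. It carries the factor a21^(q^2), which
    multiplication by \<open>\<epsilon>\<close> turns into a21.\<close>
  have "fps_frob 2 (?C a21 * fps_frob 1 y2) = fps_frob 2 ((fps_X - t1) * fps_frob 2 y1 - y1)"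
    unfolding y2 t1_def ..
  then have k: "?C (a21 ^ q ^ 2) * G3 = (fps_X - t3) * F4 - F2"
    by (simp add: fps_frob_mult fps_frob_diff fps_frob_frob fps_frob_X fps_frob_const F2_def F4_def G3_def t1_def t3_def
        power_mult[symmetric] eval_nat_numeral)
  have "?C \<epsilon> * ((fps_X - t3) * F4 - F2) = ?C (\<epsilon> * a21 ^ q ^ 2) * G3"
    unfolding k[symmetric] fps_const_mult[symmetric] mult.assoc ..
  also have "\<epsilon> * a21 ^ q ^ 2 = a21" using nz by (simp add: \<epsilon>_def)
  finally have G3: "?C a21 * G3 = ?C \<epsilon> * ((fps_X - t3) * F4 - F2)" ..
  have "?L \<longleftrightarrow> fps_frob 1 y2 = fps_frob 1 ((fps_X - t1) * fps_frob 2 y2 - ?C a12 * fps_frob 1 y1)"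
    unfolding fps_frob_inj t1_def ..
  also have "fps_frob 1 ((fps_X - t1) * fps_frob 2 y2 - ?C a12 * fps_frob 1 y1) = (fps_X - t2) * G3 - ?C (a12 ^ q) * F2"
    by (simp add: fps_frob_mult fps_frob_diff fps_frob_frob fps_frob_X fps_frob_const F2_def G3_def t1_def t2_def
        power_mult[symmetric] eval_nat_numeral)
  also have "fps_frob 1 y2 = (fps_X - t2) * G3 - ?C (a12 ^ q) * F2 \<longleftrightarrow>
     ?C a21 * fps_frob 1 y2 = ?C a21 * ((fps_X - t2) * G3 - ?C (a12 ^ q) * F2)" using nz by simp
  also have "?C a21 * ((fps_X - t2) * G3 - ?C (a12 ^ q) * F2) = (fps_X - t2) * (?C a21 * G3) - ?C a21 * ?C (a12 ^ q) * F2"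
    by (simp only: right_diff_distrib mult.assoc mult.left_commute)
  also have "\<dots> = (fps_X - t2) * (?C \<epsilon> * ((fps_X - t3) * F4 - F2)) - ?C a21 * ?C (a12 ^ q) * F2"
    unfolding G3 ..
  also have "?C a21 * fps_frob 1 y2 = (fps_X - t1) * F2 - y1" unfolding y2 F2_def t1_def ..
  finally have 1: "?L \<longleftrightarrow> (fps_X - t1) * F2 - y1 =
      (fps_X - t2) * (?C \<epsilon> * ((fps_X - t3) * F4 - F2)) - ?C a21 * ?C (a12 ^ q) * F2" .
  have "a21 * (\<theta> ^ q / a21 + \<theta> ^ (q\<^sup>2) / a21 ^ (q\<^sup>2) - a12 ^ q) = \<theta> ^ q + \<epsilon> * \<theta> ^ q\<^sup>2 - a21 * a12 ^ q"
    using a21 by (simp add: \<epsilon>_def algebra_simps)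
  then have 2: "?C (a21 * (\<theta> ^ q / a21 + \<theta> ^ (q\<^sup>2) / a21 ^ (q\<^sup>2) - a12 ^ q)) = t1 + ?C \<epsilon> * t2 - ?C a21 * ?C (a12 ^ q)"
    by (simp add: t1_def t2_def)
  have 3: "?C (\<theta> ^ (q ^ 2) * \<theta> ^ (q ^ 3) * \<epsilon>) = t2 * t3 * ?C \<epsilon>" "?C (1 + \<epsilon>) = 1 + ?C \<epsilon>"
    "?C ((\<theta> ^ (q ^ 2) + \<theta> ^ (q ^ 3)) * \<epsilon>) = (t2 + t3) * ?C \<epsilon>"
    by (simp_all add: t2_def t3_def flip: fps_const_add)
  show ?thesis
    unfolding 1 2 3 F2_def[symmetric] F4_def[symmetric]
    by (rule trans[OF diff_eq_diff_eq eq_commute]) (simp add: algebra_simps)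
qed

text \<open>An invariant element goes to its coordinate at \<tau> e_1. The other coordinates are
  then forced, as a21 \<noteq> 0 and \<tau> is injective, and they exist in the Tate algebra because
  \<tau> is surjective there.\<close>

lemma h1_eq_card_fps_basis:
  fixes a12 a21 :: 'c and A :: "'c ^ 2 ^ 2"
  defines "\<epsilon> \<equiv> a21 / a21 ^ q\<^sup>2"
  defines "S \<equiv> rec_module (a21 * (\<theta> ^ q / a21 + \<theta> ^ (q\<^sup>2) / a21 ^ (q\<^sup>2) - a12 ^ q)) (\<theta> ^ (q ^ 2) * \<theta> ^ (q ^ 3) * \<epsilon>)
     (1 + \<epsilon>) ((\<theta> ^ (q ^ 2) + \<theta> ^ (q ^ 3)) * \<epsilon>) \<epsilon>"
  assumes a21: "a21 \<noteq> 0" and A: "A = vector [vector [0, a12], vector [a21, 0]]"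
    and B: "Fq_T_submodule.fps_basis q S B"
  shows "h1 q \<theta> ord A = card B"
proof -
  interpret S: Fq_T_submodule q \<theta> ord S unfolding S_def by (rule Fq_T_submodule_rec_module)
  have A_nth: "A $ 1 $ 1 = 0" "A $ 1 $ 2 = a12" "A $ 2 $ 1 = a21" "A $ 2 $ 2 = 0" by (simp_all add: A)
  have lin: "fps_of_poly [:- c, 1:] = fps_X - fps_const c" for c :: 'c
    by (simp add: fps_of_poly_pCons fps_const_neg[symmetric] del: fps_const_neg)
  \<comment> \<open>The first half of the fixed point equation expresses the coordinates at e_j
    through those at \<tau> e_j. Substituting it leaves two equations, of which the one for index 1
    is solved for \<tau> of the second coordinate.\<close>
  have fixed_iff: "z \<in> tau_fixed A \<longleftrightarrow> z \<in> tate_vecs \<and>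
      fst z = (\<chi> j. (fps_X - fps_const \<theta>) * fps_frob 1 (snd z $ j)) \<and>
      fps_const a21 * fps_frob 1 (snd z $ 2) = (fps_X - fps_const (\<theta> ^ q)) * fps_frob 2 (snd z $ 1) - snd z $ 1 \<and>
      snd z $ 2 = (fps_X - fps_const (\<theta> ^ q)) * fps_frob 2 (snd z $ 2) - fps_const a12 * fps_frob 1 (snd z $ 1)" for z
  proof -
    have sq: "fps_frob 1 ((fps_X - fps_const \<theta>) * fps_frob 1 f) = (fps_X - fps_const (\<theta> ^ q)) * fps_frob 2 f" for f
      by (simp add: fps_frob_mult fps_frob_diff fps_frob_frob fps_frob_X fps_frob_const numeral_2_eq_2)
    have eq: "a = b - c \<longleftrightarrow> c = b - a" for a b c :: "'c fps" by (auto simp: algebra_simps)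
    have "z \<in> tau_fixed A \<longleftrightarrow> z \<in> tate_vecs \<and>
      fst z = (\<chi> j. (fps_X - fps_const \<theta>) * fps_frob 1 (snd z $ j)) \<and>
      (\<forall>k. snd z $ k = fps_frob 1 (fst z $ k) - (\<Sum>j\<in>UNIV. fps_const (A $ j $ k) * fps_frob 1 (snd z $ j)))"
    proof -
      have "tensor_tau A z = z \<longleftrightarrow> fst z = fst (tensor_tau A z) \<and> snd z = snd (tensor_tau A z)"
        by (auto simp: prod_eq_iff)
      moreover have "fst (tensor_tau A z) = (\<chi> j. (fps_X - fps_const \<theta>) * fps_frob 1 (snd z $ j))"
        by (simp add: tensor_tau_def Tate_tau_eq_frob lin)
      moreover have "snd z = snd (tensor_tau A z) \<longleftrightarrow>
        (\<forall>k. snd z $ k = fps_frob 1 (fst z $ k) - (\<Sum>j\<in>UNIV. fps_const (A $ j $ k) * fps_frob 1 (snd z $ j)))"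
        by (simp add: vec_eq_iff tensor_tau_def Tate_tau_eq_frob)
      ultimately show ?thesis by (simp only: tau_fixed_def mem_Collect_eq)
    qed
    also have "\<dots> \<longleftrightarrow> z \<in> tate_vecs \<and>
      fst z = (\<chi> j. (fps_X - fps_const \<theta>) * fps_frob 1 (snd z $ j)) \<and>
      snd z $ 1 = (fps_X - fps_const (\<theta> ^ q)) * fps_frob 2 (snd z $ 1) - fps_const a21 * fps_frob 1 (snd z $ 2) \<and>
      snd z $ 2 = (fps_X - fps_const (\<theta> ^ q)) * fps_frob 2 (snd z $ 2) - fps_const a12 * fps_frob 1 (snd z $ 1)"
      by (intro conj_cong refl) (simp add: forall_2 sum_2 A_nth sq del: One_nat_def)
    finally show ?thesis unfolding eq[of "snd z $ 1"] .
  qed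
  let ?p = "\<lambda>z :: ('c fps ^ 2) \<times> ('c fps ^ 2). snd z $ 1"
  have p_in: "?p z \<in> S" if "z \<in> tau_fixed A" for z
    using that[unfolded fixed_iff] eliminate_second_coordinate[OF a21, of "snd z $ 2" "?p z" a12]
    by (simp add: S_def rec_module_def \<epsilon>_def tate_vecs_def)
  have p_inj: "z = w" if z: "z \<in> tau_fixed A" and w: "w \<in> tau_fixed A" and eq: "?p z = ?p w" for z w
  proof -
    have "fps_const a21 * fps_frob 1 (snd z $ 2) = fps_const a21 * fps_frob 1 (snd w $ 2)"
      using z w eq unfolding fixed_iff by simp
    then have "snd z $ 2 = snd w $ 2" using a21 by (simp add: fps_frob_inj)
    then have "snd z = snd w" using eq by (simp add: vec_eq_iff forall_2)
    then show ?thesis using z w unfolding fixed_iff by (simp add: prod_eq_iff)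
  qed
  have p_surj: "\<exists>z\<in>tau_fixed A. ?p z = f" if f: "f \<in> S" for f
  proof -
    have ft: "f \<in> tate" using f by (simp add: S_def rec_module_def)
    \<comment> \<open>The value that the equation forces on \<tau> of the missing
      coordinate.\<close>
    define h where "h = fps_const (inverse a21) * (fps_of_poly [:- (\<theta> ^ q), 1:] * fps_frob 2 f - f)"
    have tt: "fps_frob 2 f \<in> tate"
      using tate_tau[OF tate_tau[OF ft]] by (simp add: Tate_tau_eq_frob fps_frob_frob numeral_2_eq_2)
    have "h \<in> tate" unfolding h_def by (intro tate_const_mult tate_diff tate_poly_mult tt ft)
    then obtain g where g: "g \<in> tate" "Tate_tau q g = h" using Tate_tau_surj by blast
    define y :: "'c fps ^ 2" where "y = (\<chi> j. if j = 1 then f else g)"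
    have y: "y $ 1 = f" "y $ 2 = g" by (simp_all add: y_def)
    define z where "z = (\<chi> j. (fps_X - fps_const \<theta>) * fps_frob 1 (y $ j), y)"
    have e1: "fps_const a21 * fps_frob 1 g = (fps_X - fps_const (\<theta> ^ q)) * fps_frob 2 f - f"
    proof -
      have "fps_const a21 * h = fps_const (a21 * inverse a21) * (fps_of_poly [:- (\<theta> ^ q), 1:] * fps_frob 2 f - f)"
        unfolding h_def by (simp only: fps_const_mult[symmetric] mult.assoc)
      then show ?thesis using a21 g(2) by (simp add: Tate_tau_eq_frob lin)
    qed
    have e2: "g = (fps_X - fps_const (\<theta> ^ q)) * fps_frob 2 g - fps_const a12 * fps_frob 1 f"
      using eliminate_second_coordinate[OF a21 e1, of a12] f by (simp add: S_def rec_module_def \<epsilon>_def)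
    have "(fps_X - fps_const \<theta>) * fps_frob 1 h \<in> tate" if "h \<in> tate" for h
      using tate_poly_mult[OF tate_tau[OF that], of "[:- \<theta>, 1:]"] unfolding lin Tate_tau_eq_frob .
    then have "z \<in> tate_vecs" using ft g(1) by (auto simp: z_def tate_vecs_def forall_2 y)
    then have "z \<in> tau_fixed A" unfolding fixed_iff using e1 e2 by (simp add: z_def y)
    moreover have "?p z = f" by (simp add: z_def y)
    ultimately show ?thesis by blast
  qed
  \<comment> \<open>The inverse of the projection; uniqueness of the preimage (\<open>s_eq\<close>)
    makes it linear.\<close>
  define s where "s f = (SOME z. z \<in> tau_fixed A \<and> ?p z = f)" for f
  have s: "s f \<in> tau_fixed A" "?p (s f) = f" if "f \<in> S" for f
    using someI_ex[of "\<lambda>z. z \<in> tau_fixed A \<and> ?p z = f"] p_surj[OF that] unfolding s_def by blast+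
  have s_eq: "s f = z" if "z \<in> tau_fixed A" "?p z = f" for f z
    using p_inj[OF s(1) that(1)] s(2)[of f] p_in[OF that(1)] that(2) by simp
  have tau_add: "tensor_tau A (z + w) = tensor_tau A z + tensor_tau A w" for z w
    by (simp add: tensor_tau_def prod_eq_iff vec_eq_iff Tate_tau_add sum.distrib algebra_simps)
  have fixed_add: "z + w \<in> tau_fixed A" if "z \<in> tau_fixed A" "w \<in> tau_fixed A" for z w
    using that by (simp add: tau_fixed_def tau_add tate_vecs_def tate_add)
  have fixed_mult: "(\<chi> j. fps_of_poly p * fst z $ j, \<chi> j. fps_of_poly p * snd z $ j) \<in> tau_fixed A"
    if z: "z \<in> tau_fixed A" and p: "p \<in> polys_over (Fq q)" for z p
  proof -
    have "tensor_tau A (\<chi> j. fps_of_poly p * fst z $ j, \<chi> j. fps_of_poly p * snd z $ j)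
      = (\<chi> j. fps_of_poly p * fst (tensor_tau A z) $ j, \<chi> j. fps_of_poly p * snd (tensor_tau A z) $ j)"
      using fps_frob_poly[OF p, of 1]
      by (simp add: tensor_tau_def vec_eq_iff Tate_tau_eq_frob fps_frob_mult right_diff_distrib sum_distrib_left mult.left_commute)
    then show ?thesis using z by (simp add: tau_fixed_def tate_vecs_def tate_poly_mult)
  qed
  have fixed_0: "0 \<in> tau_fixed A"
    by (simp add: tau_fixed_def tate_vecs_def tensor_tau_def prod_eq_iff vec_eq_iff)
  show ?thesis
    unfolding h1_def
  proof (rule S.free_rank_eq[OF _ _ _ _ _ B, of "\<lambda>f. tensor_fiber A (s f)"])
    show "inj_on (\<lambda>f. tensor_fiber A (s f)) S"
    proof (rule inj_onI)
      fix f h assume fh: "f \<in> S" "h \<in> S" "tensor_fiber A (s f) = tensor_fiber A (s h)"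
      have "s f \<in> tate_vecs" using s(1)[OF fh(1)] by (simp add: tau_fixed_def)
      from tensor_fiber_inj[OF this fh(3)] have "?p (s f) = ?p (s h)" by (rule arg_cong)
      then show "f = h" unfolding s(2)[OF fh(1)] s(2)[OF fh(2)] .
    qed
    have "s ` S = tau_fixed A"
    proof (intro equalityI subsetI)
      fix z assume z: "z \<in> tau_fixed A"
      show "z \<in> s ` S" using imageI[OF p_in[OF z], of s] unfolding s_eq[OF z refl] .
    qed (use s(1) in blast)
    then show "carrier (H1 q \<theta> ord A) = (\<lambda>f. tensor_fiber A (s f)) ` S"
      unfolding carrier_H1 by (simp only: image_image[symmetric, of "tensor_fiber A" s])
    show "tensor_fiber A (s f) \<oplus>\<^bsub>H1 q \<theta> ord A\<^esub> tensor_fiber A (s h) = tensor_fiber A (s (f + h))"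
      if "f \<in> S" "h \<in> S" for f h
    proof -
      have "s (f + h) = s f + s h" using s[OF that(1)] s[OF that(2)] by (intro s_eq fixed_add) simp_all
      then show ?thesis using add_H1[OF s(1)[OF that(1)] s(1)[OF that(2)]] by simp
    qed
    have "s 0 = 0" using fixed_0 by (intro s_eq) simp_all
    then show "\<zero>\<^bsub>H1 q \<theta> ord A\<^esub> = tensor_fiber A (s 0)" by (simp add: zero_H1)
    show "p \<odot>\<^bsub>H1 q \<theta> ord A\<^esub> tensor_fiber A (s f) = tensor_fiber A (s (fps_of_poly p * f))"
      if "p \<in> polys_over (Fq q)" "f \<in> S" for p f
    proof -
      have "s (fps_of_poly p * f) = (\<chi> j. fps_of_poly p * fst (s f) $ j, \<chi> j. fps_of_poly p * snd (s f) $ j)"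
        by (rule s_eq[OF fixed_mult[OF s(1)[OF that(2)] that(1)]]) (use s(2)[OF that(2)] in simp)
      then show ?thesis using smult_H1[OF s(1)[OF that(2)]] by simp
    qed
  qed
qed

section \<open>The rank zero case\<close>

lemma q_powers: "1 < q\<^sup>2" "1 < q ^ 4" "q\<^sup>2 < q ^ 4"
  using one_less_power[OF q_gt_1] power_strict_increasing[OF _ q_gt_1] by simp_all

lemma ord_mult_power_ge:
  assumes "ord c \<ge> ereal a" "ord x \<ge> ereal m"
  shows "ord (c * x ^ k) \<ge> ereal (a + real k * m)"
proof -
  have "ereal a + ereal (real k) * ereal m \<le> ord c + ereal (real k) * ord x"
    using assms by (intro add_mono ereal_mult_left_mono) auto
  then show ?thesis by (simp add: ord_mult ord_power)
qed

lemma ord_mult_power_gt: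
  assumes "ord c \<ge> ereal a" "ord x > ereal m" "k > 0"
  shows "ord (c * x ^ k) > ereal (a + real k * m)"
proof (cases "c = 0 \<or> x = 0")
  case True
  then show ?thesis using assms(3) by (auto simp: power_0_left)
next
  case False
  then obtain a' m' where am: "ord c = ereal a'" "ord x = ereal m'" using ord_finite by blast
  then have "a \<le> a'" "real k * m < real k * m'" using assms by auto
  then show ?thesis by (simp add: ord_mult ord_power am)
qed

lemma ord_mult_power_gt':
  assumes "ord c > ereal a" "ord x \<ge> ereal m"
  shows "ord (c * x ^ k) > ereal (a + real k * m)"
proof (cases "c = 0 \<or> x ^ k = 0")
  case True
  then have 0: "c * x ^ k = 0" by (simp only: mult_eq_0_iff)
  show ?thesis unfolding 0 by simp
next
  case False
  show ?thesis
  proof (cases "x = 0")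
    case True
    then have "k = 0" using False by (cases k) auto
    then show ?thesis using assms by simp
  next
    case x: False
    then obtain a' m' where am: "ord c = ereal a'" "ord x = ereal m'" using ord_finite False by blast
    then have "a < a'" "real k * m \<le> real k * m'" using assms by (auto intro: mult_left_mono)
    then show ?thesis by (simp add: ord_mult ord_power am)
  qed
qed

text \<open>Only finitely many coefficients have valuation at most that of a given nonzero one, so
  the minimum is attained and has a last index.\<close>

lemma tate_min_attained:
  assumes f: "f \<in> tate" "f \<noteq> 0"
  shows "\<exists>m n. ord (fps_nth f n) = ereal m \<and> (\<forall>i. ord (fps_nth f i) \<ge> ereal m) \<and> (\<forall>i>n. ord (fps_nth f i) > ereal m)"
proof -
  obtain j where "fps_nth f j \<noteq> 0" using f(2) by (auto simp: fps_eq_iff)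
  then obtain r where r: "ord (fps_nth f j) = ereal r" using ord_finite by blast
  have "eventually (\<lambda>i. ord (fps_nth f i) > ereal r) sequentially" using f(1) tate_iff by blast
  then obtain N where N: "\<And>i. i \<ge> N \<Longrightarrow> ord (fps_nth f i) > ereal r" by (auto simp: eventually_sequentially)
  define I where "I = {i. ord (fps_nth f i) \<le> ereal r}"
  have "i < N" if "i \<in> I" for i
  proof (rule ccontr)
    assume "\<not> i < N"
    then have "ord (fps_nth f i) > ereal r" using N by simp
    then show False using that by (simp add: I_def)
  qed
  then have "I \<subseteq> {..<N}" by auto
  then have fin: "finite I" by (rule finite_subset) simp
  have jI: "j \<in> I" by (simp add: I_def r)
  define M where "M = Min ((\<lambda>i. ord (fps_nth f i)) ` I)"
  have "M \<in> (\<lambda>i. ord (fps_nth f i)) ` I" unfolding M_def using fin jI by (intro Min_in) auto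
  then obtain k where k: "k \<in> I" "M = ord (fps_nth f k)" by auto
  have Mle: "M \<le> ord (fps_nth f i)" if "i \<in> I" for i unfolding M_def using fin that by (intro Min_le) auto
  have Mr: "M \<le> ereal r" using k by (simp add: I_def)
  have all: "M \<le> ord (fps_nth f i)" for i
    using Mle[of i] Mr by (cases "i \<in> I") (auto simp: I_def)
  have "M \<noteq> - \<infinity>" unfolding k(2) by (rule ord_not_MInf)
  then obtain m where m: "M = ereal m" using Mr by (cases M) auto
  define J where "J = {i. ord (fps_nth f i) = ereal m}"
  have "J \<subseteq> I" using Mr by (auto simp: J_def I_def m)
  then have finJ: "finite J" using fin finite_subset by blast
  have "k \<in> J" using k m by (simp add: J_def)
  then have "Max J \<in> J" using finJ by (intro Max_in) auto
  then have 1: "ord (fps_nth f (Max J)) = ereal m" by (simp add: J_def)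
  have "ord (fps_nth f i) > ereal m" if "i > Max J" for i
  proof -
    have "i \<notin> J"
    proof
      assume "i \<in> J"
      then have "i \<le> Max J" by (rule Max_ge[OF finJ])
      then show False using that by simp
    qed
    then have "ord (fps_nth f i) \<noteq> ereal m" by (simp add: J_def)
    moreover have "ereal m \<le> ord (fps_nth f i)" using all[of i] unfolding m .
    ultimately show ?thesis by (simp add: less_le)
  qed
  then show ?thesis using 1 all unfolding m by blast
qed

text \<open>Let \<open>m\<close> be the minimal valuation and \<open>n\<close> its last index. Since
  ord \<eta> and ord \<epsilon> exceed w = ord u, the terms with \<eta> and \<epsilon> always have
  valuation above w + q^4 m. One of c_n, \<kappa> c_n^(q^2) and u c_n^(q^4) is then strictly minimal
  in a suitable equation and cannot be cancelled.\<close>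

lemma rec_module_trivial:
  assumes \<kappa>: "ord \<kappa> = 0" and \<sigma>: "ord \<sigma> \<ge> 0" and u: "ord u = ereal w" "w \<ge> 0"
    and \<eta>: "ord \<eta> > ord u" and \<epsilon>: "ord \<epsilon> > ord u"
  shows "rec_module \<sigma> u \<kappa> \<eta> \<epsilon> = {0}"
proof (rule ccontr)
  let ?Q = "q\<^sup>2" and ?R = "q ^ 4"
  assume "rec_module \<sigma> u \<kappa> \<eta> \<epsilon> \<noteq> {0}"
  moreover have "0 \<in> rec_module \<sigma> u \<kappa> \<eta> \<epsilon>" by (simp add: rec_module_def fps_frob_0)
  ultimately obtain f where f: "f \<in> rec_module \<sigma> u \<kappa> \<eta> \<epsilon>" "f \<noteq> 0" by blast
  then have ft: "f \<in> tate" by (simp add: rec_module_def)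
  obtain m n where mn: "ord (fps_nth f n) = ereal m" "\<And>i. ord (fps_nth f i) \<ge> ereal m"
    "\<And>i. i > n \<Longrightarrow> ord (fps_nth f i) > ereal m"
    using tate_min_attained[OF ft f(2)] by blast
  define c where "c i = fps_nth f i" for i
  \<comment> \<open>Zero in place of the missing predecessors gives one recurrence for all indices;
    zero satisfies every lower bound on \<open>ord\<close>.\<close>
  define c1 where "c1 i = (if i = 0 then 0 else c (i - 1))" for i
  define c2 where "c2 i = (if i = 0 \<or> i = 1 then 0 else c (i - 2))" for i
  have rec: "c i + \<sigma> * c i ^ ?Q + u * c i ^ ?R = \<kappa> * c1 i ^ ?Q + \<eta> * c1 i ^ ?R - \<epsilon> * c2 i ^ ?R" for i
    using rec_module_nth[OF f(1), of i] by (cases "i = 0"; cases "i = 1") (simp_all add: c_def c1_def c2_def power_0_left)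
  have c: "ord (c i) \<ge> ereal m" "ord (c1 i) \<ge> ereal m" "ord (c2 i) \<ge> ereal m" for i
    using mn(2) by (simp_all add: c_def c1_def c2_def)
  note QR = q_powers
  have Q1: "1 \<le> real ?Q" using QR(1) by linarith
  have ge0: "ord \<kappa> \<ge> ereal 0" "ord \<sigma> \<ge> ereal 0" "ord u \<ge> ereal w" "ord 1 \<ge> ereal 0" using \<kappa> \<sigma> u by (simp_all add: zero_ereal_def)
  have gtw: "ord \<eta> > ereal w" "ord \<epsilon> > ereal w" using \<eta> \<epsilon> u by simp_all
  have top: "ord (\<eta> * c1 i ^ ?R) > ereal (w + real ?R * m)" "ord (\<epsilon> * c2 i ^ ?R) > ereal (w + real ?R * m)" for i
    by (rule ord_mult_power_gt'[OF gtw(1) c(2)], rule ord_mult_power_gt'[OF gtw(2) c(3)])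
  consider (A) "m > 0" | (B) "m \<le> 0" "real ?Q * m \<le> w + real ?R * m" | (C) "m \<le> 0" "real ?Q * m > w + real ?R * m" by linarith
  then show False
  proof cases
    case A
    have gt: "ereal m < x" if "ereal (a + real k * m) \<le> x" "a \<ge> 0" "k > 1" for a k x
    proof -
      have "1 * m < real k * m" using A that(3) by (intro mult_strict_right_mono) auto
      then have "ereal m < ereal (a + real k * m)" using that(2) by simp
      then show ?thesis using that(1) by (rule less_le_trans)
    qed
    have "c n = \<kappa> * c1 n ^ ?Q + \<eta> * c1 n ^ ?R - \<epsilon> * c2 n ^ ?R - \<sigma> * c n ^ ?Q - u * c n ^ ?R"
      using rec[of n] by (simp add: algebra_simps)
    also have "ord \<dots> > ereal m"
      using QR u(2) by (intro ord_diff_gt ord_add_gt gt[OF ord_mult_power_ge[OF ge0(1) c(2)]]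
          gt[OF ord_mult_power_ge[OF ge0(2) c(1)]] gt[OF ord_mult_power_ge[OF ge0(3) c(1)]]
          gt[OF less_imp_le[OF top(1)]] gt[OF less_imp_le[OF top(2)]]) auto
    finally show False using mn(1) by (simp add: c_def)
  next
    case B
    let ?i = "Suc n"
    have cn: "ord (c ?i) > ereal m" using mn(3) by (simp add: c_def)
    have c1: "c1 ?i = c n" by (simp add: c1_def)
    have lt: "ereal (real ?Q * m) < x" if "ereal (w + real ?R * m) < x" for x
    proof -
      have "ereal (real ?Q * m) \<le> ereal (w + real ?R * m)" using B(2) by simp
      then show ?thesis using that by (rule le_less_trans)
    qed
    have "real ?Q * m \<le> 1 * m" using Q1 B(1) by (rule mult_right_mono_neg)
    then have "ereal (real ?Q * m) \<le> ereal m" by simp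
    then have 1: "ord (c ?i) > ereal (real ?Q * m)" using cn by (rule le_less_trans)
    have 2: "ord (\<sigma> * c ?i ^ ?Q) > ereal (real ?Q * m)"
      using ord_mult_power_gt[OF ge0(2) cn, of ?Q] QR by simp
    have 3: "ord (u * c ?i ^ ?R) > ereal (real ?Q * m)"
      by (rule lt[OF ord_mult_power_gt[OF ge0(3) cn]]) (use QR in simp)
    have "\<kappa> * c n ^ ?Q = c ?i + \<sigma> * c ?i ^ ?Q + u * c ?i ^ ?R - \<eta> * c1 ?i ^ ?R + \<epsilon> * c2 ?i ^ ?R"
      using rec[of ?i] by (simp add: c1 algebra_simps)
    also have "ord \<dots> > ereal (real ?Q * m)"
      by (intro ord_diff_gt ord_add_gt 1 2 3 lt[OF top(1)] lt[OF top(2)])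
    finally show False using mn(1) \<kappa> by (simp add: c_def ord_mult ord_power)
  next
    case C
    have lt: "ereal (w + real ?R * m) < x" if "ereal (real ?Q * m) \<le> x" for x
    proof -
      have "ereal (w + real ?R * m) < ereal (real ?Q * m)" using C(2) by simp
      then show ?thesis using that by (rule less_le_trans)
    qed
    have "real ?Q * m \<le> 1 * m" using Q1 C(1) by (rule mult_right_mono_neg)
    then have "ereal (real ?Q * m) \<le> ereal m" by simp
    then have "ereal (real ?Q * m) \<le> ord (c n)" using c(1) by (rule order.trans)
    then have 1: "ord (c n) > ereal (w + real ?R * m)" by (rule lt)
    have 2: "ord (\<sigma> * c n ^ ?Q) > ereal (w + real ?R * m)"
      using lt[OF ord_mult_power_ge[OF ge0(2) c(1), of ?Q n, unfolded add_0_left]] .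
    have 3: "ord (\<kappa> * c1 n ^ ?Q) > ereal (w + real ?R * m)"
      using lt[OF ord_mult_power_ge[OF ge0(1) c(2), of ?Q n, unfolded add_0_left]] .
    have "u * c n ^ ?R = \<kappa> * c1 n ^ ?Q + \<eta> * c1 n ^ ?R - \<epsilon> * c2 n ^ ?R - c n - \<sigma> * c n ^ ?Q"
      using rec[of n] by (simp add: algebra_simps)
    also have "ord \<dots> > ereal (w + real ?R * m)"
      by (intro ord_diff_gt ord_add_gt 1 2 3 top)
    finally show False using mn(1) u(1) by (simp add: c_def ord_mult ord_power)
  qed
qed

text \<open>Substitute f = b g and cancel one factor \<open>b\<close>; a q^k-th power keeps the
  factor b^(q^k - 1).\<close>

lemma rec_module_rescale:
  assumes "b \<noteq> 0" "f \<in> rec_module \<sigma> u \<kappa> \<eta> \<epsilon>"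
  shows "fps_const (inverse b) * f \<in>
    rec_module (\<sigma> * b ^ (q\<^sup>2 - 1)) (u * b ^ (q ^ 4 - 1)) (\<kappa> * b ^ (q\<^sup>2 - 1)) (\<eta> * b ^ (q ^ 4 - 1)) (\<epsilon> * b ^ (q ^ 4 - 1))"
proof (rule rec_moduleI)
  show "fps_const (inverse b) * f \<in> tate" using assms(2) by (intro tate_const_mult) (simp add: rec_module_def)
  define g where "g = fps_const (inverse b) * f"
  have fg: "fps_nth f j = b * fps_nth g j" for j using assms(1) by (simp add: g_def)
  have Q: "b ^ q\<^sup>2 = b * b ^ (q\<^sup>2 - 1)" "b ^ q ^ 4 = b * b ^ (q ^ 4 - 1)"
    by (simp_all add: power_eq_if)
  fix i
  have "b * (fps_nth g i + \<sigma> * b ^ (q\<^sup>2 - 1) * fps_nth g i ^ q\<^sup>2 + u * b ^ (q ^ 4 - 1) * fps_nth g i ^ q ^ 4) =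
    b * (if i = 0 then 0 else \<kappa> * b ^ (q\<^sup>2 - 1) * fps_nth g (i - 1) ^ q\<^sup>2 + \<eta> * b ^ (q ^ 4 - 1) * fps_nth g (i - 1) ^ q ^ 4
      - (if i = 1 then 0 else \<epsilon> * b ^ (q ^ 4 - 1) * fps_nth g (i - 2) ^ q ^ 4))"
    using rec_module_nth[OF assms(2), of i] unfolding fg power_mult_distrib Q
    by (simp add: algebra_simps split: if_splits)
  then show "fps_nth (fps_const (inverse b) * f) i + \<sigma> * b ^ (q\<^sup>2 - 1) * fps_nth (fps_const (inverse b) * f) i ^ q\<^sup>2
     + u * b ^ (q ^ 4 - 1) * fps_nth (fps_const (inverse b) * f) i ^ q ^ 4 =
    (if i = 0 then 0 else \<kappa> * b ^ (q\<^sup>2 - 1) * fps_nth (fps_const (inverse b) * f) (i - 1) ^ q\<^sup>2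
      + \<eta> * b ^ (q ^ 4 - 1) * fps_nth (fps_const (inverse b) * f) (i - 1) ^ q ^ 4
      - (if i = 1 then 0 else \<epsilon> * b ^ (q ^ 4 - 1) * fps_nth (fps_const (inverse b) * f) (i - 2) ^ q ^ 4))"
    using assms(1) unfolding g_def[symmetric] mult_cancel_left by simp
qed

text \<open>The part of the Newton polygon used below: if all roots have valuation below
  \<open>y\<close>, the constant term strictly dominates at valuation \<open>y\<close>. Splitting
  off X - a multiplies the constant term by -a, while both contributions a g_k and g_(k-1) to any
  other coefficient remain strictly heavier because ord a < y.\<close>

lemma ord_roots_less:
  fixes f :: "'c poly"
  assumes "f \<noteq> 0" "\<And>x. poly f x = 0 \<Longrightarrow> ord x < ereal y"
  shows "coeff f 0 \<noteq> 0 \<and> (\<forall>k>0. ord (coeff f k) + ereal (real k * y) > ord (coeff f 0))"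
  using assms
proof (induction "degree f" arbitrary: f)
  case 0
  then obtain c where "f = [:c:]" using degree_eq_zeroE by metis
  then show ?case using 0 ord_finite[of c] by (auto simp: coeff_pCons split: nat.splits)
next
  case (Suc n)
  obtain a where a: "poly f a = 0" using poly_root[of f] Suc.hyps by auto
  then obtain g where f: "f = [:- a, 1:] * g" by (auto simp: poly_eq_0_iff_dvd elim: dvdE)
  have g: "g \<noteq> 0" using f Suc.prems(1) by auto
  then have dg: "n = degree g" using Suc.hyps(2) unfolding f by (subst (asm) degree_mult_eq) auto
  have "ord x < ereal y" if "poly g x = 0" for x using Suc.prems(2)[of x] that by (simp add: f)
  then have IH: "coeff g 0 \<noteq> 0" "\<And>k. k > 0 \<Longrightarrow> ord (coeff g k) + ereal (real k * y) > ord (coeff g 0)"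
    using Suc.hyps(1)[OF dg g] by blast+
  obtain s where s: "ord (coeff g 0) = ereal s" using IH(1) ord_finite by blast
  have "ord a < ereal y" using Suc.prems(2)[OF a] .
  moreover from this have "a \<noteq> 0" by auto
  ultimately obtain r where r: "ord a = ereal r" "r < y" using ord_finite[of a] by (metis less_ereal.simps(1))
  have c0: "coeff f 0 = - (a * coeff g 0)" by (simp add: f)
  have gt: "ord (coeff f k) > ereal (r + s - real k * y)" if k: "k > 0" for k
  proof -
    obtain j where j: "k = Suc j" using k by (cases k) auto
    have "coeff f k = - (a * coeff g k) + coeff g j" by (simp add: f j)
    moreover have "ord (coeff g k) > ereal (s - real k * y)"
      using IH(2)[OF k] s by (cases "ord (coeff g k)") auto
    then have "ord (- (a * coeff g k)) > ereal (r + s - real k * y)"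
      by (cases "ord (coeff g k)") (auto simp: ord_mult r)
    moreover have "ord (coeff g j) \<ge> ereal (s - real j * y)"
      using IH(2)[of j] s by (cases "j = 0"; cases "ord (coeff g j)") auto
    then have "ord (coeff g j) > ereal (r + s - real k * y)"
      using r(2) by (cases "ord (coeff g j)") (auto simp: j algebra_simps)
    ultimately show ?thesis using ord_add_gt by metis
  qed
  have "ord (coeff f k) + ereal (real k * y) > ord (coeff f 0)" if "k > 0" for k
    using gt[OF that] unfolding c0 ord_minus ord_mult r s by (cases "ord (coeff f k)") auto
  then show ?case using \<open>a \<noteq> 0\<close> IH(1) c0 by auto
qed

text \<open>If all roots of u X^(q^4) + \<sigma> X^(q^2) + X - R had valuation below
  \<open>y\<close>, the constant term -R would strictly dominate each of the other three at
  valuation \<open>y\<close>, against the assumption on \<open>R\<close>.\<close>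

lemma additive_poly_small_root:
  assumes u: "u \<noteq> 0"
    and R: "ord R \<ge> ereal y \<or> ord R \<ge> ord \<sigma> + ereal (real (q\<^sup>2) * y) \<or> ord R \<ge> ord u + ereal (real (q ^ 4) * y)"
  shows "\<exists>x. x + \<sigma> * x ^ q\<^sup>2 + u * x ^ q ^ 4 = R \<and> ord x \<ge> ereal y"
proof -
  define f where "f = monom u (q ^ 4) + monom \<sigma> (q\<^sup>2) + monom 1 1 - [:R:]"
  note QR = q_powers
  have c: "coeff f (q ^ 4) = u" "coeff f (q\<^sup>2) = \<sigma>" "coeff f 1 = 1" "coeff f 0 = - R"
    using QR by (auto simp: f_def coeff_pCons split: nat.splits)
  have f0: "f \<noteq> 0" using c(1) u by auto
  have "\<exists>x. poly f x = 0 \<and> ord x \<ge> ereal y"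
  proof (rule ccontr)
    assume "\<not> ?thesis"
    then have "\<And>x. poly f x = 0 \<Longrightarrow> ord x < ereal y" by (meson not_le)
    from ord_roots_less[OF f0 this] have gt: "\<And>k. k > 0 \<Longrightarrow> ord R < ord (coeff f k) + ereal (real k * y)"
      using c(4) by simp
    have "ord R < ereal y" using gt[of 1] c(3) by simp
    moreover have "ord R < ord \<sigma> + ereal (real (q\<^sup>2) * y)" using gt[of "q\<^sup>2"] c(2) QR by simp
    moreover have "ord R < ord u + ereal (real (q ^ 4) * y)" using gt[of "q ^ 4"] c(1) QR by simp
    ultimately show False using R by auto
  qed
  then obtain x where "poly f x = 0" "ord x \<ge> ereal y" by blast
  then show ?thesis by (auto simp: f_def poly_monom algebra_simps intro!: exI[of _ x])
qed

end

section \<open>The rank four case\<close>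

text \<open>\<open>expand\<close> is the interface to the Newton polygon estimates: from two
  coefficients of valuation at least \<open>x\<close> a next one can be chosen with a gain
  \<open>\<delta>\<close> independent of \<open>x\<close>.\<close>

locale expanding_recurrence = C_infinity q \<theta> ord for q and \<theta> :: "'c::field" and ord +
  fixes \<sigma> u \<kappa> \<eta> \<epsilon> :: 'c and \<delta> :: real
  assumes u_nonzero: "u \<noteq> 0" and \<delta>_pos: "\<delta> > 0"
    and expand: "ord c \<ge> ereal x \<Longrightarrow> ord c' \<ge> ereal x \<Longrightarrow>
      \<exists>d. d + \<sigma> * d ^ q\<^sup>2 + u * d ^ q ^ 4 = \<kappa> * c ^ q\<^sup>2 + \<eta> * c ^ q ^ 4 - \<epsilon> * c' ^ q ^ 4 \<and> ord d \<ge> ereal (x + \<delta>)"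
begin

abbreviation S where "S \<equiv> rec_module \<sigma> u \<kappa> \<eta> \<epsilon>"

sublocale S: Fq_T_submodule q \<theta> ord S
  by (rule Fq_T_submodule_rec_module)

definition P where "P d = d + \<sigma> * d ^ q\<^sup>2 + u * d ^ q ^ 4"

definition rhs where "rhs c c' = \<kappa> * c ^ q\<^sup>2 + \<eta> * c ^ q ^ 4 - \<epsilon> * c' ^ q ^ 4"

definition W where "W = {w. P w = 0}"

lemma P_add: "P (a + b) = P a + P b"
  by (simp add: P_def frob_add algebra_simps)

lemma P_scale: assumes "l \<in> Fq q" shows "P (l * b) = l * P b"
proof -
  have "l ^ q\<^sup>2 = l" "l ^ q ^ 4 = l" using Fq_power[OF assms] by blast+
  then show ?thesis by (simp add: P_def power_mult_distrib algebra_simps)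
qed

lemma W_add: "a \<in> W \<Longrightarrow> b \<in> W \<Longrightarrow> a + b \<in> W"
  and W_scale: "l \<in> Fq q \<Longrightarrow> b \<in> W \<Longrightarrow> l * b \<in> W"
  by (simp_all add: W_def P_add P_scale)

lemma W_0: "0 \<in> W"
  by (simp add: W_def P_def power_0_left)

lemma W_sum: "(\<And>i. i \<in> I \<Longrightarrow> h i \<in> W) \<Longrightarrow> sum h I \<in> W"
  by (induction I rule: infinite_finite_induct) (auto intro: W_0 W_add)

text \<open>The exponents q^2 and q^4 vanish in C_infinity, so the derivative is 1 and all roots are
  simple.\<close>

lemma card_W: "card W = q ^ 4"
proof -
  define f where "f = monom u (q ^ 4) + monom \<sigma> (q\<^sup>2) + monom 1 1"
  note QR = q_powers
  have cf: "coeff f i = (if i = q ^ 4 then u else 0) + (if i = q\<^sup>2 then \<sigma> else 0) + (if i = 1 then 1 else 0)" for i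
    by (simp add: f_def)
  have deg: "degree f = q ^ 4"
  proof (rule antisym)
    show "degree f \<le> q ^ 4" using QR by (intro degree_le) (auto simp: cf)
    show "q ^ 4 \<le> degree f" using QR u_nonzero by (intro le_degree) (auto simp: cf)
  qed
  have "pderiv f = 1"
    by (simp add: f_def pderiv_add pderiv_monom of_nat_power power_0_left monom_0 one_pCons)
  then have "poly (pderiv f) x \<noteq> 0" for x by simp
  moreover have "f \<noteq> 0" using deg QR by auto
  ultimately have "card {x. poly f x = 0} = q ^ 4" using card_roots_simple[of f] deg by simp
  moreover have "{x. poly f x = 0} = W" by (auto simp: f_def W_def P_def poly_monom algebra_simps)
  ultimately show ?thesis by simp
qed

lemma finite_W: "finite W"
  using card_W by (intro card_ge_0_finite) simp

lemma rec_module_P: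
  assumes "f \<in> S"
  shows "P (fps_nth f i) = rhs (if i = 0 then 0 else fps_nth f (i - 1)) (if i = 0 \<or> i = 1 then 0 else fps_nth f (i - 2))"
  using rec_module_nth[OF assms, of i] unfolding P_def rhs_def
  by (cases "i = 0"; cases "i = 1") (simp_all add: power_0_left)

lemma next_coefficient:
  "\<exists>N. \<forall>c c'. P (N c c') = rhs c c' \<and> (\<forall>x. ord c \<ge> ereal x \<longrightarrow> ord c' \<ge> ereal x \<longrightarrow> ord (N c c') \<ge> ereal (x + \<delta>))"
proof -
  have "\<exists>d. P d = rhs c c' \<and> (\<forall>x. ord c \<ge> ereal x \<longrightarrow> ord c' \<ge> ereal x \<longrightarrow> ord d \<ge> ereal (x + \<delta>))" for c c'
  proof (cases "c = 0 \<and> c' = 0")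
    \<comment> \<open>One value must satisfy the bound for all \<open>x\<close> at once. If both
      arguments vanish there is no largest admissible \<open>x\<close>, and only the choice 0 works;
      otherwise the minimum of the two valuations is used.\<close>
    case True
    then show ?thesis by (intro exI[of _ 0]) (simp add: P_def rhs_def power_0_left)
  next
    case False
    have "min (ord c) (ord c') \<noteq> \<infinity>" using False ord_eq_PInf_iff[of c] ord_eq_PInf_iff[of c'] by (auto simp: min_def)
    moreover have "min (ord c) (ord c') \<noteq> - \<infinity>" using ord_not_MInf[of c] ord_not_MInf[of c'] by (auto simp: min_def)
    ultimately obtain x where x: "min (ord c) (ord c') = ereal x" by (cases "min (ord c) (ord c')") auto
    have "ord c \<ge> ereal x" "ord c' \<ge> ereal x" unfolding x[symmetric] by auto
    then obtain d where d: "P d = rhs c c'" "ord d \<ge> ereal (x + \<delta>)"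
      using expand[of x c c'] unfolding P_def rhs_def by blast
    have "ord d \<ge> ereal (y + \<delta>)" if "ord c \<ge> ereal y" "ord c' \<ge> ereal y" for y
    proof -
      have "ereal y \<le> ereal x" using that unfolding x[symmetric] by simp
      then have "ereal (y + \<delta>) \<le> ereal (x + \<delta>)" by simp
      then show ?thesis using d(2) by (rule order.trans)
    qed
    then show ?thesis using d(1) by blast
  qed
  then have "\<forall>p. \<exists>d. P d = rhs (fst p) (snd p) \<and>
      (\<forall>x. ord (fst p) \<ge> ereal x \<longrightarrow> ord (snd p) \<ge> ereal x \<longrightarrow> ord d \<ge> ereal (x + \<delta>))" by blast
  from choice[OF this] obtain g where g: "\<And>p. P (g p) = rhs (fst p) (snd p) \<and>
      (\<forall>x. ord (fst p) \<ge> ereal x \<longrightarrow> ord (snd p) \<ge> ereal x \<longrightarrow> ord (g p) \<ge> ereal (x + \<delta>))" by blast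
  show ?thesis
  proof (intro exI[of _ "\<lambda>c c'. g (c, c')"] allI)
    fix c c'
    show "P (g (c, c')) = rhs c c' \<and> (\<forall>x. ord c \<ge> ereal x \<longrightarrow> ord c' \<ge> ereal x \<longrightarrow> ord (g (c, c')) \<ge> ereal (x + \<delta>))"
      using g[of "(c, c')"] unfolding fst_conv snd_conv .
  qed
qed

text \<open>Iterating \<open>N\<close> from the constant term \<open>w\<close> gives a Tate series
  because every step gains valuation; \<open>sq\<close> carries the last two coefficients.\<close>

lemma solution_extends:
  assumes w: "w \<in> W" "w \<noteq> 0"
  shows "\<exists>f\<in>S. fps_nth f 0 = w \<and> (\<forall>i>0. ord (fps_nth f i) > ord w)"
proof -
  obtain N where N: "\<And>c c'. P (N c c') = rhs c c'"
    "\<And>c c' x. ord c \<ge> ereal x \<Longrightarrow> ord c' \<ge> ereal x \<Longrightarrow> ord (N c c') \<ge> ereal (x + \<delta>)"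
    using next_coefficient by blast
  obtain r where r: "ord w = ereal r" using w(2) ord_finite by blast
  define sq where "sq = rec_nat (w, 0) (\<lambda>_ p. (N (fst p) (snd p), fst p))"
  define f where "f = Abs_fps (\<lambda>i. fst (sq i))"
  have sq: "sq 0 = (w, 0)" "\<And>i. sq (Suc i) = (N (fst (sq i)) (snd (sq i)), fst (sq i))"
    by (simp_all add: sq_def)
  have snd_sq: "snd (sq (Suc i)) = fst (sq i)" for i by (simp add: sq)
  \<comment> \<open>A coefficient depends on its two predecessors, so the gain
    \<open>\<delta>\<close> is guaranteed only over two steps; hence \<open>\<delta> / 2\<close> per
    index.\<close>
  have bound: "ord (fst (sq i)) \<ge> ereal (r + \<delta> * real i / 2) \<and> ord (snd (sq i)) \<ge> ereal (r + \<delta> * (real i - 1) / 2)" for i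
  proof (induction i)
    case 0
    have "r \<le> r" by simp
    then show ?case by (simp add: sq r)
  next
    case (Suc i)
    have "\<delta> * (real i - 1) \<le> \<delta> * real i" using \<delta>_pos by simp
    then have "ereal (r + \<delta> * (real i - 1) / 2) \<le> ereal (r + \<delta> * real i / 2)" by simp
    then have "ord (fst (sq i)) \<ge> ereal (r + \<delta> * (real i - 1) / 2)" using Suc by (blast intro: order.trans)
    then have "ord (fst (sq (Suc i))) \<ge> ereal (r + \<delta> * (real i - 1) / 2 + \<delta>)"
      using N(2) Suc unfolding sq(2) fst_conv by blast
    moreover have "r + \<delta> * (real i - 1) / 2 + \<delta> = r + \<delta> * real (Suc i) / 2" by (simp add: algebra_simps)
    ultimately show ?case using Suc by (simp add: snd_sq)
  qed
  have "f \<in> tate"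
    unfolding tate_iff
  proof
    fix b :: real
    have "eventually (\<lambda>i. real i > (b - r) * 2 / \<delta>) sequentially"
      by (rule eventually_compose_filterlim[OF eventually_gt_at_top filterlim_real_sequentially])
    then show "eventually (\<lambda>i. ord (fps_nth f i) > ereal b) sequentially"
    proof eventually_elim
      case (elim i)
      then have "b < r + \<delta> * real i / 2" using \<delta>_pos by (simp add: divide_less_eq mult.commute)
      then have "ereal b < ereal (r + \<delta> * real i / 2)" by simp
      then show ?case unfolding f_def fps_nth_Abs_fps using bound[of i] by (blast intro: less_le_trans)
    qed
  qed
  moreover have "P (fps_nth f i) = rhs (if i = 0 then 0 else fps_nth f (i - 1)) (if i = 0 \<or> i = 1 then 0 else fps_nth f (i - 2))" for i
  proof -
    consider "i = 0" | "i = 1" | j where "i = Suc (Suc j)" by (metis One_nat_def not0_implies_Suc)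
    then show ?thesis
    proof cases
      case 1
      then show ?thesis using w(1) by (simp add: f_def sq W_def rhs_def power_0_left)
    next
      case 2
      then show ?thesis by (simp add: f_def sq N)
    next
      case 3
      then show ?thesis by (simp add: f_def sq N)
    qed
  qed
  then have "fps_nth f i + \<sigma> * fps_nth f i ^ q\<^sup>2 + u * fps_nth f i ^ q ^ 4 =
    (if i = 0 then 0 else \<kappa> * fps_nth f (i - 1) ^ q\<^sup>2 + \<eta> * fps_nth f (i - 1) ^ q ^ 4
      - (if i = 1 then 0 else \<epsilon> * fps_nth f (i - 2) ^ q ^ 4))" for i
    unfolding P_def rhs_def by (cases "i = 0"; cases "i = 1") (simp_all add: power_0_left)
  ultimately have "f \<in> S" by (intro rec_moduleI)
  moreover have "fps_nth f 0 = w" by (simp add: f_def sq)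
  moreover have "ord (fps_nth f i) > ord w" if "i > 0" for i
  proof -
    have "ord w < ereal (r + \<delta> * real i / 2)" using that \<delta>_pos by (simp add: r)
    then show ?thesis unfolding f_def fps_nth_Abs_fps using bound[of i] by (blast intro: less_le_trans)
  qed
  ultimately show ?thesis by blast
qed

section \<open>Orthogonal F_q-bases of the root space\<close>

definition Fq_span :: "nat \<Rightarrow> (nat \<Rightarrow> 'c) \<Rightarrow> 'c set" where
  "Fq_span n ws = {\<Sum>j<n. l j * ws j | l. \<forall>j<n. l j \<in> Fq q}"

lemma Fq_spanI: "(\<And>j. j < n \<Longrightarrow> l j \<in> Fq q) \<Longrightarrow> (\<Sum>j<n. l j * ws j) \<in> Fq_span n ws"
  unfolding Fq_span_def by blast

lemma Fq_span_image: "Fq_span n ws = (\<lambda>l. \<Sum>j<n. l j * ws j) ` ({..<n} \<rightarrow>\<^sub>E Fq q)"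
proof (intro equalityI subsetI)
  fix x assume "x \<in> Fq_span n ws"
  then obtain l where l: "\<forall>j<n. l j \<in> Fq q" "x = (\<Sum>j<n. l j * ws j)" by (auto simp: Fq_span_def)
  then have "x = (\<Sum>j<n. restrict l {..<n} j * ws j)" "restrict l {..<n} \<in> {..<n} \<rightarrow>\<^sub>E Fq q" by auto
  then show "x \<in> (\<lambda>l. \<Sum>j<n. l j * ws j) ` ({..<n} \<rightarrow>\<^sub>E Fq q)" by blast
qed (auto simp: Fq_span_def)

lemma finite_Fq_functions: "finite ({..<n::nat} \<rightarrow>\<^sub>E (Fq q :: 'c set))" and card_Fq_functions: "card ({..<n::nat} \<rightarrow>\<^sub>E (Fq q :: 'c set)) = q ^ n"
  by (auto intro: finite_PiE simp: finite_Fq card_PiE card_Fq)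

lemma card_Fq_span: "card (Fq_span n ws) \<le> q ^ n"
  unfolding Fq_span_image using card_image_le[OF finite_Fq_functions] card_Fq_functions by metis

text \<open>With the ultrametric inequality this says that a nontrivial combination has the least
  valuation among the vectors it involves; nonzero elements of F_q have valuation 0.\<close>

definition orthogonal :: "nat \<Rightarrow> (nat \<Rightarrow> 'c) \<Rightarrow> bool" where
  "orthogonal n ws \<longleftrightarrow> (\<forall>j<n. ws j \<in> W) \<and>
    (\<forall>l. (\<forall>j<n. l j \<in> Fq q) \<longrightarrow> (\<exists>j<n. l j \<noteq> 0) \<longrightarrow>
       (\<Sum>j<n. l j * ws j) \<noteq> 0 \<and> (\<forall>j<n. l j \<noteq> 0 \<longrightarrow> ord (\<Sum>j<n. l j * ws j) \<le> ord (ws j)))"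

lemma orthogonalD:
  assumes "orthogonal n ws"
  shows "j < n \<Longrightarrow> ws j \<in> W"
    and "(\<And>j. j < n \<Longrightarrow> l j \<in> Fq q) \<Longrightarrow> j < n \<Longrightarrow> l j \<noteq> 0 \<Longrightarrow>
      (\<Sum>j<n. l j * ws j) \<noteq> 0 \<and> ord (\<Sum>j<n. l j * ws j) \<le> ord (ws j)"
  using assms unfolding orthogonal_def by blast+

text \<open>Each new vector is chosen of maximal valuation outside the span of its predecessors; then no
  cancellation occurs in linear combinations.\<close>

lemma orthogonal_family_aux:
  assumes "n \<le> 4"
  shows "\<exists>ws. orthogonal n ws \<and> (\<forall>x\<in>W - Fq_span n ws. \<forall>j<n. ord x \<le> ord (ws j))"
  using assms
proof (induction n)
  case 0
  show ?case by (simp add: orthogonal_def)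
next
  case (Suc n)
  have "n \<le> 4" using Suc.prems by simp
  from Suc.IH[OF this] obtain ws where o: "orthogonal n ws" and
    o': "\<forall>x\<in>W - Fq_span n ws. \<forall>j<n. ord x \<le> ord (ws j)" by blast
  have ws1: "ws j \<in> W" if "j < n" for j using o that by (simp add: orthogonal_def)
  have ws2: "(\<Sum>j<n. l j * ws j) \<noteq> 0 \<and> (\<forall>j<n. l j \<noteq> 0 \<longrightarrow> ord (\<Sum>j<n. l j * ws j) \<le> ord (ws j))"
    if "\<forall>j<n. l j \<in> Fq q" "\<exists>j<n. l j \<noteq> 0" for l
    using o that unfolding orthogonal_def by blast
  have ws3: "ord x \<le> ord (ws j)" if "x \<in> W - Fq_span n ws" "j < n" for x j using o' that by blast
  \<comment> \<open>Counting shows that fewer than four vectors cannot span, so a further vector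
    exists.\<close>
  have "card (Fq_span n ws) < card W"
  proof -
    have "q ^ n < q ^ 4" using Suc.prems by (intro power_strict_increasing q_gt_1) simp
    then show ?thesis using card_Fq_span[of n ws] unfolding card_W by simp
  qed
  moreover have "finite (Fq_span n ws)" unfolding Fq_span_image by (intro finite_imageI finite_Fq_functions)
  ultimately have "\<not> W \<subseteq> Fq_span n ws" using card_mono[of "Fq_span n ws" W] by linarith
  then have ne: "W - Fq_span n ws \<noteq> {}" by blast
  have fin: "finite (W - Fq_span n ws)" using finite_W by simp
  define M where "M = Max (ord ` (W - Fq_span n ws))"
  have "M \<in> ord ` (W - Fq_span n ws)" unfolding M_def using fin ne by (intro Max_in) auto
  then obtain w where w: "w \<in> W - Fq_span n ws" "M = ord w" by blast
  have max: "ord x \<le> ord w" if "x \<in> W - Fq_span n ws" for x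
    unfolding w(2)[symmetric] M_def using fin that by (intro Max_ge) auto
  define ws' where "ws' j = (if j = n then w else ws j)" for j
  have ws': "ws' n = w" "\<And>j. j < n \<Longrightarrow> ws' j = ws j" by (simp_all add: ws'_def)
  have sum': "(\<Sum>j<Suc n. l j * ws' j) = (\<Sum>j<n. l j * ws j) + l n * w" for l
    by (simp add: ws')
  have sub: "Fq_span n ws \<subseteq> Fq_span (Suc n) ws'"
  proof
    fix x assume "x \<in> Fq_span n ws"
    then obtain l where l: "\<forall>j<n. l j \<in> Fq q" "x = (\<Sum>j<n. l j * ws j)" by (auto simp: Fq_span_def)
    then have "x = (\<Sum>j<Suc n. (l(n := 0)) j * ws' j)" "\<forall>j<Suc n. (l(n := 0)) j \<in> Fq q"
      unfolding sum' by (auto simp: less_Suc_eq)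
    then show "x \<in> Fq_span (Suc n) ws'" unfolding Fq_span_def by blast
  qed
  have comb: "(\<Sum>j<Suc n. l j * ws' j) \<noteq> 0 \<and> (\<forall>j<Suc n. l j \<noteq> 0 \<longrightarrow> ord (\<Sum>j<Suc n. l j * ws' j) \<le> ord (ws' j))"
    if l: "\<And>j. j < Suc n \<Longrightarrow> l j \<in> Fq q" and nz: "\<exists>j<Suc n. l j \<noteq> 0" for l
  proof (cases "l n = 0")
    case True
    have "\<exists>j<n. l j \<noteq> 0" using nz True by (auto simp: less_Suc_eq)
    then have "(\<Sum>j<n. l j * ws j) \<noteq> 0 \<and> (\<forall>j<n. l j \<noteq> 0 \<longrightarrow> ord (\<Sum>j<n. l j * ws j) \<le> ord (ws j))"
      using ws2[of l] l by simp
    then show ?thesis unfolding sum' using True ws' by (simp add: less_Suc_eq)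
  next
    case False
    let ?s = "\<Sum>j<Suc n. l j * ws' j"
    have sW: "?s \<in> W" using l ws1 w(1) by (intro W_sum W_scale) (auto simp: ws'_def less_Suc_eq)
    have notin: "?s \<notin> Fq_span n ws"
    proof
      assume "?s \<in> Fq_span n ws"
      then obtain k where k: "\<forall>j<n. k j \<in> Fq q" "?s = (\<Sum>j<n. k j * ws j)" by (auto simp: Fq_span_def)
      then have "l n * w = (\<Sum>j<n. (k j - l j) * ws j)" unfolding sum' by (simp add: left_diff_distrib sum_subtractf algebra_simps)
      then have "w = (\<Sum>j<n. (k j - l j) * ws j) / l n" using False by (simp add: eq_divide_eq mult.commute)
      also have "\<dots> = (\<Sum>j<n. ((k j - l j) / l n) * ws j)" by (simp add: sum_divide_distrib)
      also have "\<dots> \<in> Fq_span n ws" using k(1) l by (intro Fq_spanI Fq_divide Fq_diff) auto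
      finally have "w \<in> Fq_span n ws" .
      then show False using w(1) by blast
    qed
    have "0 \<in> Fq_span n ws" using Fq_spanI[of n "\<lambda>_. 0" ws] by simp
    then have "?s \<noteq> 0" using notin by auto
    \<comment> \<open>The combination lies outside the old span: the choice of \<open>w\<close>
      bounds its valuation by that of \<open>w\<close>, the induction hypothesis by those of the
      earlier vectors.\<close>
    moreover have "ord ?s \<le> ord (ws' j)" if "j < Suc n" for j
      using max[of ?s] ws3[of ?s j] sW notin that ws' by (cases "j = n") auto
    ultimately show ?thesis by blast
  qed
  have out: "ord x \<le> ord (ws' j)" if "x \<in> W - Fq_span (Suc n) ws'" "j < Suc n" for x j
  proof -
    have "x \<in> W - Fq_span n ws" using that(1) sub by blast
    then show ?thesis using max[of x] ws3[of x j] that(2) ws' by (cases "j = n") auto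
  qed
  have "ws' j \<in> W" if "j < Suc n" for j using that ws1 w(1) by (auto simp: ws'_def)
  then have "orthogonal (Suc n) ws'" unfolding orthogonal_def using comb by blast
  then show ?case using out by blast
qed

text \<open>Distinct coefficient families give distinct combinations, so the span has q^4 elements,
  as many as \<open>W\<close>.\<close>

lemma orthogonal_basis: "\<exists>ws. orthogonal 4 ws \<and> W \<subseteq> Fq_span 4 ws"
proof -
  obtain ws where o: "orthogonal 4 ws" using orthogonal_family_aux[of 4] by blast
  have "inj_on (\<lambda>l. \<Sum>j<4. l j * ws j) ({..<4} \<rightarrow>\<^sub>E Fq q)"
  proof (rule inj_onI)
    fix l k assume l: "l \<in> {..<4} \<rightarrow>\<^sub>E Fq q" and k: "k \<in> {..<4} \<rightarrow>\<^sub>E Fq q"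
      and eq: "(\<Sum>j<4. l j * ws j) = (\<Sum>j<4. k j * ws j)"
    have "(\<Sum>j<4. (l j - k j) * ws j) = 0" using eq by (simp only: left_diff_distrib sum_subtractf) simp
    moreover have "l j - k j \<in> Fq q" if "j < 4" for j using l k that by (intro Fq_diff) auto
    ultimately have "l j - k j = 0" if "j < 4" for j using orthogonalD(2)[OF o, of "\<lambda>j. l j - k j" j] that by blast
    then show "l = k" by (intro PiE_ext[OF l k]) simp
  qed
  then have "card (Fq_span 4 ws) = q ^ 4"
    unfolding Fq_span_image by (simp only: card_image card_Fq_functions)
  moreover have "Fq_span 4 ws \<subseteq> W"
    unfolding Fq_span_def using orthogonalD(1)[OF o] by (auto intro!: W_sum W_scale)
  ultimately have "Fq_span 4 ws = W" using card_W finite_W by (intro card_subset_eq) simp_all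
  then show ?thesis using o by blast
qed

section \<open>A basis of the module of solutions\<close>

lemma S_diff: "f \<in> S \<Longrightarrow> g \<in> S \<Longrightarrow> f - g \<in> S"
  using S.S_add[of f "fps_of_poly [:- 1:] * g"] S.S_mult[OF polys_Fq_const[OF Fq_minus[OF Fq_1]], of g]
  by (simp add: fps_of_poly_pCons fps_const_neg[symmetric] del: fps_const_neg)

text \<open>By \<open>expand\<close> the equation for index \<open>n\<close> has another solution
  \<open>d\<close> of larger valuation; the difference is a root with the valuation of the
  coefficient. Hence minimal valuations of nonzero solutions are among those of the finitely many
  roots.\<close>

lemma min_ord_in_W:
  assumes "f \<in> S" "ord (fps_nth f n) = ereal m" "\<And>i. ord (fps_nth f i) \<ge> ereal m"
  shows "\<exists>w\<in>W. ord w = ereal m"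
proof -
  let ?c = "if n = 0 then 0 else fps_nth f (n - 1)" and ?c' = "if n = 0 \<or> n = 1 then 0 else fps_nth f (n - 2)"
  have "ord ?c \<ge> ereal m" "ord ?c' \<ge> ereal m" using assms(3) by simp_all
  then obtain d where d: "P d = rhs ?c ?c'" "ord d \<ge> ereal (m + \<delta>)"
    using expand[of m ?c ?c'] unfolding P_def rhs_def by blast
  have "P (fps_nth f n - d + d) = P (fps_nth f n - d) + P d" by (rule P_add)
  then have "fps_nth f n - d \<in> W" using d(1) rec_module_P[OF assms(1), of n] by (simp add: W_def)
  moreover have "ereal m < ereal (m + \<delta>)" using \<delta>_pos by simp
  then have "ord (fps_nth f n) < ord (- d)" unfolding assms(2) ord_minus using d(2) by (rule less_le_trans)
  then have "ord (fps_nth f n + - d) = ereal m" using ord_add_eq assms(2) by metis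
  ultimately show ?thesis by (intro bexI[of _ "fps_nth f n - d"]) simp_all
qed

text \<open>Solutions whose leading coefficients form an orthogonal basis of \<open>W\<close>. Subtracting a
  combination of them and dividing by $T$ removes one of the finitely many coefficients of minimal
  valuation, or raises the minimal valuation, which takes finitely many values.\<close>

lemma generated:
  assumes ws: "orthogonal 4 ws" "W \<subseteq> Fq_span 4 ws"
    and b: "\<And>j. j < 4 \<Longrightarrow> b j \<in> S" "\<And>j. j < 4 \<Longrightarrow> fps_nth (b j) 0 = ws j"
      "\<And>j i. j < 4 \<Longrightarrow> i > 0 \<Longrightarrow> ord (fps_nth (b j) i) > ord (ws j)"
    and f: "f \<in> S"
  shows "\<exists>p. (\<forall>j<4::nat. p j \<in> polys_over (Fq q)) \<and> f = (\<Sum>j<4. fps_of_poly (p j) * b j)"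
proof -
  define gen where "gen f \<longleftrightarrow> (\<exists>p. (\<forall>j<4::nat. p j \<in> polys_over (Fq q)) \<and> f = (\<Sum>j<4. fps_of_poly (p j) * b j))" for f
  have gen0: "gen 0" unfolding gen_def by (intro exI[of _ "\<lambda>_. 0"]) (simp add: polys_over_def)
  \<comment> \<open>\<open>n\<close> bounds the indices at which the minimal valuation
    \<open>m\<close> may occur. Removing the constant term and dividing by T lowers \<open>n\<close>
    by one; at \<open>n = 0\<close> the valuation has risen above \<open>m\<close>.\<close>
  have step: "gen f"
    if base: "\<And>f. f \<in> S \<Longrightarrow> (\<And>i. ord (fps_nth f i) > ereal m) \<Longrightarrow> gen f"
      and f: "f \<in> S" "\<And>i. ord (fps_nth f i) \<ge> ereal m" "\<And>i. i \<ge> n \<Longrightarrow> ord (fps_nth f i) > ereal m" for m n f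
    using f
  proof (induction n arbitrary: f)
    case 0
    then show ?case by (intro base) auto
  next
    case (Suc n)
    define w where "w = fps_nth f 0"
    have "w \<in> W" using rec_module_P[OF Suc.prems(1), of 0] by (simp add: w_def W_def rhs_def power_0_left)
    then have "w \<in> Fq_span 4 ws" using ws(2) by blast
    then obtain l where l: "\<forall>j<4. l j \<in> Fq q" "w = (\<Sum>j<4. l j * ws j)" unfolding Fq_span_def by blast
    define g where "g = (\<Sum>j<4. fps_of_poly [:l j:] * b j)"
    have gS: "g \<in> S" unfolding g_def using l(1) b(1) by (intro S.S_sum S.S_mult polys_Fq_const) auto
    have g_nth: "fps_nth g i = (\<Sum>j<4. l j * fps_nth (b j) i)" for i
      by (simp add: g_def fps_sum_nth fps_of_poly_const)
    have "fps_nth g 0 = w" unfolding g_nth l(2) using b(2) by (intro sum.cong) auto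
    then have d0: "fps_nth (f - g) 0 = 0" by (simp add: w_def)
    define f' where "f' = fps_shift 1 (f - g)"
    have d: "f - g = fps_X * f'" unfolding f'_def using d0 by (intro fps_ext) simp
    then have f'S: "f' \<in> S" using S_diff[OF Suc.prems(1) gS] S.S_shift[of f'] by simp
    \<comment> \<open>Orthogonality enters here: every basis vector used to represent
      \<open>w\<close> has valuation at least ord w \<ge> m, and the higher coefficients of its
      solution exceed that.\<close>
    have ord_g: "ord (fps_nth g i) > ereal m" if "i > 0" for i
      unfolding g_nth
    proof (rule ord_sum_gt)
      fix j assume "j \<in> {..<4::nat}"
      then have j: "j < 4" by simp
      show "ord (l j * fps_nth (b j) i) > ereal m"
      proof (cases "l j = 0")
        case False
        have "ereal m \<le> ord w" using Suc.prems(2)[of 0] by (simp add: w_def)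
        also have "ord w \<le> ord (ws j)" using orthogonalD(2)[OF ws(1), of l j] l j False by simp
        also have "\<dots> < ord (fps_nth (b j) i)" by (rule b(3)[OF j that])
        finally show ?thesis using ord_Fq[of "l j"] l(1) j False by (simp add: ord_mult)
      qed simp
    qed
    have f'_nth: "fps_nth f' i = fps_nth f (Suc i) - fps_nth g (Suc i)" for i by (simp add: f'_def)
    have "gen f'"
    proof (rule Suc.IH[OF f'S])
      show "ord (fps_nth f' i) \<ge> ereal m" for i
        unfolding f'_nth by (rule ord_diff_ge[OF Suc.prems(2) less_imp_le[OF ord_g]]) simp
      show "ord (fps_nth f' i) > ereal m" if "n \<le> i" for i
        unfolding f'_nth by (rule ord_diff_gt[OF Suc.prems(3) ord_g]) (use that in simp_all)
    qed
    then obtain p where p: "\<forall>j<4. p j \<in> polys_over (Fq q)" "f' = (\<Sum>j<4. fps_of_poly (p j) * b j)"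
      unfolding gen_def by blast
    have "f = g + fps_X * f'" using d by (simp add: algebra_simps)
    also have "\<dots> = (\<Sum>j<4. fps_of_poly (pCons (l j) (p j)) * b j)"
      unfolding g_def p(2) sum_distrib_left sum.distrib[symmetric]
      by (intro sum.cong refl) (simp add: fps_of_poly_pCons algebra_simps)
    finally have "f = (\<Sum>j<4. fps_of_poly (pCons (l j) (p j)) * b j)" .
    moreover have "\<forall>j<4. pCons (l j) (p j) \<in> polys_over (Fq q)" using l(1) p(1) by (auto intro: polys_Fq_pCons)
    ultimately show ?case unfolding gen_def by (intro exI[of _ "\<lambda>j. pCons (l j) (p j)"]) simp
  qed
  \<comment> \<open>The induction counts the nonzero roots of valuation above \<open>m\<close>.
    Passing to the true minimum m' of f removes at least the root of valuation m' supplied by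
    \<open>min_ord_in_W\<close>.\<close>
  have above: "gen f" if "f \<in> S" "\<And>i. ord (fps_nth f i) > ereal m" for f m
    using that
  proof (induction "card {w \<in> W. w \<noteq> 0 \<and> ord w > ereal m}" arbitrary: f m rule: less_induct)
    case less
    show ?case
    proof (cases "f = 0")
      case False
      have ft: "f \<in> tate" using less.prems(1) by (simp add: rec_module_def)
      obtain m' n where mn: "ord (fps_nth f n) = ereal m'" "\<forall>i. ord (fps_nth f i) \<ge> ereal m'"
        "\<forall>i>n. ord (fps_nth f i) > ereal m'"
        using tate_min_attained[OF ft False] by blast
      obtain w where w: "w \<in> W" "ord w = ereal m'"
        using min_ord_in_W[OF less.prems(1) mn(1)] mn(2) by blast
      have mm: "ereal m < ereal m'" using less.prems(2)[of n] unfolding mn(1) .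
      have "w \<in> {w \<in> W. w \<noteq> 0 \<and> ord w > ereal m}" using w mm by auto
      moreover have "w \<notin> {w \<in> W. w \<noteq> 0 \<and> ord w > ereal m'}" using w by auto
      moreover have "{w \<in> W. w \<noteq> 0 \<and> ord w > ereal m'} \<subseteq> {w \<in> W. w \<noteq> 0 \<and> ord w > ereal m}"
        using less_trans[OF mm] by blast
      ultimately have "{w \<in> W. w \<noteq> 0 \<and> ord w > ereal m'} \<subset> {w \<in> W. w \<noteq> 0 \<and> ord w > ereal m}" by blast
      then have "card {w \<in> W. w \<noteq> 0 \<and> ord w > ereal m'} < card {w \<in> W. w \<noteq> 0 \<and> ord w > ereal m}"
        using finite_W by (intro psubset_card_mono) auto
      from less.hyps[OF this] show ?thesis
        by (rule step[OF _ less.prems(1), of m' "Suc n"]) (use mn in auto)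
    qed (simp add: gen0)
  qed
  have "gen f"
  proof (cases "f = 0")
    case False
    have ft: "f \<in> tate" using f by (simp add: rec_module_def)
    obtain m n where mn: "\<forall>i. ord (fps_nth f i) \<ge> ereal m" using tate_min_attained[OF ft False] by blast
    have "ord (fps_nth f i) > ereal (m - 1)" for i
    proof -
      have "ereal (m - 1) < ereal m" by simp
      then show ?thesis using mn by (blast intro: less_le_trans)
    qed
    then show ?thesis using above[OF f] by blast
  qed (simp add: gen0)
  then show ?thesis unfolding gen_def .
qed

text \<open>In a relation the constant coefficients give an F_q-relation between the
  \<open>ws j\<close>, so they vanish; then T can be divided out and the argument repeated for the
  next coefficients.\<close>

lemma independent:
  assumes ws: "orthogonal 4 ws" and b: "\<And>j. j < 4 \<Longrightarrow> fps_nth (b j) 0 = ws j"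
    and p: "\<And>j. j < 4 \<Longrightarrow> p j \<in> polys_over (Fq q)"
    and 0: "(\<Sum>j<4::nat. fps_of_poly (p j) * b j) = 0"
  shows "j < 4 \<Longrightarrow> p j = 0"
proof -
  have c0: "coeff (p j) 0 = 0"
    if p: "\<And>j. j < 4 \<Longrightarrow> p j \<in> polys_over (Fq q)" "(\<Sum>j<4::nat. fps_of_poly (p j) * b j) = 0" and j: "j < 4" for p j
  proof -
    have "(\<Sum>j<4. coeff (p j) 0 * ws j) = fps_nth (\<Sum>j<4::nat. fps_of_poly (p j) * b j) 0"
      by (simp add: fps_sum_nth b)
    then have "(\<Sum>j<4. coeff (p j) 0 * ws j) = 0" unfolding p(2) by simp
    moreover have "coeff (p j) 0 \<in> Fq q" if "j < 4" for j using p(1)[OF that] by (simp add: polys_over_def)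
    ultimately show ?thesis using orthogonalD(2)[OF ws, of "\<lambda>j. coeff (p j) 0" j] j by blast
  qed
  have "coeff (p j) n = 0" if "j < 4" for n j
    using p 0 that
  proof (induction n arbitrary: p j)
    case 0
    from c0[OF this] show ?case .
  next
    case (Suc n)
    define p' where "p' j = poly_shift 1 (p j)" for j
    have pp: "p j = pCons 0 (p' j)" if "j < 4" for j
      using c0[OF Suc.prems(1,2) that]
      by (intro poly_eqI) (simp add: p'_def coeff_poly_shift coeff_pCons split: nat.splits)
    have "fps_X * (\<Sum>j<4. fps_of_poly (p' j) * b j) = (\<Sum>j<4. fps_of_poly (p j) * b j)"
      unfolding sum_distrib_left
      by (intro sum.cong refl) (simp add: pp fps_of_poly_pCons mult.assoc mult.left_commute)
    then have "(\<Sum>j<4. fps_of_poly (p' j) * b j) = 0" using Suc.prems(2) by simp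
    moreover have "p' j \<in> polys_over (Fq q)" if "j < 4" for j
      using Suc.prems(1)[OF that] by (simp add: polys_over_def p'_def coeff_poly_shift)
    ultimately have "coeff (p' j) n = 0" using Suc.IH Suc.prems(3) by blast
    then show ?case using pp[OF Suc.prems(3)] by simp
  qed
  then show "j < 4 \<Longrightarrow> p j = 0" by (intro poly_eqI) simp
qed

lemma basis_exists: "\<exists>B. S.fps_basis B \<and> card B = 4"
proof -
  obtain ws where ws: "orthogonal 4 ws" "W \<subseteq> Fq_span 4 ws" using orthogonal_basis by blast
  have ws0: "ws j \<noteq> 0" if "j < 4" for j
  proof -
    have "(\<Sum>i<4. (if i = j then 1 else 0) * ws i) \<noteq> 0"
      using orthogonalD(2)[OF ws(1), of "\<lambda>i. if i = j then 1 else 0" j] that by simp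
    moreover have "(\<Sum>i<4. (if i = j then 1 else 0) * ws i) = ws j"
    proof -
      have "(\<Sum>i<4. (if i = j then 1 else 0) * ws i) = (\<Sum>i<4. if i = j then ws i else 0)" by (intro sum.cong) auto
      then show ?thesis using that by (simp add: sum.delta)
    qed
    ultimately show ?thesis by simp
  qed
  have "\<forall>j. \<exists>f. j < 4 \<longrightarrow> f \<in> S \<and> fps_nth f 0 = ws j \<and> (\<forall>i>0. ord (fps_nth f i) > ord (ws j))"
    using solution_extends[OF orthogonalD(1)[OF ws(1)] ws0] by blast
  from choice[OF this] obtain b where b0: "\<forall>j<4. b j \<in> S \<and> fps_nth (b j) 0 = ws j \<and> (\<forall>i>0. ord (fps_nth (b j) i) > ord (ws j))"
    by blast
  have b: "b j \<in> S" "fps_nth (b j) 0 = ws j" "\<And>i. i > 0 \<Longrightarrow> ord (fps_nth (b j) i) > ord (ws j)" if "j < 4" for j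
    using b0 that by blast+
  have inj: "inj_on b {..<4::nat}"
  proof (rule inj_onI, rule ccontr)
    fix i j assume ij: "i \<in> {..<4::nat}" "j \<in> {..<4}" "b i = b j" "i \<noteq> j"
    \<comment> \<open>A repeated solution would give the nontrivial relation b_i - b_j = 0.\<close>
    define p :: "nat \<Rightarrow> 'c poly" where "p k = (if k = i then 1 else if k = j then - 1 else 0)" for k
    have "(\<Sum>k<4. fps_of_poly (p k) * b k) = (\<Sum>k<4. (if k = i then b i else 0) - (if k = j then b j else 0))"
      using ij(4) by (intro sum.cong) (auto simp: p_def fps_of_poly_uminus)
    also have "\<dots> = 0" using ij(1-3) by (simp add: sum_subtractf)
    finally have "(\<Sum>k<4. fps_of_poly (p k) * b k) = 0" .
    moreover have "p k \<in> polys_over (Fq q)" for k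
    proof -
      have "(1 :: 'c poly) \<in> polys_over (Fq q)" "(0 :: 'c poly) \<in> polys_over (Fq q)"
        using polys_Fq_const[OF Fq_1] by (simp_all add: polys_over_def one_pCons)
      then show ?thesis by (simp add: p_def polys_Fq_minus)
    qed
    ultimately have "p i = 0" using independent[OF ws(1) b(2), of p i] ij(1) by simp
    then show False by (simp add: p_def)
  qed
  have reindex: "(\<Sum>x\<in>b ` {..<4}. fps_of_poly (c x) * x) = (\<Sum>j<4. fps_of_poly (c (b j)) * b j)" for c
    by (simp add: sum.reindex[OF inj])
  have "S.fps_basis (b ` {..<4})"
    unfolding S.fps_basis_def
  proof (intro conjI ballI)
    show "b ` {..<4} \<subseteq> S" using b(1) by auto
    fix f assume f: "f \<in> S"
    obtain p where p: "\<forall>j<4. p j \<in> polys_over (Fq q)" "f = (\<Sum>j<4. fps_of_poly (p j) * b j)"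
      using generated[OF ws b f] by blast
    \<comment> \<open>\<open>fps_basis\<close> indexes coefficients by the basis elements
      themselves, so the numbering is inverted.\<close>
    define c where "c = (\<lambda>x\<in>b ` {..<4}. p (the_inv_into {..<4} b x))"
    have cb: "c (b j) = p j" if "j < 4" for j using that inj by (simp add: c_def the_inv_into_f_f)
    show "\<exists>!c. c \<in> b ` {..<4} \<rightarrow>\<^sub>E polys_over (Fq q) \<and> f = (\<Sum>x\<in>b ` {..<4}. fps_of_poly (c x) * x)"
    proof (rule ex1I[of _ c])
      have "c \<in> b ` {..<4} \<rightarrow>\<^sub>E polys_over (Fq q)"
      proof (rule PiE_I)
        show "c x \<in> polys_over (Fq q)" if "x \<in> b ` {..<4}" for x using that cb p(1) by auto
        show "c x = undefined" if "x \<notin> b ` {..<4}" for x using that by (simp add: c_def)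
      qed
      then show "c \<in> b ` {..<4} \<rightarrow>\<^sub>E polys_over (Fq q) \<and> f = (\<Sum>x\<in>b ` {..<4}. fps_of_poly (c x) * x)"
        unfolding reindex p(2) by (simp add: cb)
      fix c' assume c': "c' \<in> b ` {..<4} \<rightarrow>\<^sub>E polys_over (Fq q) \<and> f = (\<Sum>x\<in>b ` {..<4}. fps_of_poly (c' x) * x)"
      have c'j: "c' (b j) \<in> polys_over (Fq q)" if "j < 4" for j using c' that by auto
      have "(\<Sum>j<4. fps_of_poly (c' (b j) - p j) * b j) = (\<Sum>j<4. fps_of_poly (c' (b j)) * b j) - f"
        unfolding p(2) by (simp add: fps_of_poly_diff left_diff_distrib sum_subtractf)
      then have "(\<Sum>j<4. fps_of_poly (c' (b j) - p j) * b j) = 0" using c' unfolding reindex by simp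
      moreover have "c' (b j) - p j \<in> polys_over (Fq q)" if "j < 4" for j
        using polys_Fq_add[OF c'j[OF that] polys_Fq_minus[of "p j"]] p(1) that by simp
      ultimately have "c' (b j) - p j = 0" if "j < 4" for j
        using independent[OF ws(1) b(2), of "\<lambda>j. c' (b j) - p j" j] that by simp
      then have eq: "c' (b j) = c (b j)" if "j < 4" for j using that cb by simp
      show "c' = c"
        by (rule PiE_ext[OF conjunct1[OF c'] \<open>c \<in> b ` {..<4} \<rightarrow>\<^sub>E polys_over (Fq q)\<close>]) (use eq in auto)
    qed
  qed simp
  moreover have "card (b ` {..<4::nat}) = 4" using card_image[OF inj] by simp
  ultimately show ?thesis by blast
qed

end

section \<open>The theorem\<close>

context C_infinity
begin

text \<open>Here \<open>E\<close> is ord \<epsilon> and \<open>k\<close> bounds ord \<kappa> from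
  below. For arguments of valuation at least x the right hand side has valuation at least the
  minimum of k + q^2 x and E - q^3 + q^4 x. It remains to compare each bound with one of the three
  terms in \<open>additive_poly_small_root\<close> at y = x + \<delta>, with \<delta> independent of
  x.\<close>

lemma expanding_recurrence_exists:
  fixes E :: real
  defines "k \<equiv> min 0 E"
  assumes u: "ord u = ereal (E - real q ^ 2 - real q ^ 3)" and \<epsilon>: "ord \<epsilon> = ereal E"
    and \<eta>: "ord \<eta> \<ge> ereal (E - real q ^ 3)" and \<kappa>: "ord \<kappa> \<ge> ereal k"
    and cond: "ord \<sigma> < ereal k \<or> - (real q + 1) < E \<and> E < real q ^ 2 + real q ^ 3"
  shows "\<exists>\<delta>. expanding_recurrence q \<theta> ord \<sigma> u \<kappa> \<eta> \<epsilon> \<delta>"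
proof -
  define Q where "Q = real q ^ 2"
  define C where "C = real q ^ 3"
  have r: "real q > 1" using q_gt_1 by simp
  have C0: "C > 0" using r by (simp add: C_def)
  have Q0: "Q > 0" using r by (simp add: Q_def)
  have Q4: "real (q ^ 4) = Q * Q" "real (q\<^sup>2) = Q" by (simp_all add: Q_def power_mult[symmetric] power_add[symmetric])
  have u0: "u \<noteq> 0" using u by auto
  have rhs: "ord (\<kappa> * c ^ q\<^sup>2 + \<eta> * c ^ q ^ 4 - \<epsilon> * c' ^ q ^ 4) \<ge> ereal (min (k + Q * x) (E - C + Q * Q * x))"
    if c: "ord c \<ge> ereal x" "ord c' \<ge> ereal x" for c c' x
  proof -
    have "ord \<epsilon> \<ge> ereal (E - C)" using C0 by (simp add: \<epsilon>)
    then have "ord (\<epsilon> * c' ^ q ^ 4) \<ge> ereal (E - C + Q * Q * x)"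
      using ord_mult_power_ge[OF _ c(2), of "E - C" \<epsilon> "q ^ 4"] unfolding Q4 by simp
    moreover have "ord (\<kappa> * c ^ q\<^sup>2) \<ge> ereal (k + Q * x)"
      using ord_mult_power_ge[OF \<kappa> c(1), of "q\<^sup>2"] unfolding Q4 .
    moreover have "ord (\<eta> * c ^ q ^ 4) \<ge> ereal (E - C + Q * Q * x)"
      using ord_mult_power_ge[OF \<eta> c(1), of "q ^ 4"] unfolding Q4 C_def .
    ultimately show ?thesis by (intro ord_diff_ge ord_add_ge) (auto intro: order.trans[rotated])
  qed
  \<comment> \<open>If the bound E - q^3 + q^4 x is the smaller one, the u-term suffices for every
    x: ord u lies lower by q^2, which pays for \<delta> as long as q^2 \<delta> \<le> 1.\<close>
  have third: "ord u + ereal (Q * Q * (x + \<delta>)) \<le> R"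
    if "ereal (E - C + Q * Q * x) \<le> R" "Q * \<delta> \<le> 1" for x \<delta> R
  proof -
    have "Q * (Q * \<delta>) \<le> Q * 1" using that(2) Q0 by (intro mult_left_mono) auto
    then have "E - Q - C + Q * Q * (x + \<delta>) \<le> E - C + Q * Q * x" by (simp add: algebra_simps)
    then have "ord u + ereal (Q * Q * (x + \<delta>)) \<le> ereal (E - C + Q * Q * x)" by (simp add: u Q_def C_def)
    then show ?thesis using that(1) by (rule order.trans)
  qed
  consider (steep) h where "ord \<sigma> = ereal h" "h < k" | (middle) "- (real q + 1) < E" "E < Q + C"
  proof (cases "ord \<sigma> < ereal k")
    case True
    then show ?thesis using that(1) ord_not_MInf[of \<sigma>] by (cases "ord \<sigma>") auto
  next
    case False
    then show ?thesis using that(2) cond by (auto simp: Q_def C_def)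
  qed
  then obtain \<delta> where \<delta>: "\<delta> > 0" "Q * \<delta> \<le> 1"
    and small: "\<And>x. x + \<delta> \<le> k + Q * x \<or> ord \<sigma> + ereal (Q * (x + \<delta>)) \<le> ereal (k + Q * x)
      \<or> ord u + ereal (Q * Q * (x + \<delta>)) \<le> ereal (k + Q * x)"
  proof cases
    case steep
    \<comment> \<open>\<open>1 / Q\<close> is required by \<open>third\<close>;
      \<open>(k - h) / Q\<close> is the gain that the \<sigma>-term permits, the same for all
      x.\<close>
    define \<delta> where "\<delta> = min (1 / Q) ((k - h) / Q)"
    have "\<delta> \<le> 1 / Q" "\<delta> \<le> (k - h) / Q" by (simp_all add: \<delta>_def)
    then have d: "Q * \<delta> \<le> 1" "Q * \<delta> \<le> k - h" using Q0 by (simp_all add: le_divide_eq mult.commute)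
    have "ord \<sigma> + ereal (Q * (x + \<delta>)) \<le> ereal (k + Q * x)" for x
      using d(2) by (simp add: steep(1) algebra_simps)
    moreover have "\<delta> > 0" using steep(2) Q0 by (simp add: \<delta>_def)
    ultimately show ?thesis using that[of \<delta>] d(1) by blast
  next
    case middle
    \<comment> \<open>The linear term works for large x and the u-term for small x; \<open>D\<close>
      measures the overlap of the two ranges. Inserting q^2 x < x + \<delta> - k into the condition
      for the u-term leaves (q^4 + q^2) \<delta> \<le> D, and the bounds on \<open>E\<close> say
      that D > 0.\<close>
    define D where "D = (Q + 1) * k + Q + C - E"
    have D: "D > 0"
    proof (cases "E \<ge> 0")
      case True
      then show ?thesis using middle(2) by (simp add: D_def k_def)
    next
      case False
      then have "D = Q * (E + 1 + real q)"
        by (simp add: D_def k_def C_def Q_def algebra_simps power2_eq_square power3_eq_cube)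
      then show ?thesis using middle(1) Q0 by simp
    qed
    define \<delta> where "\<delta> = min (1 / Q) (D / (Q * Q + Q))"
    have QQ: "Q * Q + Q > 0" using Q0 by (intro add_pos_pos mult_pos_pos)
    have "\<delta> \<le> 1 / Q" "\<delta> \<le> D / (Q * Q + Q)" by (simp_all add: \<delta>_def)
    then have d: "Q * \<delta> \<le> 1" "(Q * Q + Q) * \<delta> \<le> D" using Q0 QQ by (simp_all add: le_divide_eq mult.commute)
    have "x + \<delta> \<le> k + Q * x \<or> ord u + ereal (Q * Q * (x + \<delta>)) \<le> ereal (k + Q * x)" for x
    proof (cases "x + \<delta> \<le> k + Q * x")
      case False
      then have "Q * (k + Q * x) \<le> Q * (x + \<delta>)" using Q0 by (intro mult_left_mono) auto
      then have "E - Q - C + Q * Q * (x + \<delta>) \<le> k + Q * x"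
        using d(2) unfolding D_def by (simp add: algebra_simps)
      then show ?thesis by (simp add: u Q_def C_def)
    qed simp
    moreover have "\<delta> > 0" using D Q0 QQ by (simp add: \<delta>_def)
    ultimately show ?thesis using that[of \<delta>] d(1) by blast
  qed
  have "expanding_recurrence q \<theta> ord \<sigma> u \<kappa> \<eta> \<epsilon> \<delta>"
  proof (unfold_locales)
    fix c c' x assume c: "ord c \<ge> ereal x" "ord c' \<ge> ereal x"
    let ?R = "\<kappa> * c ^ q\<^sup>2 + \<eta> * c ^ q ^ 4 - \<epsilon> * c' ^ q ^ 4"
    have "ord ?R \<ge> ereal (x + \<delta>) \<or> ord ?R \<ge> ord \<sigma> + ereal (real (q\<^sup>2) * (x + \<delta>))
      \<or> ord ?R \<ge> ord u + ereal (real (q ^ 4) * (x + \<delta>))"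
    proof (cases "E - C + Q * Q * x \<le> k + Q * x")
      case True
      then have "min (k + Q * x) (E - C + Q * Q * x) = E - C + Q * Q * x" by (rule min_absorb2)
      then have "ereal (E - C + Q * Q * x) \<le> ord ?R" using rhs[OF c] by (simp only:)
      then show ?thesis unfolding Q4 using third[OF _ \<delta>(2)] by blast
    next
      case False
      then have "min (k + Q * x) (E - C + Q * Q * x) = k + Q * x" by (intro min_absorb1) simp
      then have R: "ereal (k + Q * x) \<le> ord ?R" using rhs[OF c] by (simp only:)
      then show ?thesis unfolding Q4 using small[of x] order.trans[OF _ R] ereal_less_eq(3) by blast
    qed
    then show "\<exists>d. d + \<sigma> * d ^ q\<^sup>2 + u * d ^ q ^ 4 = ?R \<and> ord d \<ge> ereal (x + \<delta>)"
      by (rule additive_poly_small_root[OF u0])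
  qed (use u0 \<delta>(1) in simp_all)
  then show ?thesis by blast
qed

lemma fps_basis_empty:
  assumes "rec_module \<sigma> u \<kappa> \<eta> \<epsilon> = {0}"
  shows "Fq_T_submodule.fps_basis q (rec_module \<sigma> u \<kappa> \<eta> \<epsilon>) {}"
proof -
  interpret S: Fq_T_submodule q \<theta> ord "rec_module \<sigma> u \<kappa> \<eta> \<epsilon>" by (rule Fq_T_submodule_rec_module)
  show ?thesis unfolding S.fps_basis_def using assms by simp
qed

end

theorem theorem5p1:
  fixes q :: nat and \<theta> a12 a21 :: "'c::field" and ord :: "'c \<Rightarrow> ereal"
    and A :: "'c ^ 2 ^ 2" and v t :: ereal
  assumes "C_infinity q \<theta> ord"
    and "a21 \<noteq> 0"
    and "A = vector [vector [0, a12], vector [a21, 0]]"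
    and "v = ord a21"
    and "t = ord (\<theta> ^ q / a21 + \<theta> ^ (q\<^sup>2) / a21 ^ (q\<^sup>2) - a12 ^ q)"
  shows "(t \<ge> - v \<and> v \<le> ereal (- (real q)\<^sup>2 / (real q - 1)) \<or>
          t \<ge> - (ereal ((real q)\<^sup>2) * v) \<and> v \<ge> ereal (1 / (real q - 1))
            \<longrightarrow> h1 q \<theta> ord A = 0) \<and>
         (\<not> (t \<ge> - v \<and> v \<le> ereal (- (real q)\<^sup>2 / (real q - 1)) \<or>
             t \<ge> - (ereal ((real q)\<^sup>2) * v) \<and> v \<ge> ereal (1 / (real q - 1)))
            \<longrightarrow> h1 q \<theta> ord A = 4)"
proof -
  interpret C_infinity q \<theta> ord by fact
  define s where "s = \<theta> ^ q / a21 + \<theta> ^ (q\<^sup>2) / a21 ^ (q\<^sup>2) - a12 ^ q"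
  define \<epsilon> where "\<epsilon> = a21 / a21 ^ q\<^sup>2"
  define \<sigma> where "\<sigma> = a21 * s"
  define u where "u = \<theta> ^ (q ^ 2) * \<theta> ^ (q ^ 3) * \<epsilon>"
  define \<kappa> where "\<kappa> = 1 + \<epsilon>"
  define \<eta> where "\<eta> = (\<theta> ^ (q ^ 2) + \<theta> ^ (q ^ 3)) * \<epsilon>"
  let ?S = "rec_module \<sigma> u \<kappa> \<eta> \<epsilon>"
  have h1: "h1 q \<theta> ord A = card B" if "Fq_T_submodule.fps_basis q ?S B" for B
    by (rule h1_eq_card_fps_basis[OF assms(2,3)]) (use that in \<open>unfold \<sigma>_def u_def \<kappa>_def \<eta>_def \<epsilon>_def s_def\<close>)
  define r where "r = real q"
  have r: "r > 1" using q_gt_1 by (simp add: r_def)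
  then have r2: "r ^ 2 > 1" "r - 1 > 0" by simp_all
  obtain V where V: "ord a21 = ereal V" using assms(2) ord_finite by blast
  define E where "E = V - r ^ 2 * V"
  have ord_\<epsilon>: "ord \<epsilon> = ereal E"
    using assms(2) by (simp add: \<epsilon>_def ord_divide ord_power V E_def r_def)
  have ord_\<theta>: "ord (\<theta> ^ n) = ereal (- real n)" for n
    by (simp add: ord_power ord_theta one_ereal_def)
  have ord_u: "ord u = ereal (E - r ^ 2 - r ^ 3)"
    by (simp add: u_def ord_mult ord_\<theta> ord_\<epsilon> r_def)
  have "ord (\<theta> ^ (q ^ 2) + \<theta> ^ (q ^ 3)) \<ge> ereal (- (r ^ 3))"
  proof (rule ord_add_ge)
    show "ereal (- (r ^ 3)) \<le> ord (\<theta> ^ q ^ 2)"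
      using power_increasing[of 2 3 r] r unfolding ord_\<theta> by (simp add: r_def)
  qed (simp add: ord_\<theta> r_def)
  then have ord_\<eta>: "ord \<eta> \<ge> ereal (E - r ^ 3)"
    by (cases "ord (\<theta> ^ (q ^ 2) + \<theta> ^ (q ^ 3))") (auto simp: \<eta>_def ord_mult ord_\<epsilon>)
  have ord_\<kappa>: "ord \<kappa> \<ge> ereal (min 0 E)"
    unfolding \<kappa>_def by (rule ord_add_ge) (auto simp: ord_\<epsilon> zero_ereal_def)
  have ord_\<sigma>: "ord \<sigma> = ereal V + t"
    by (simp add: \<sigma>_def ord_mult V s_def assms(5))
  have t: "t \<noteq> - \<infinity>" unfolding assms(5) by (rule ord_not_MInf)
  have E_fact: "E = - (V * (r - 1)) * (r + 1)" by (simp add: E_def algebra_simps power2_eq_square)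
  have v: "v = ereal V" by (simp add: assms(4) V)
  \<comment> \<open>Multiplying the thresholds by r - 1 makes them comparable with E = -(V (r - 1))
    (r + 1).\<close>
  have c1: "v \<le> ereal (- (r ^ 2) / (r - 1)) \<longleftrightarrow> V * (r - 1) \<le> - (r ^ 2)"
    unfolding v ereal_less_eq by (rule pos_le_divide_eq[OF r2(2)])
  have c2: "v \<ge> ereal (1 / (r - 1)) \<longleftrightarrow> 1 \<le> V * (r - 1)"
    unfolding v ereal_less_eq by (rule pos_divide_le_eq[OF r2(2)])
  have E_V: "E = (r ^ 2 - 1) * (- V)" by (simp add: E_def algebra_simps)
  \<comment> \<open>\<open>D\<close> is ord u and \<open>F\<close> the lower bound for ord
    \<eta>.\<close>
  define D F where "D = E - r ^ 2 - r ^ 3" and "F = E - r ^ 3"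
  have "r ^ 3 > 0" "r ^ 2 > 0" using r by simp_all
  then have DF: "D < F" "D < E" unfolding D_def F_def by linarith+
  note ord_u' = ord_u[folded D_def] and ord_\<eta>' = ord_\<eta>[folded F_def]
  have trivial: "?S = {0}" if "t \<ge> - v" "v \<le> ereal (- (r ^ 2) / (r - 1))"
  proof -
    \<comment> \<open>The threshold for v is what makes u integral: multiplied by r + 1 it reads E
      \<ge> r^2 + r^3.\<close>
    have "r ^ 2 \<le> - (V * (r - 1))" using that(2) unfolding c1 by simp
    then have "r ^ 2 * (r + 1) \<le> E" unfolding E_fact using r by (intro mult_right_mono) auto
    then have w: "D \<ge> 0" by (simp add: D_def algebra_simps power2_eq_square power3_eq_cube)
    then have E0: "E > 0" using DF(2) by linarith
    show ?thesis
    proof (rule rec_module_trivial[OF _ _ ord_u' w])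
      show "ord \<kappa> = 0" unfolding \<kappa>_def using ord_add_eq[of 1 \<epsilon>] E0 by (simp add: ord_\<epsilon>)
      show "ord \<sigma> \<ge> 0" using that(1) unfolding ord_\<sigma> v by (cases t) auto
      have "ereal D < ereal F" using DF(1) by simp
      then show "ord \<eta> > ord u" unfolding ord_u' using ord_\<eta>' by (rule less_le_trans)
      show "ord \<epsilon> > ord u" unfolding ord_u' ord_\<epsilon> using DF(2) by simp
    qed
  qed
  have trivial': "?S = {0}" if "t \<ge> - (ereal (r ^ 2) * v)" "v \<ge> ereal (1 / (r - 1))"
  proof -
    \<comment> \<open>The exponents with which b = a21 enters in
      \<open>rec_module_rescale\<close>.\<close>
    define m n where "m = q\<^sup>2 - 1" and "n = q ^ 4 - 1"
    have mn: "real m = r ^ 2 - 1" "real n = r ^ 4 - 1"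
      using q_powers by (simp_all add: m_def n_def r_def of_nat_diff)
    have pw: "ord (a21 ^ m) = ereal ((r ^ 2 - 1) * V)" "ord (a21 ^ n) = ereal ((r ^ 4 - 1) * V)"
      by (simp_all add: ord_power V mn)
    have V1: "1 \<le> V * (r - 1)" using that(2) unfolding c2 .
    then have "V * (r - 1) > 0" by simp
    then have V0: "V > 0" using r2 by (simp add: zero_less_mult_iff)
    \<comment> \<open>The rescaled u has valuation (r^4 - r^2) V - r^2 - r^3, nonnegative precisely
      when V (r - 1) \<ge> 1.\<close>
    have "1 * (r + 1) \<le> V * (r - 1) * (r + 1)" using V1 r by (intro mult_right_mono) auto
    then have "r ^ 2 * (r + 1) \<le> r ^ 2 * (V * (r - 1) * (r + 1))" by (intro mult_left_mono) auto
    then have w: "D + (r ^ 4 - 1) * V \<ge> 0"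
      by (simp add: D_def E_def algebra_simps power2_eq_square power3_eq_cube power4_eq_xxxx)
    have "rec_module (\<sigma> * a21 ^ m) (u * a21 ^ n) (\<kappa> * a21 ^ m) (\<eta> * a21 ^ n) (\<epsilon> * a21 ^ n) = {0}"
    proof (rule rec_module_trivial[OF _ _ _ w])
      show "ord (u * a21 ^ n) = ereal (D + (r ^ 4 - 1) * V)"
        by (simp add: ord_mult ord_u' pw)
      \<comment> \<open>Rescaling turns \<epsilon> into 1 and the summand 1 of \<kappa> into a21^m,
        which has positive valuation; so \<kappa> becomes a unit.\<close>
      have "a21 * a21 ^ m = a21 ^ q\<^sup>2" using q_powers(1) by (simp add: m_def power_eq_if)
      then have "\<kappa> * a21 ^ m = 1 + a21 ^ m" using assms(2) by (simp add: \<kappa>_def \<epsilon>_def algebra_simps)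
      moreover have "ord (1 + a21 ^ m) = 0" using ord_add_eq[of 1 "a21 ^ m"] V0 r2 by (simp add: pw)
      ultimately show "ord (\<kappa> * a21 ^ m) = 0" by simp
      show "ord (\<sigma> * a21 ^ m) \<ge> 0"
        using that(1) unfolding ord_mult ord_\<sigma> v pw by (cases t) (auto simp: algebra_simps)
      show "ord (\<epsilon> * a21 ^ n) > ord (u * a21 ^ n)" unfolding ord_mult ord_u' ord_\<epsilon> pw using DF(2) by simp
      show "ord (\<eta> * a21 ^ n) > ord (u * a21 ^ n)"
        unfolding ord_mult ord_u' pw using ord_\<eta>' DF(1) by (cases "ord \<eta>") auto
    qed
    then have "fps_const (inverse a21) * f = 0" if "f \<in> ?S" for f
      using rec_module_rescale[OF assms(2) that] unfolding m_def n_def by blast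
    then have "?S \<subseteq> {0}" using assms(2) by auto
    moreover have "0 \<in> ?S" by (simp add: rec_module_def fps_frob_0)
    ultimately show ?thesis by blast
  qed
  have four: "h1 q \<theta> ord A = 4"
    if n1: "\<not> (t \<ge> - v \<and> v \<le> ereal (- (r ^ 2) / (r - 1)))"
      and n2: "\<not> (t \<ge> - (ereal (r ^ 2) * v) \<and> v \<ge> ereal (1 / (r - 1)))"
  proof -
    \<comment> \<open>If v satisfies one of the two thresholds, the matching bound on t fails, and
      this puts V + t below \<open>min 0 E\<close>, which is 0 for the first threshold and E for the
      second. If v satisfies neither, E lies in the open interval.\<close>
    have "ord \<sigma> < ereal (min 0 E) \<or> - (r + 1) < E \<and> E < r ^ 2 + r ^ 3"
    proof (cases "V * (r - 1) \<le> - (r ^ 2)")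
      case True
      then have "t < - v" using n1 unfolding c1 by (simp add: not_le)
      moreover have "V * (r - 1) < 0" using True r2(1) by linarith
      then have "V < 0" using r2(2) by (simp add: mult_less_0_iff)
      then have "E > 0" unfolding E_V using r2(1) by (intro mult_pos_pos) simp_all
      ultimately show ?thesis unfolding ord_\<sigma> v by (cases t) (auto simp: t)
    next
      case F1: False
      show ?thesis
      proof (cases "1 \<le> V * (r - 1)")
        case True
        then have "t < - (ereal (r ^ 2) * v)" using n2 unfolding c2 by (simp add: not_le)
        moreover have "V * (r - 1) > 0" using True by linarith
        then have "V > 0" using r2(2) by (simp add: zero_less_mult_iff)
        then have "E < 0" unfolding E_V using r2(1) by (intro mult_pos_neg) simp_all
        ultimately show ?thesis unfolding ord_\<sigma> v by (cases t) (auto simp: t E_def)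
      next
        case False
        then have "- 1 * (r + 1) < - (V * (r - 1)) * (r + 1)" using r by (intro mult_strict_right_mono) auto
        moreover have "- (V * (r - 1)) < r ^ 2" using F1 by linarith
        then have "- (V * (r - 1)) * (r + 1) < r ^ 2 * (r + 1)" using r by (intro mult_strict_right_mono) auto
        ultimately have "- (r + 1) < E" "E < r ^ 2 + r ^ 3"
          unfolding E_fact by (simp_all add: algebra_simps power2_eq_square power3_eq_cube)
        then show ?thesis by blast
      qed
    qed
    then obtain \<delta> where "expanding_recurrence q \<theta> ord \<sigma> u \<kappa> \<eta> \<epsilon> \<delta>"
      using expanding_recurrence_exists[of u E \<epsilon> \<eta> \<kappa> \<sigma>] ord_u ord_\<epsilon> ord_\<eta> ord_\<kappa> unfolding r_def by blast
    then interpret R: expanding_recurrence q \<theta> ord \<sigma> u \<kappa> \<eta> \<epsilon> \<delta> .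
    obtain B where "R.S.fps_basis B" "card B = 4" using R.basis_exists by blast
    then show ?thesis using h1[of B] by simp
  qed
  have zero: "h1 q \<theta> ord A = 0" if "?S = {0}"
    using h1[OF fps_basis_empty[OF that]] by simp
  show ?thesis
    unfolding r_def[symmetric] using zero[OF trivial] zero[OF trivial'] four by blast
qed

end
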